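(* For all $n\ge 3$ and $1\le k\le n-2$, the snowy twin peaks graph $STP_{n+1}^k$, which is the labelled unit interval graph on $n+1$ vertices given by the sequence $(m_i)_{i=1}^{n+1}$ with $m_1=k+1$, $m_2=n$, and $m_i=n+1$ for $3\le i\le n+1$, and its reverse graph $(STP_{n+1}^k)^r$, are both appendable $(e)$-positive.
   Context: All graphs are finite and simple with nonempty vertex set. A labelled graph on $d$ vertices is a graph with vertex set $[d]=\{1,\dots,d\}$. A labelled unit interval graph is a labelled graph $G$ such that whenever $i\le v<w\le j$ and $ij\in E(G)$, also $vw\in E(G)$; it is determined by the weakly increasing sequence $(m_i)$, where $m_i\ge i$ is the largest label in the closed neighbourhood of $i$ (so for $i<j$, $ij$ is an edge iff $j\le m_i$). The reverse graph $G^r$ of a labelled graph $G$ on $d$ vertices is obtained by relabelling each vertex $i$ as $d+1-i$. For a set partition $\pi$ of $[d]$, let $B_{\pi,i}$ be the block containing $i$, and let $e_\pi=\sum x_{i_1}\cdots x_{i_d}$ in noncommuting variables $x_1,x_2,\dots$, summed over all tuples $(i_1,\dots,i_d)$ of positive integers with $i_j\ne i_k$ whenever $j\neq k$ and $B_{\pi,j}=B_{\pi,k}$. The $e_\pi$, over set partitions $\pi$ of $[d]$, form a $\mathbb Q$-basis of $\mathrm{NCSym}^d$, the degree-$d$ part of the algebra of symmetric functions in noncommuting variables. For $d\ge 1$ let $\mathrm{type}(\pi)=(\lambda,b)$, where $b=|B_{\pi,d}|$ and $\lambda$ is the integer partition (possibly empty) formed by the sizes of the other blocks. $\mathrm{UBCSym}^d$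 is the $\mathbb Q$-vector space with basis $\{e_{(\lambda,b)}\}$ over pairs of a partition $\lambda$ and an integer $b\ge 1$ with $|\lambda|+b=d$, and $\nu:\mathrm{NCSym}^d\to\mathrm{UBCSym}^d$ is the linear map with $\nu(e_\pi)=e_{\mathrm{type}(\pi)}$. For a labelled graph $G$ on $d$ vertices, $Y_G=\sum_\kappa x_{\kappa(1)}\cdots x_{\kappa(d)}\in\mathrm{NCSym}^d$, summed over all proper colourings $\kappa:[d]\to\mathbb Z_{>0}$ of $G$, and $y_G=\nu(Y_G)$. $G$ is $(e)$-positive if all coefficients of $y_G$ in the basis $\{e_{(\lambda,b)}\}$ are nonnegative. For labelled graphs $G$ on $n$ vertices and $H$ on $m$ vertices, the concatenation $G+H$ is the labelled graph on $[n+m-1]$ obtained by placing $G$ on labels $1,\dots,n$ and $H$ on labels $n,\dots,n+m-1$ (vertex $i$ of $H$ becoming $n-1+i$), so vertex $n$ of $G$ is identified with vertex $1$ of $H$. A labelled graph $H$ is appendable $(e)$-positive if $G+H$ is $(e)$-positive for every $(e)$-positive labelled graph $G$. *)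

theory Defs
  imports Complex_Main "HOL-Library.Multiset" "HOL-Library.Disjoint_Sets"
begin

section \<open>Labelled graphs\<close>

text \<open>A pair \<open>(d, E)\<close> is the graph with vertex set \<open>{1..d}\<close> and edge set \<open>E\<close>.\<close>

type_synonym lgraph = "nat \<times> nat set set"

definition labelled_graph :: "lgraph \<Rightarrow> bool" where
  "labelled_graph G \<longleftrightarrow>
     1 \<le> fst G \<and> snd G \<subseteq> {{i, j} | i j. i \<in> {1..fst G} \<and> j \<in> {1..fst G} \<and> i \<noteq> j}"

definition labelled_unit_interval_graph :: "lgraph \<Rightarrow> bool" where
  "labelled_unit_interval_graph G \<longleftrightarrow> labelled_graph G \<and>
     (\<forall>i v w j. i \<le> v \<and> v < w \<and> w \<le> j \<and> {i, j} \<in> snd G \<longrightarrow> {v, w} \<in> snd G)"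

definition max_closed_nbr :: "lgraph \<Rightarrow> nat \<Rightarrow> nat" where
  "max_closed_nbr G i = Max (insert i {j. {i, j} \<in> snd G})"

definition unit_interval_graph :: "nat \<Rightarrow> (nat \<Rightarrow> nat) \<Rightarrow> lgraph" where
  "unit_interval_graph d m = (d, {{i, j} | i j. 1 \<le> i \<and> i < j \<and> j \<le> d \<and> j \<le> m i})"

definition reverse_graph :: "lgraph \<Rightarrow> lgraph" where
  "reverse_graph G = (fst G, (\<lambda>e. (\<lambda>i. fst G + 1 - i) ` e) ` snd G)"

definition concat_graph :: "lgraph \<Rightarrow> lgraph \<Rightarrow> lgraph" where
  "concat_graph G H =
     (fst G + fst H - 1, snd G \<union> (\<lambda>e. (\<lambda>i. fst G - 1 + i) ` e) ` snd H)"


section \<open>Symmetric functions in noncommuting variables\<close>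

text \<open>
  A formal power series over the rationals in noncommuting variables \<open>x\<^sub>1, x\<^sub>2, \<dots>\<close> is its
  coefficient function on words; the list \<open>[i\<^sub>1, \<dots>, i\<^sub>d]\<close> stands for the monomial
  \<open>x\<^bsub>i\<^sub>1\<^esub> \<dots> x\<^bsub>i\<^sub>d\<^esub>\<close>. List indices start at 0, so position \<open>j \<in> {1..d}\<close> of \<open>w\<close> is \<open>w ! (j - 1)\<close>.
\<close>

type_synonym nc_series = "nat list \<Rightarrow> rat"

text \<open>The formal sum of a set of (pairwise distinct) monomials.\<close>

definition monomial_sum :: "nat list set \<Rightarrow> nc_series" where
  "monomial_sum A = (\<lambda>w. if w \<in> A then 1 else 0)"

definition block :: "nat set set \<Rightarrow> nat \<Rightarrow> nat set" where
  "block \<pi> i = (THE B. B \<in> \<pi> \<and> i \<in> B)"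

definition e_nc :: "nat \<Rightarrow> nat set set \<Rightarrow> nc_series" where
  "e_nc d \<pi> = monomial_sum {w. length w = d \<and> (\<forall>i\<in>set w. 0 < i) \<and>
     (\<forall>j\<in>{1..d}. \<forall>k\<in>{1..d}. j \<noteq> k \<and> block \<pi> j = block \<pi> k \<longrightarrow> w ! (j - 1) \<noteq> w ! (k - 1))}"

text \<open>Distinct colourings of \<open>{1..d}\<close> give distinct words, so every coefficient is 0 or 1.\<close>

definition Y_graph :: "lgraph \<Rightarrow> nc_series" where
  "Y_graph G = monomial_sum {map \<kappa> [1..<Suc (fst G)] | \<kappa>.
     (\<forall>i\<in>{1..fst G}. 0 < \<kappa> i) \<and> (\<forall>i j. {i, j} \<in> snd G \<longrightarrow> \<kappa> i \<noteq> \<kappa> j)}"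

text \<open>
  The coordinates of an element of \<open>NCSym\<^sup>d\<close> in its basis \<open>e_nc d \<pi>\<close>, \<open>\<pi>\<close> ranging over the set
  partitions of \<open>{1..d}\<close>; existence and uniqueness of \<open>c\<close> is the fact that this is a basis.
  The value 0 outside set partitions only serves to make \<open>c\<close> unique as a total function.
\<close>

definition e_coeff :: "nat \<Rightarrow> nc_series \<Rightarrow> nat set set \<Rightarrow> rat" where
  "e_coeff d f = (THE c. (\<forall>\<pi>. \<not> partition_on {1..d} \<pi> \<longrightarrow> c \<pi> = 0) \<and>
     f = (\<lambda>w. \<Sum>\<pi> | partition_on {1..d} \<pi>. c \<pi> * e_nc d \<pi> w))"


section \<open>The space \<open>UBCSym\<^sup>d\<close> and (e)-positivity\<close>

text \<open>Integer partitions are multisets of positive integers.\<close>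

definition ubc_index :: "nat \<Rightarrow> (nat multiset \<times> nat) set" where
  "ubc_index d = {(l, b). 0 \<notin># l \<and> 1 \<le> b \<and> sum_mset l + b = d}"

definition ptype :: "nat \<Rightarrow> nat set set \<Rightarrow> nat multiset \<times> nat" where
  "ptype d \<pi> = (image_mset card (mset_set (\<pi> - {block \<pi> d})), card (block \<pi> d))"

text \<open>
  An element of \<open>UBCSym\<^sup>d\<close> is represented by its coordinates in the basis indexed by \<open>ubc_index d\<close>.
\<close>

type_synonym ubc = "nat multiset \<times> nat \<Rightarrow> rat"

definition e_ubc :: "nat multiset \<times> nat \<Rightarrow> ubc" where
  "e_ubc t = (\<lambda>s. if s = t then 1 else 0)"

text \<open>The linear extension of \<open>e_nc d \<pi> \<mapsto> e_ubc (ptype d \<pi>)\<close>.\<close>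

definition nu :: "nat \<Rightarrow> nc_series \<Rightarrow> ubc" where
  "nu d f = (\<lambda>s. \<Sum>\<pi> | partition_on {1..d} \<pi>. e_coeff d f \<pi> * e_ubc (ptype d \<pi>) s)"

definition y_graph :: "lgraph \<Rightarrow> ubc" where
  "y_graph G = nu (fst G) (Y_graph G)"

definition e_positive :: "lgraph \<Rightarrow> bool" where
  "e_positive G \<longleftrightarrow> (\<forall>t\<in>ubc_index (fst G). 0 \<le> y_graph G t)"

definition appendable_e_positive :: "lgraph \<Rightarrow> bool" where
  "appendable_e_positive H \<longleftrightarrow> labelled_graph H \<and>
     (\<forall>G. labelled_graph G \<and> e_positive G \<longrightarrow> e_positive (concat_graph G H))"


section \<open>Snowy twin peaks\<close>

definition stp_seq :: "nat \<Rightarrow> nat \<Rightarrow> nat \<Rightarrow> nat" where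
  "stp_seq d k i = (if i = 1 then k + 1 else if i = 2 then d - 1 else d)"

text \<open>The subscript \<open>d\<close> is the number of vertices.\<close>

definition STP :: "nat \<Rightarrow> nat \<Rightarrow> lgraph" where
  "STP d k = unit_interval_graph d (stp_seq d k)"

lemma edge_unit_interval_graph:
  "{i, j} \<in> snd (unit_interval_graph d m) \<longleftrightarrow>
     1 \<le> min i j \<and> i \<noteq> j \<and> max i j \<le> d \<and> max i j \<le> m (min i j)"
proof (cases "i < j")
  case True
  then show ?thesis
    by (auto simp: unit_interval_graph_def doubleton_eq_iff min_def max_def)
next
  case False
  then have "{i, j} \<in> snd (unit_interval_graph d m) \<longleftrightarrow>
      1 \<le> j \<and> j < i \<and> i \<le> d \<and> i \<le> m j"
    unfolding insert_commute[of i j "{}"]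
    by (auto simp: unit_interval_graph_def doubleton_eq_iff)
  with False show ?thesis
    by (auto simp: min_def max_def)
qed

lemma unit_interval_graph_correct:
  assumes "1 \<le> d"
    and mono: "\<And>i j. 1 \<le> i \<Longrightarrow> i \<le> j \<Longrightarrow> j \<le> d \<Longrightarrow> m i \<le> m j"
    and bounds: "\<And>i. 1 \<le> i \<Longrightarrow> i \<le> d \<Longrightarrow> i \<le> m i \<and> m i \<le> d"
  shows "labelled_unit_interval_graph (unit_interval_graph d m)"
    and "\<And>i. i \<in> {1..d} \<Longrightarrow> max_closed_nbr (unit_interval_graph d m) i = m i"
proof -
  have lg: "labelled_graph (unit_interval_graph d m)"
    using assms(1) by (fastforce simp: labelled_graph_def unit_interval_graph_def)
  show "labelled_unit_interval_graph (unit_interval_graph d m)"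
    unfolding labelled_unit_interval_graph_def
  proof (intro conjI lg allI impI)
    fix i v w j
    assume *: "i \<le> v \<and> v < w \<and> w \<le> j \<and> {i, j} \<in> snd (unit_interval_graph d m)"
    then have "1 \<le> i" "j \<le> d" "j \<le> m i"
      by (auto simp: edge_unit_interval_graph min_def max_def split: if_splits)
    moreover have "m i \<le> m v" using mono[of i v] * calculation by auto
    ultimately show "{v, w} \<in> snd (unit_interval_graph d m)"
      using * by (auto simp: edge_unit_interval_graph min_def max_def)
  qed
  fix i assume i: "i \<in> {1..d}"
  let ?S = "insert i {j. {i, j} \<in> snd (unit_interval_graph d m)}"
  have sub: "j \<le> m i" if "j \<in> ?S" for j
    using that bounds[of i] i by (auto simp: edge_unit_interval_graph min_def max_def split: if_splits)
  have "m i \<in> ?S"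
    using bounds[of i] i by (auto simp: edge_unit_interval_graph min_def max_def)
  moreover have "finite ?S" using sub by (meson finite_nat_set_iff_bounded_le)
  ultimately show "max_closed_nbr (unit_interval_graph d m) i = m i"
    unfolding max_closed_nbr_def using sub by (intro Max_eqI) auto
qed

lemma STP_correct:
  assumes "3 \<le> n" "1 \<le> k" "k \<le> n - 2"
  shows "labelled_unit_interval_graph (STP (n + 1) k)"
    and "max_closed_nbr (STP (n + 1) k) 1 = k + 1"
    and "max_closed_nbr (STP (n + 1) k) 2 = n"
    and "\<And>i. i \<in> {3..n + 1} \<Longrightarrow> max_closed_nbr (STP (n + 1) k) i = n + 1"
proof -
  have a: "1 \<le> n + 1" by simp
  have b: "stp_seq (n + 1) k i \<le> stp_seq (n + 1) k j" if "1 \<le> i" "i \<le> j" "j \<le> n + 1" for i j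
    using that assms by (auto simp: stp_seq_def)
  have c: "i \<le> stp_seq (n + 1) k i \<and> stp_seq (n + 1) k i \<le> n + 1" if "1 \<le> i" "i \<le> n + 1" for i
    using that assms by (auto simp: stp_seq_def)
  note u = unit_interval_graph_correct[where d = "n + 1" and m = "stp_seq (n + 1) k", OF a b c]
  show "labelled_unit_interval_graph (STP (n + 1) k)"
    unfolding STP_def using u(1) by blast
  have m: "max_closed_nbr (STP (n + 1) k) i = stp_seq (n + 1) k i" if "i \<in> {1..n + 1}" for i
    unfolding STP_def using u(2) that by blast
  show "max_closed_nbr (STP (n + 1) k) 1 = k + 1"
    by (subst m) (auto simp: stp_seq_def)
  show "max_closed_nbr (STP (n + 1) k) 2 = n"
    using assms by (subst m) (auto simp: stp_seq_def)
  show "max_closed_nbr (STP (n + 1) k) i = n + 1" if "i \<in> {3..n + 1}" for i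
    using that by (subst m) (auto simp: stp_seq_def)
qed

end

theory Submission
  imports Defs "HOL-Combinatorics.Transposition"
begin

text \<open>
  View \<open>Y_G\<close> as a function of colourings. Appending \<open>H\<close> multiplies it by a function of the
  new colours and of the colour of the shared vertex, so it suffices to append to disjoint unions of
  cliques, for which \<open>Y_G = e_\<pi>\<close>, and relabellings fixing the last vertex may be used freely. If a vertex
  \<open>v\<close> is joined to a subset \<open>T\<close> of a clique, then the indicator that the colour of \<open>v\<close> does not occur on
  \<open>T\<close> is \<open>1\<close> minus the sum of the coincidence indicators; if the vertices of the clique are
  interchangeable, the coefficients are thus affine in \<open>card T\<close>. Therefore a snowy twin peaks graph is a
  convex combination of graphs built from complete graphs and complete graphs minus an edge between
  the first and last vertex. For these two, a recurrence obtained by moving vertices between the two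
  cliques gives explicit nonnegative coefficients.
\<close>

text \<open>Coefficients are defined by a definite description, so none can be computed before the
  basis property is proved; it comes from Moebius inversion on set partitions. Since
  \<open>nu\<close> remembers only block sizes and which block holds the last vertex, relabellings
  must fix that vertex, and a coincidence with the last vertex has to be treated apart from all
  others. This is the obstacle in the two-clique computation: cliques sharing the last vertex
  generally have coefficients of both signs, and these enter the recurrence for cliques sharing
  another vertex. Nonnegativity therefore does not propagate along the recurrence and is read off
  from its solution. The binomial weights arise because each step divides by the size
  \<open>b\<close> of one clique and sums over the vertices of the other: the weights
  \<open>(s - 1) choose (b - 1)\<close> and \<open>(s - 1) * ((s - 2) choose (b - 1))\<close> absorb
  both factors.\<close>

section \<open>The clique functions form a basis\<close>

text \<open>The Moebius function of the partition lattice, from the discrete partition to \<open>\<rho>\<close>.\<close>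

definition mu :: "'a set set \<Rightarrow> rat" where
  "mu \<rho> = (\<Prod>B\<in>\<rho>. (- 1) ^ (card B - 1) * fact (card B - 1))"

definition const_on_blocks :: "('a \<Rightarrow> 'b) \<Rightarrow> 'a set set \<Rightarrow> bool" where
  "const_on_blocks \<phi> \<rho> \<longleftrightarrow> (\<forall>B\<in>\<rho>. \<forall>x\<in>B. \<forall>y\<in>B. \<phi> x = \<phi> y)"

lemma mu_nonzero: "mu \<rho> \<noteq> 0"
  by (cases "finite \<rho>") (auto simp: mu_def)

lemma finite_partitions: "finite S \<Longrightarrow> finite {\<rho>. partition_on S \<rho> \<and> P \<rho>}"
  by (rule finite_subset[of _ "Pow (Pow S)"]) (auto simp: partition_on_def)

text \<open>A block of size c contributes (-1)^(c-1) (c-1)!, so one more element multiplies this by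
  -c, while a new singleton contributes 1.\<close>

lemma mu_insert_block:
  assumes "finite S" "a \<notin> S" "partition_on S \<rho>" "B \<in> insert {} \<rho>"
  shows "mu (insert (insert a B) (\<rho> - {B})) = mu \<rho> * (if B = {} then 1 else - of_nat (card B))"
proof -
  have fin: "finite \<rho>" using assms finite_elements by blast
  have sub: "C \<subseteq> S" if "C \<in> \<rho>" for C using assms(3) that by (auto simp: partition_on_def)
  have aB: "a \<notin> B" "finite B" using assms sub finite_subset by auto
  have new: "insert a B \<notin> \<rho> - {B}" using sub assms(2) by auto
  let ?f = "\<lambda>B::'a set. (- 1) ^ (card B - 1) * fact (card B - 1) :: rat"
  have 1: "mu (insert (insert a B) (\<rho> - {B})) = ?f (insert a B) * mu (\<rho> - {B})"
    unfolding mu_def using fin new by simp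
  show ?thesis
  proof (cases "B = {}")
    case True
    then have "\<rho> - {B} = \<rho>" using assms(3) by (auto simp: partition_on_def)
    with 1 True show ?thesis by simp
  next
    case False
    then have B: "B \<in> \<rho>" using assms(4) by simp
    obtain c where c: "card B = Suc c" using False aB by (cases "card B") auto
    have "mu \<rho> = ?f B * mu (\<rho> - {B})"
      unfolding mu_def using fin B by (simp add: prod.remove)
    then show ?thesis using 1 False c aB by (simp add: algebra_simps)
  qed
qed

text \<open>The choice \<open>B = {}\<close> encodes putting \<open>a\<close> back as a singleton,
  so that one formula covers all ways of inserting \<open>a\<close>. The condition on
  \<open>B\<close> is exactly what keeps \<phi> constant on the enlarged block.\<close>

lemma bij_betw_partition_on_insert:
  assumes "a \<notin> S"
  shows "bij_betw (\<lambda>(\<rho>, B). insert (insert a B) (\<rho> - {B}))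
    (SIGMA \<rho>:{\<rho>. partition_on S \<rho> \<and> const_on_blocks \<phi> \<rho>}.
       insert {} {B \<in> \<rho>. \<forall>x\<in>B. \<phi> x = \<phi> a})
    {\<rho>. partition_on (insert a S) \<rho> \<and> const_on_blocks \<phi> \<rho>}"
    (is "bij_betw ?j ?X ?Y")
proof -
  define blk where "blk = (\<lambda>\<rho>. THE A. A \<in> \<rho> \<and> a \<in> A)"
  define i where "i = (\<lambda>\<rho>. ((\<rho> - {blk \<rho>}) \<union> ({blk \<rho> - {a}} - {{}}), blk \<rho> - {a}))"
  have blk: "blk \<rho> = A" if "partition_on T \<rho>" "A \<in> \<rho>" "a \<in> A" for \<rho> A T
    unfolding blk_def
  proof (rule the_equality)
    fix A' assume "A' \<in> \<rho> \<and> a \<in> A'"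
    then show "A' = A" using that by (metis disjnt_iff partition_onD2 pairwiseD disjoint_def IntI empty_iff)
  qed (use that in auto)
  have pj: "partition_on (insert a S) (insert (insert a B) (\<rho> - {B}))"
    if "partition_on S \<rho>" "B \<in> insert {} \<rho>" for \<rho> B
  proof -
    have 1: "\<Union> \<rho> = S" "disjoint \<rho>" "{} \<notin> \<rho>" using that by (auto simp: partition_on_def)
    have "\<Union> (insert (insert a B) (\<rho> - {B})) = insert a S" using 1 that(2) by auto
    moreover have "disjoint (insert (insert a B) (\<rho> - {B}))"
    proof -
      have "disjoint (\<rho> - {B})" using 1 by (meson Diff_subset pairwise_subset)
      moreover have "\<forall>C\<in>\<rho> - {B}. insert a B \<inter> C = {}"
        using 1 that(2) assms unfolding disjoint_def by blast
      ultimately show ?thesis by (auto simp: pairwise_insert disjnt_def Int_commute)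
    qed
    ultimately show ?thesis using 1 by (auto simp: partition_on_def)
  qed
  show ?thesis
  proof (rule bij_betw_byWitness[where f' = i])
    show "\<forall>p\<in>?X. i (?j p) = p"
    proof
      fix p assume "p \<in> ?X"
      then obtain \<rho> B where p: "p = (\<rho>, B)" "partition_on S \<rho>" "B \<in> insert {} \<rho>" by auto
      have sub: "C \<subseteq> S" if "C \<in> \<rho>" for C using p that by (auto simp: partition_on_def)
      have ne: "{} \<notin> \<rho>" using p by (auto simp: partition_on_def)
      have aB: "a \<notin> B" using p sub assms by auto
      have b: "blk (?j p) = insert a B" using blk[OF pj[OF p(2,3)], of "insert a B"] p(1) by simp
      have "insert a B \<notin> \<rho>" using sub assms by auto
      then have "(?j p - {insert a B}) \<union> ({B} - {{}}) = \<rho>" using p ne by auto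
      moreover have "insert a B - {a} = B" using aB by simp
      ultimately show "i (?j p) = p" using b p(1) unfolding i_def by simp
    qed
    have Y: "i \<rho> \<in> ?X \<and> ?j (i \<rho>) = \<rho>" if "\<rho> \<in> ?Y" for \<rho>
    proof -
      have P: "partition_on (insert a S) \<rho>" "const_on_blocks \<phi> \<rho>"
        using that by auto
      obtain A where A: "A \<in> \<rho>" "a \<in> A" using P(1) by (auto simp: partition_on_def)
      have b: "blk \<rho> = A" using blk P A by blast
      have 1: "\<Union> \<rho> = insert a S" "disjoint \<rho>" "{} \<notin> \<rho>" using P by (auto simp: partition_on_def)
      have dis: "C \<inter> A = {}" if "C \<in> \<rho>" "C \<noteq> A" for C
        using 1 A that unfolding disjoint_def by blast
      define B where "B = A - {a}"
      define \<rho>' where "\<rho>' = (\<rho> - {A}) \<union> ({B} - {{}})"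
      have i: "i \<rho> = (\<rho>', B)" unfolding i_def b \<rho>'_def B_def by simp
      have "\<Union> \<rho>' = S"
      proof -
        have "\<Union> \<rho>' = \<Union> (\<rho> - {A}) \<union> B" unfolding \<rho>'_def by auto
        moreover have "\<Union> (\<rho> - {A}) = insert a S - A" using 1 dis A by blast
        moreover have "A \<subseteq> insert a S" using A(1) 1(1) by blast
        then have "(insert a S - A) \<union> (A - {a}) = S" using A(2) assms by blast
        ultimately show ?thesis unfolding B_def by simp
      qed
      moreover have "disjoint \<rho>'" using 1 dis unfolding \<rho>'_def B_def disjoint_def by blast
      moreover have "{} \<notin> \<rho>'" using 1 unfolding \<rho>'_def by auto
      ultimately have pr: "partition_on S \<rho>'" by (auto simp: partition_on_def)
      have c: "const_on_blocks \<phi> \<rho>'" using P A unfolding \<rho>'_def B_def const_on_blocks_def by auto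
      have "\<forall>x\<in>B. \<phi> x = \<phi> a"
        using P(2) A unfolding B_def const_on_blocks_def by blast
      then have BB: "B \<in> insert {} {B \<in> \<rho>'. \<forall>x\<in>B. \<phi> x = \<phi> a}"
        unfolding \<rho>'_def by auto
      have "B \<notin> \<rho> \<or> B = {}" using dis[of B] A unfolding B_def by blast
      then have "\<rho>' - {B} = \<rho> - {A}" using 1(3) unfolding \<rho>'_def by (cases "B = {}") auto
      moreover have "insert a B = A" using A(2) unfolding B_def by blast
      ultimately have "insert (insert a B) (\<rho>' - {B}) = \<rho>" using A(1) by auto
      then show ?thesis using i pr c BB by auto
    qed
    show "\<forall>\<rho>\<in>?Y. ?j (i \<rho>) = \<rho>" by (rule ballI, rule conjunct2[OF Y])
    show "i ` ?Y \<subseteq> ?X" by (rule image_subsetI, rule conjunct1[OF Y])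
    show "?j ` ?X \<subseteq> ?Y"
    proof
      fix \<rho>' assume "\<rho>' \<in> ?j ` ?X"
      then obtain \<rho> B where p: "\<rho>' = insert (insert a B) (\<rho> - {B})" "partition_on S \<rho>"
         "const_on_blocks \<phi> \<rho>" "B \<in> insert {} \<rho>" "\<forall>x\<in>B. \<phi> x = \<phi> a" by auto
      show "\<rho>' \<in> ?Y" using pj[OF p(2,4)] p by (auto simp: const_on_blocks_def)
    qed
  qed
qed

text \<open>
  Deleting \<open>a\<close> from a partition of \<open>insert a S\<close> leaves a partition \<open>\<rho>\<close> of \<open>S\<close>; putting \<open>a\<close> back as a
  singleton contributes \<open>mu \<rho>\<close>, putting it into a block \<open>B\<close> contributes \<open>- card B * mu \<rho>\<close>. Hence the
  sum is multiplied by \<open>1 - card {x \<in> S. \<phi> x = \<phi> a}\<close>.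
\<close>

lemma sum_mu:
  assumes "finite S"
  shows "(\<Sum>\<rho> | partition_on S \<rho> \<and> const_on_blocks \<phi> \<rho>. mu \<rho>) = of_bool (inj_on \<phi> S)"
  using assms
proof (induction S)
  case empty
  have "{\<rho>. partition_on {} \<rho> \<and> const_on_blocks \<phi> \<rho>} = {{}}"
    by (auto simp: partition_on_empty const_on_blocks_def)
  then show ?case by (simp add: mu_def)
next
  case (insert a S)
  let ?P = "\<lambda>S. {\<rho>. partition_on S \<rho> \<and> const_on_blocks \<phi> \<rho>}"
  let ?Q = "\<lambda>\<rho>. {B \<in> \<rho>. \<forall>x\<in>B. \<phi> x = \<phi> a}"
  define F where "F = {x \<in> S. \<phi> x = \<phi> a}"
  have cnt: "(\<Sum>B\<in>?Q \<rho>. of_nat (card B)) = (of_nat (card F) :: rat)" if "\<rho> \<in> ?P S" for \<rho>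
  proof -
    have \<rho>: "partition_on S \<rho>" "const_on_blocks \<phi> \<rho>"
      using that by auto
    have "\<Union> (?Q \<rho>) = F"
    proof (intro equalityI subsetI)
      fix x assume "x \<in> \<Union> (?Q \<rho>)"
      then show "x \<in> F" using \<rho>(1) by (auto simp: F_def partition_on_def)
    next
      fix x assume x: "x \<in> F"
      then obtain B where "B \<in> \<rho>" "x \<in> B" using \<rho>(1) by (auto simp: F_def partition_on_def)
      moreover from this have "\<forall>y\<in>B. \<phi> y = \<phi> a" using \<rho>(2) x unfolding F_def const_on_blocks_def by fastforce
      ultimately show "x \<in> \<Union> (?Q \<rho>)" by auto
    qed
    moreover have "card (\<Union> (?Q \<rho>)) = (\<Sum>B\<in>?Q \<rho>. card B)"
    proof (rule card_Union_disjoint)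
      show "pairwise disjnt (?Q \<rho>)"
        using \<rho>(1) by (auto simp: partition_on_def disjoint_def pairwise_def disjnt_def)
      show "finite A" if "A \<in> ?Q \<rho>" for A
        using that \<rho>(1) insert(1) by (auto simp: partition_on_def intro: finite_subset)
    qed
    ultimately have "card F = (\<Sum>B\<in>?Q \<rho>. card B)" by simp
    then show ?thesis by (simp only: of_nat_sum)
  qed
  have "(\<Sum>\<rho>\<in>?P (insert a S). mu \<rho>) =
      (\<Sum>(\<rho>, B)\<in>(SIGMA \<rho>:?P S. insert {} (?Q \<rho>)). mu (insert (insert a B) (\<rho> - {B})))"
    using sum.reindex_bij_betw[OF bij_betw_partition_on_insert[OF insert(2), where \<phi> = \<phi>], of mu]
    by (simp add: case_prod_unfold)
  also have "\<dots> = (\<Sum>\<rho>\<in>?P S. \<Sum>B\<in>insert {} (?Q \<rho>). mu (insert (insert a B) (\<rho> - {B})))"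
    by (rule sum.Sigma[symmetric])
       (use insert(1) finite_partitions[OF insert(1)] finite_elements[OF insert(1)] in auto)
  also have "\<dots> = (\<Sum>\<rho>\<in>?P S. mu \<rho> * (1 - of_nat (card F)))"
  proof (rule sum.cong[OF refl])
    fix \<rho> assume \<rho>: "\<rho> \<in> ?P S"
    have ne: "{} \<notin> ?Q \<rho>" using \<rho> by (auto simp: partition_on_def)
    have "finite \<rho>" using \<rho> finite_elements[OF insert(1)] by blast
    then have fin: "finite (?Q \<rho>)" by simp
    have "(\<Sum>B\<in>insert {} (?Q \<rho>). mu (insert (insert a B) (\<rho> - {B}))) =
        (\<Sum>B\<in>insert {} (?Q \<rho>). mu \<rho> * (if B = {} then 1 else - of_nat (card B)))"
      by (rule sum.cong[OF refl], rule mu_insert_block[OF insert(1,2)]) (use \<rho> in auto)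
    also have "\<dots> = mu \<rho> * (\<Sum>B\<in>insert {} (?Q \<rho>). if B = {} then 1 else - of_nat (card B))"
      by (rule sum_distrib_left[symmetric])
    also have "(\<Sum>B\<in>insert {} (?Q \<rho>). if B = {} then 1 else - of_nat (card B)) =
        1 + (\<Sum>B\<in>?Q \<rho>. if B = {} then 1 else - rat_of_nat (card B))"
      using ne fin by (subst sum.insert) auto
    also have "(\<Sum>B\<in>?Q \<rho>. if B = {} then 1 else - rat_of_nat (card B)) =
        (\<Sum>B\<in>?Q \<rho>. - rat_of_nat (card B))"
      by (rule sum.cong[OF refl]) (use ne in auto)
    also have "1 + (\<Sum>B\<in>?Q \<rho>. - rat_of_nat (card B)) = 1 - of_nat (card F)"
      using cnt[OF \<rho>] by (simp add: sum_negf)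
    finally show "(\<Sum>B\<in>insert {} (?Q \<rho>). mu (insert (insert a B) (\<rho> - {B}))) =
        mu \<rho> * (1 - of_nat (card F))" .
  qed
  also have "\<dots> = of_bool (inj_on \<phi> S) * (1 - of_nat (card F))"
    using insert by (simp add: sum_distrib_right[symmetric])
  also have "\<dots> = of_bool (inj_on \<phi> (insert a S))"
  proof (cases "inj_on \<phi> S")
    case True
    show ?thesis
    proof (cases "F = {}")
      case True
      moreover from this have "\<phi> a \<notin> \<phi> ` S" unfolding F_def by force
      ultimately show ?thesis using \<open>inj_on \<phi> S\<close> insert(2) by simp
    next
      case False
      then obtain x where x: "x \<in> F" by auto
      then have F: "F = {x}" using \<open>inj_on \<phi> S\<close> by (auto simp: F_def inj_on_def)
      have xS: "x \<in> S" "\<phi> a = \<phi> x" using x unfolding F_def by auto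
      then have "\<phi> a \<in> \<phi> ` S" by auto
      then show ?thesis using insert(2) F by auto
    qed
  qed auto
  finally show ?case .
qed

section \<open>Partitions as equivalence relations, and the span of the clique functions\<close>

definition same_block :: "'a set set \<Rightarrow> ('a \<times> 'a) set" where
  "same_block \<pi> = {(i, j). \<exists>B\<in>\<pi>. i \<in> B \<and> j \<in> B}"

definition kernel :: "nat \<Rightarrow> (nat \<Rightarrow> nat) \<Rightarrow> nat set set" where
  "kernel d \<kappa> = (\<lambda>i. {j \<in> {1..d}. \<kappa> j = \<kappa> i}) ` {1..d}"

definition cliques :: "nat set set \<Rightarrow> (nat \<Rightarrow> nat) \<Rightarrow> rat" where
  "cliques \<pi> \<kappa> = of_bool (\<forall>B\<in>\<pi>. inj_on \<kappa> B)"

text \<open>Only the partition of \<open>{1..d}\<close> into colour classes matters, as for symmetric functions.\<close>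

definition class_fun :: "nat \<Rightarrow> ((nat \<Rightarrow> nat) \<Rightarrow> rat) \<Rightarrow> bool" where
  "class_fun d f \<longleftrightarrow>
     (\<forall>\<kappa> \<kappa>'. (\<forall>i\<in>{1..d}. \<forall>j\<in>{1..d}. \<kappa> i = \<kappa> j \<longleftrightarrow> \<kappa>' i = \<kappa>' j) \<longrightarrow> f \<kappa> = f \<kappa>')"

definition clique_span :: "nat \<Rightarrow> ((nat \<Rightarrow> nat) \<Rightarrow> rat) \<Rightarrow> bool" where
  "clique_span d f \<longleftrightarrow> (\<exists>c. \<forall>\<kappa>. f \<kappa> = (\<Sum>\<pi> | partition_on {1..d} \<pi>. c \<pi> * cliques \<pi> \<kappa>))"

lemma same_block_image:
  assumes "partition_on S \<pi>" "i \<in> B" "B \<in> \<pi>"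
  shows "same_block \<pi> `` {i} = B"
  using assms unfolding same_block_def partition_on_def disjoint_def by blast

lemma same_block_sym: "(i, j) \<in> same_block \<pi> \<Longrightarrow> (j, i) \<in> same_block \<pi>"
  by (auto simp: same_block_def)

lemma same_block_trans:
  assumes "partition_on S \<pi>" "(i, j) \<in> same_block \<pi>" "(j, k) \<in> same_block \<pi>"
  shows "(i, k) \<in> same_block \<pi>"
proof -
  obtain B where B: "B \<in> \<pi>" "i \<in> B" "j \<in> B" using assms(2) by (auto simp: same_block_def)
  then have "k \<in> B" using same_block_image[OF assms(1)] assms(3) by blast
  then show ?thesis using B by (auto simp: same_block_def)
qed

lemma same_block_refl: "partition_on S \<pi> \<Longrightarrow> i \<in> S \<Longrightarrow> (i, i) \<in> same_block \<pi>"
  by (auto simp: same_block_def partition_on_def)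

lemma partition_eq_same_block:
  assumes "partition_on S \<pi>"
  shows "\<pi> = (\<lambda>i. same_block \<pi> `` {i}) ` S"
proof (intro equalityI subsetI)
  fix B assume B: "B \<in> \<pi>"
  have "B \<noteq> {}" "B \<subseteq> S" using assms B by (auto simp: partition_on_def)
  then obtain i where i: "i \<in> B" "i \<in> S" by blast
  then have "B = same_block \<pi> `` {i}" using same_block_image[OF assms] B by simp
  with i show "B \<in> (\<lambda>i. same_block \<pi> `` {i}) ` S" by blast
next
  fix B assume "B \<in> (\<lambda>i. same_block \<pi> `` {i}) ` S"
  then obtain i where i: "i \<in> S" "B = same_block \<pi> `` {i}" by blast
  then obtain C where "C \<in> \<pi>" "i \<in> C" using assms unfolding partition_on_def by blast
  then show "B \<in> \<pi>" using same_block_image[OF assms] i by simp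
qed

text \<open>On the level of \<open>same_block\<close>, refinement is inclusion. With this
  antisymmetry, inductions along refinement can run on the cardinality of the relation.\<close>

lemma same_block_inject:
  "partition_on S \<pi> \<Longrightarrow> partition_on S \<rho> \<Longrightarrow> same_block \<pi> = same_block \<rho> \<Longrightarrow> \<pi> = \<rho>"
  by (metis partition_eq_same_block)

lemma same_block_subset: "partition_on S \<pi> \<Longrightarrow> same_block \<pi> \<subseteq> S \<times> S"
  by (auto simp: same_block_def partition_on_def)

lemma const_on_blocks_iff:
  "const_on_blocks \<phi> \<rho> \<longleftrightarrow> (\<forall>(i, j)\<in>same_block \<rho>. \<phi> i = \<phi> j)"
  by (auto simp: const_on_blocks_def same_block_def)

lemma partition_on_kernel: "partition_on {1..d} (kernel d \<kappa>)"
  by (auto simp: partition_on_def kernel_def disjoint_def)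

lemma same_block_kernel:
  "same_block (kernel d \<kappa>) = {(i, j). i \<in> {1..d} \<and> j \<in> {1..d} \<and> \<kappa> i = \<kappa> j}"
  by (auto simp: same_block_def kernel_def)

text \<open>In this form the partition and the colour classes play symmetric roles: their
  equivalence relations meet only in the diagonal.\<close>

lemma cliques_same_block:
  assumes "partition_on {1..d} \<pi>"
  shows "cliques \<pi> \<kappa> = of_bool (same_block \<pi> \<inter> same_block (kernel d \<kappa>) \<subseteq> Id)"
proof -
  have "(\<forall>B\<in>\<pi>. inj_on \<kappa> B) \<longleftrightarrow> same_block \<pi> \<inter> same_block (kernel d \<kappa>) \<subseteq> Id"
    using assms unfolding same_block_kernel unfolding same_block_def inj_on_def partition_on_def
    by blast
  then show ?thesis by (simp add: cliques_def)
qed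

lemma exists_colouring:
  assumes "partition_on {1..d} \<sigma>"
  shows "\<exists>\<kappa>. kernel d \<kappa> = \<sigma>"
proof -
  define \<kappa> where "\<kappa> = (\<lambda>i. Min (same_block \<sigma> `` {i}))"
  have mem: "\<kappa> i \<in> same_block \<sigma> `` {i}" if "i \<in> {1..d}" for i
  proof -
    have "i \<in> \<Union> \<sigma>" using partition_onD1[OF assms] that by simp
    then obtain B where B: "B \<in> \<sigma>" "i \<in> B" by blast
    moreover have "B \<subseteq> {1..d}" using B partition_onD1[OF assms] by blast
    ultimately have "finite B" using finite_subset by blast
    moreover have "same_block \<sigma> `` {i} = B" using same_block_image[OF assms] B by simp
    ultimately show ?thesis unfolding \<kappa>_def using B(2) by (metis Min_in empty_iff)
  qed
  have "same_block (kernel d \<kappa>) = same_block \<sigma>"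
  proof (intro equalityI subrelI)
    fix i j assume "(i, j) \<in> same_block (kernel d \<kappa>)"
    then have ij: "i \<in> {1..d}" "j \<in> {1..d}" "\<kappa> i = \<kappa> j" by (auto simp: same_block_kernel)
    have "(i, \<kappa> i) \<in> same_block \<sigma>" "(j, \<kappa> i) \<in> same_block \<sigma>"
      using mem[OF ij(1)] mem[OF ij(2)] ij(3) by auto
    then show "(i, j) \<in> same_block \<sigma>"
      by (rule same_block_trans[OF assms _ same_block_sym])
  next
    fix i j assume a: "(i, j) \<in> same_block \<sigma>"
    then obtain B where "B \<in> \<sigma>" "i \<in> B" "j \<in> B" by (auto simp: same_block_def)
    then have "\<kappa> i = \<kappa> j" unfolding \<kappa>_def using same_block_image[OF assms] by simp
    then show "(i, j) \<in> same_block (kernel d \<kappa>)"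
      using a same_block_subset[OF assms] by (auto simp: same_block_kernel)
  qed
  then show ?thesis using same_block_inject partition_on_kernel assms by blast
qed

lemma class_fun_kernel:
  assumes "class_fun d f" "kernel d \<kappa> = kernel d \<kappa>'"
  shows "f \<kappa> = f \<kappa>'"
proof -
  have "same_block (kernel d \<kappa>) = same_block (kernel d \<kappa>')" using assms(2) by simp
  then have "\<forall>i\<in>{1..d}. \<forall>j\<in>{1..d}. \<kappa> i = \<kappa> j \<longleftrightarrow> \<kappa>' i = \<kappa>' j"
    unfolding same_block_kernel by blast
  then show ?thesis using assms(1) unfolding class_fun_def by blast
qed

lemma clique_span_cliques:
  assumes "partition_on {1..d} \<pi>"
  shows "clique_span d (cliques \<pi>)"
  unfolding clique_span_def
proof (intro exI allI)
  fix \<kappa>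
  have "(\<Sum>\<pi>' | partition_on {1..d} \<pi>'. (if \<pi>' = \<pi> then 1 else 0) * cliques \<pi>' \<kappa>) =
      (\<Sum>\<pi>' | partition_on {1..d} \<pi>'. if \<pi>' = \<pi> then cliques \<pi> \<kappa> else 0)"
    by (rule sum.cong) auto
  also have "\<dots> = cliques \<pi> \<kappa>" using assms finite_partitions[of "{1..d}" "\<lambda>_. True"] by simp
  finally show "cliques \<pi> \<kappa> = (\<Sum>\<pi>' | partition_on {1..d} \<pi>'. (if \<pi>' = \<pi> then 1 else 0) * cliques \<pi>' \<kappa>)"
    by simp
qed

lemma clique_span_diff:
  assumes "clique_span d f" "clique_span d g"
  shows "clique_span d (\<lambda>\<kappa>. a * (f \<kappa> - g \<kappa>))"
proof -
  obtain c c' where "\<And>\<kappa>. f \<kappa> = (\<Sum>\<pi> | partition_on {1..d} \<pi>. c \<pi> * cliques \<pi> \<kappa>)"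
    "\<And>\<kappa>. g \<kappa> = (\<Sum>\<pi> | partition_on {1..d} \<pi>. c' \<pi> * cliques \<pi> \<kappa>)"
    using assms unfolding clique_span_def by blast
  then have "\<forall>\<kappa>. a * (f \<kappa> - g \<kappa>) = (\<Sum>\<pi> | partition_on {1..d} \<pi>. (a * (c \<pi> - c' \<pi>)) * cliques \<pi> \<kappa>)"
    by (simp add: sum_distrib_left sum_subtractf algebra_simps)
  then show ?thesis unfolding clique_span_def by (intro exI)
qed

lemma clique_span_sum:
  assumes "finite I" "\<And>i. i \<in> I \<Longrightarrow> clique_span d (f i)"
  shows "clique_span d (\<lambda>\<kappa>. \<Sum>i\<in>I. a i * f i \<kappa>)"
proof -
  have "\<forall>i\<in>I. \<exists>c. \<forall>\<kappa>. f i \<kappa> = (\<Sum>\<pi> | partition_on {1..d} \<pi>. c \<pi> * cliques \<pi> \<kappa>)"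
    using assms(2) unfolding clique_span_def by blast
  then obtain c where c: "\<And>i \<kappa>. i \<in> I \<Longrightarrow> f i \<kappa> = (\<Sum>\<pi> | partition_on {1..d} \<pi>. c i \<pi> * cliques \<pi> \<kappa>)"
    by metis
  have "(\<Sum>i\<in>I. a i * f i \<kappa>) =
      (\<Sum>\<pi> | partition_on {1..d} \<pi>. (\<Sum>i\<in>I. a i * c i \<pi>) * cliques \<pi> \<kappa>)" for \<kappa>
  proof -
    have "(\<Sum>i\<in>I. a i * f i \<kappa>) =
        (\<Sum>i\<in>I. \<Sum>\<pi> | partition_on {1..d} \<pi>. a i * c i \<pi> * cliques \<pi> \<kappa>)"
      by (rule sum.cong) (simp_all add: c sum_distrib_left mult.assoc)
    also have "\<dots> = (\<Sum>\<pi> | partition_on {1..d} \<pi>. \<Sum>i\<in>I. a i * c i \<pi> * cliques \<pi> \<kappa>)"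
      by (rule sum.swap)
    finally show ?thesis by (simp add: sum_distrib_right)
  qed
  then show ?thesis unfolding clique_span_def by (intro exI allI)
qed

text \<open>Apply \<open>sum_mu\<close> to the map sending a vertex to its block in \<pi> together
  with its colour. It is injective iff no block of \<pi> repeats a colour, and it is constant on the
  blocks of \<rho> iff \<rho> refines \<pi> and \<kappa> is constant on them.\<close>

lemma cliques_eq_sum_mu:
  assumes \<pi>: "partition_on {1..d} \<pi>"
  shows "cliques \<pi> \<kappa> =
    (\<Sum>\<rho> | partition_on {1..d} \<rho> \<and> same_block \<rho> \<subseteq> same_block \<pi>. mu \<rho> * of_bool (const_on_blocks \<kappa> \<rho>))"
proof -
  define \<phi> where "\<phi> = (\<lambda>i. (same_block \<pi> `` {i}, \<kappa> i))"
  have eq: "same_block \<pi> `` {i} = same_block \<pi> `` {j} \<longleftrightarrow> (i, j) \<in> same_block \<pi>"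
    if "i \<in> {1..d}" "j \<in> {1..d}" for i j
  proof
    assume "same_block \<pi> `` {i} = same_block \<pi> `` {j}"
    then have "j \<in> same_block \<pi> `` {i}" using same_block_refl[OF \<pi> that(2)] by simp
    then show "(i, j) \<in> same_block \<pi>" by simp
  next
    assume "(i, j) \<in> same_block \<pi>"
    then obtain B where "B \<in> \<pi>" "i \<in> B" "j \<in> B" by (auto simp: same_block_def)
    then show "same_block \<pi> `` {i} = same_block \<pi> `` {j}" using same_block_image[OF \<pi>] by simp
  qed
  have eq': "\<phi> i = \<phi> j \<longleftrightarrow> (i, j) \<in> same_block \<pi> \<and> \<kappa> i = \<kappa> j"
    if "i \<in> {1..d}" "j \<in> {1..d}" for i j
    using eq[OF that] by (simp add: \<phi>_def)
  have c: "const_on_blocks \<phi> \<rho> \<longleftrightarrow> same_block \<rho> \<subseteq> same_block \<pi> \<and> const_on_blocks \<kappa> \<rho>"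
    if "partition_on {1..d} \<rho>" for \<rho>
  proof -
    have "const_on_blocks \<phi> \<rho> \<longleftrightarrow> (\<forall>(i, j)\<in>same_block \<rho>. (i, j) \<in> same_block \<pi> \<and> \<kappa> i = \<kappa> j)"
      unfolding const_on_blocks_iff
      by (rule ball_cong[OF refl]) (use same_block_subset[OF that] eq' in blast)
    then show ?thesis unfolding const_on_blocks_iff by auto
  qed
  have i: "inj_on \<phi> {1..d} \<longleftrightarrow> same_block \<pi> \<inter> same_block (kernel d \<kappa>) \<subseteq> Id"
  proof -
    have "inj_on \<phi> {1..d} \<longleftrightarrow>
        (\<forall>i\<in>{1..d}. \<forall>j\<in>{1..d}. (i, j) \<in> same_block \<pi> \<and> \<kappa> i = \<kappa> j \<longrightarrow> i = j)"
      unfolding inj_on_def 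
      by (rule ball_cong[OF refl], rule ball_cong[OF refl], subst eq') (assumption | rule refl)+
    also have "\<dots> \<longleftrightarrow> same_block \<pi> \<inter> same_block (kernel d \<kappa>) \<subseteq> Id"
      unfolding same_block_kernel subset_iff Int_iff split_paired_All pair_in_Id_conv
        mem_Collect_eq case_prod_conv
      by blast
    finally show ?thesis .
  qed
  have "cliques \<pi> \<kappa> = of_bool (inj_on \<phi> {1..d})"
    unfolding cliques_same_block[OF \<pi>] i ..
  also have "\<dots> = (\<Sum>\<rho> | partition_on {1..d} \<rho> \<and> const_on_blocks \<phi> \<rho>. mu \<rho>)"
    by (rule sum_mu[symmetric]) simp
  also have "\<dots> = (\<Sum>\<rho> | partition_on {1..d} \<rho> \<and> same_block \<rho> \<subseteq> same_block \<pi>.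
      mu \<rho> * of_bool (const_on_blocks \<kappa> \<rho>))"
    by (rule sum.mono_neutral_cong_left) (use c in \<open>auto intro: finite_partitions\<close>)
  finally show ?thesis .
qed

text \<open>The expansion \<open>cliques_eq_sum_mu\<close> is triangular with respect to refinement,
  and its diagonal entry \<open>mu \<pi>\<close> is nonzero; solve it from the finest partitions
  upwards.\<close>

lemma clique_span_const_on_blocks:
  assumes "partition_on {1..d} \<pi>"
  shows "clique_span d (\<lambda>\<kappa>. of_bool (const_on_blocks \<kappa> \<pi>))"
  using assms
proof (induction "card (same_block \<pi>)" arbitrary: \<pi> rule: less_induct)
  case less
  let ?Q = "{\<rho>. partition_on {1..d} \<rho> \<and> same_block \<rho> \<subset> same_block \<pi>}"
  have fin: "finite (same_block \<pi>)"
    using same_block_subset[OF less.prems] finite_subset by blast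
  have finQ: "finite ?Q" by (rule finite_partitions) simp
  have eq: "{\<rho>. partition_on {1..d} \<rho> \<and> same_block \<rho> \<subseteq> same_block \<pi>} = insert \<pi> ?Q"
    using less.prems same_block_inject by blast
  have "cliques \<pi> \<kappa> = mu \<pi> * of_bool (const_on_blocks \<kappa> \<pi>) +
      (\<Sum>\<rho>\<in>?Q. mu \<rho> * of_bool (const_on_blocks \<kappa> \<rho>))" for \<kappa>
    unfolding cliques_eq_sum_mu[OF less.prems] eq using finQ by (subst sum.insert) auto
  then have *: "of_bool (const_on_blocks \<kappa> \<pi>) =
      inverse (mu \<pi>) * (cliques \<pi> \<kappa> - (\<Sum>\<rho>\<in>?Q. mu \<rho> * of_bool (const_on_blocks \<kappa> \<rho>)))" for \<kappa>
    using mu_nonzero[of \<pi>] by (simp add: field_simps)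
  have "clique_span d (\<lambda>\<kappa>. of_bool (const_on_blocks \<kappa> \<rho>))" if "\<rho> \<in> ?Q" for \<rho>
    using that less.hyps[of \<rho>] psubset_card_mono[OF fin] by blast
  then show ?case
    unfolding * by (intro clique_span_diff clique_span_cliques clique_span_sum finQ less.prems)
qed

text \<open>A colouring is constant on the blocks of \<rho> iff its kernel is \<rho> or strictly
  coarser. Subtracting the coarser kernels is an induction from the coarsest partition downwards,
  hence the measure: a relation on \<open>{1..d}\<close> has at most \<open>d * d\<close>
  pairs.\<close>

lemma clique_span_kernel_eq:
  assumes "partition_on {1..d} \<rho>"
  shows "clique_span d (\<lambda>\<kappa>. of_bool (kernel d \<kappa> = \<rho>))"
  using assms
proof (induction "d * d - card (same_block \<rho>)" arbitrary: \<rho> rule: less_induct)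
  case less
  let ?Q = "{\<sigma>. partition_on {1..d} \<sigma> \<and> same_block \<rho> \<subset> same_block \<sigma>}"
  have finQ: "finite ?Q" by (rule finite_partitions) simp
  have *: "of_bool (kernel d \<kappa> = \<rho>) =
      1 * (of_bool (const_on_blocks \<kappa> \<rho>) - (\<Sum>\<sigma>\<in>?Q. 1 * (of_bool (kernel d \<kappa> = \<sigma>) :: rat)))" for \<kappa>
  proof -
    have "const_on_blocks \<kappa> \<rho> \<longleftrightarrow> same_block \<rho> \<subseteq> same_block (kernel d \<kappa>)"
      using same_block_subset[OF less.prems] unfolding const_on_blocks_iff same_block_kernel by blast
    also have "\<dots> \<longleftrightarrow> kernel d \<kappa> = \<rho> \<or> kernel d \<kappa> \<in> ?Q"
      using same_block_inject[OF partition_on_kernel less.prems] partition_on_kernel by blast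
    finally have 1: "const_on_blocks \<kappa> \<rho> \<longleftrightarrow> kernel d \<kappa> = \<rho> \<or> kernel d \<kappa> \<in> ?Q" .
    have 2: "(\<Sum>\<sigma>\<in>?Q. 1 * (of_bool (kernel d \<kappa> = \<sigma>) :: rat)) = of_bool (kernel d \<kappa> \<in> ?Q)"
    proof -
      have "(\<Sum>\<sigma>\<in>?Q. 1 * (of_bool (kernel d \<kappa> = \<sigma>) :: rat)) =
          (\<Sum>\<sigma>\<in>?Q. if kernel d \<kappa> = \<sigma> then 1 else 0)" by (rule sum.cong) auto
      then show ?thesis using finQ by simp
    qed
    have 3: "\<not> (kernel d \<kappa> = \<rho> \<and> kernel d \<kappa> \<in> ?Q)" by auto
    show ?thesis unfolding 2 using 1 3 by auto
  qed
  have "clique_span d (\<lambda>\<kappa>. of_bool (kernel d \<kappa> = \<sigma>))" if "\<sigma> \<in> ?Q" for \<sigma>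
  proof -
    have \<sigma>: "partition_on {1..d} \<sigma>" "same_block \<rho> \<subset> same_block \<sigma>" using that by auto
    have sub: "same_block \<sigma> \<subseteq> {1..d} \<times> {1..d}" using same_block_subset[OF \<sigma>(1)] .
    then have "finite (same_block \<sigma>)" using finite_subset by blast
    then have "card (same_block \<rho>) < card (same_block \<sigma>)" using psubset_card_mono \<sigma>(2) by blast
    moreover have "card (same_block \<sigma>) \<le> d * d" using card_mono[OF _ sub] by simp
    ultimately show ?thesis using less.hyps[of \<sigma>] \<sigma>(1) by simp
  qed
  then show ?case
    unfolding *
    by (intro clique_span_diff clique_span_const_on_blocks clique_span_sum finQ less.prems)
qed

lemma clique_span_class_fun:
  assumes "class_fun d f"
  shows "clique_span d f"
proof -
  have "\<exists>r. \<forall>\<sigma>. partition_on {1..d} \<sigma> \<longrightarrow> kernel d (r \<sigma>) = \<sigma>"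
    using exists_colouring by metis
  then obtain r where r: "\<And>\<sigma>. partition_on {1..d} \<sigma> \<Longrightarrow> kernel d (r \<sigma>) = \<sigma>" by blast
  let ?P = "{\<sigma>. partition_on {1..d} \<sigma>}"
  have fin: "finite ?P" using finite_partitions[of "{1..d}" "\<lambda>_. True"] by simp
  have "f \<kappa> = (\<Sum>\<sigma>\<in>?P. f (r \<sigma>) * of_bool (kernel d \<kappa> = \<sigma>))" for \<kappa>
  proof -
    have "(\<Sum>\<sigma>\<in>?P. f (r \<sigma>) * of_bool (kernel d \<kappa> = \<sigma>)) =
        (\<Sum>\<sigma>\<in>?P. if kernel d \<kappa> = \<sigma> then f (r \<sigma>) else 0)" by (rule sum.cong) auto
    also have "\<dots> = f (r (kernel d \<kappa>))" using fin partition_on_kernel by simp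
    also have "\<dots> = f \<kappa>" 
      by (rule class_fun_kernel[OF assms r[OF partition_on_kernel]])
    finally show ?thesis by simp
  qed
  then have "f = (\<lambda>\<kappa>. \<Sum>\<sigma>\<in>?P. f (r \<sigma>) * of_bool (kernel d \<kappa> = \<sigma>))" by blast
  then show ?thesis
    using clique_span_sum[OF fin, of d "\<lambda>\<sigma> \<kappa>. of_bool (kernel d \<kappa> = \<sigma>)" "\<lambda>\<sigma>. f (r \<sigma>)"]
      clique_span_kernel_eq by auto
qed

text \<open>
  The matrix \<open>cliques \<pi> \<kappa>\<close> indexed by \<open>\<pi>\<close> and the kernel of \<open>\<kappa>\<close> is symmetric, so that the
  spanning property already gives linear independence.
\<close>

lemma cliques_independent:
  assumes zero: "\<And>\<kappa>. (\<Sum>\<pi> | partition_on {1..d} \<pi>. c \<pi> * cliques \<pi> \<kappa>) = 0"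
    and \<rho>: "partition_on {1..d} \<rho>"
  shows "c \<rho> = 0"
proof -
  let ?P = "{\<sigma>. partition_on {1..d} \<sigma>}"
  have fin: "finite ?P" using finite_partitions[of "{1..d}" "\<lambda>_. True"] by simp
  have "\<exists>r. \<forall>\<sigma>. partition_on {1..d} \<sigma> \<longrightarrow> kernel d (r \<sigma>) = \<sigma>"
    using exists_colouring by metis
  then obtain r where r: "\<And>\<sigma>. partition_on {1..d} \<sigma> \<Longrightarrow> kernel d (r \<sigma>) = \<sigma>" by blast
  have sym: "cliques \<pi> (r \<sigma>) = cliques \<sigma> (r \<pi>)" if "\<pi> \<in> ?P" "\<sigma> \<in> ?P" for \<pi> \<sigma>
    using that by (simp add: cliques_same_block r Int_commute)
  obtain b where b: "\<And>\<kappa>. of_bool (kernel d \<kappa> = \<rho>) = (\<Sum>\<pi>\<in>?P. b \<pi> * cliques \<pi> \<kappa>)"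
    using clique_span_kernel_eq[OF \<rho>] unfolding clique_span_def by auto
  \<comment> \<open>Pair the vanishing combination with the coordinates \<open>b\<close> of the
    indicator of the kernel \<rho>. By symmetry the inner sum over \<sigma> becomes that indicator
    at the representative colouring \<open>r \<pi>\<close>, which isolates
    \<open>c \<rho>\<close>.\<close>
  have "0 = (\<Sum>\<sigma>\<in>?P. b \<sigma> * (\<Sum>\<pi>\<in>?P. c \<pi> * cliques \<pi> (r \<sigma>)))"
    using zero by simp
  also have "\<dots> = (\<Sum>\<sigma>\<in>?P. \<Sum>\<pi>\<in>?P. c \<pi> * (b \<sigma> * cliques \<sigma> (r \<pi>)))"
    unfolding sum_distrib_left by (intro sum.cong refl) (use sym in \<open>simp add: algebra_simps\<close>)
  also have "\<dots> = (\<Sum>\<pi>\<in>?P. \<Sum>\<sigma>\<in>?P. c \<pi> * (b \<sigma> * cliques \<sigma> (r \<pi>)))" by (rule sum.swap)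
  also have "\<dots> = (\<Sum>\<pi>\<in>?P. c \<pi> * of_bool (kernel d (r \<pi>) = \<rho>))"
    unfolding b sum_distrib_left ..
  also have "\<dots> = (\<Sum>\<pi>\<in>?P. if \<pi> = \<rho> then c \<rho> else 0)"
    by (rule sum.cong) (auto simp: r)
  also have "\<dots> = c \<rho>" using \<rho> fin by simp
  finally show ?thesis by simp
qed

section \<open>Coordinates of class functions in UBCSym\<close>

lemma class_fun_const: "class_fun d (\<lambda>_. a)"
  by (simp add: class_fun_def)

lemma class_fun_mult: "class_fun d f \<Longrightarrow> class_fun d g \<Longrightarrow> class_fun d (\<lambda>\<kappa>. f \<kappa> * g \<kappa>)"
  unfolding class_fun_def by metis

lemma class_fun_sum:
  "(\<And>i. i \<in> I \<Longrightarrow> class_fun d (f i)) \<Longrightarrow> class_fun d (\<lambda>\<kappa>. \<Sum>i\<in>I. f i \<kappa>)"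
  unfolding class_fun_def by (intro allI impI sum.cong) blast+

lemma class_fun_mono: "class_fun d f \<Longrightarrow> d \<le> d' \<Longrightarrow> class_fun d' f"
  unfolding class_fun_def
proof (intro allI impI)
  fix \<kappa> \<kappa>' :: "nat \<Rightarrow> nat"
  assume a: "\<forall>\<kappa> \<kappa>'. (\<forall>i\<in>{1..d}. \<forall>j\<in>{1..d}. (\<kappa> i = \<kappa> j) = (\<kappa>' i = \<kappa>' j)) \<longrightarrow> f \<kappa> = f \<kappa>'"
    "d \<le> d'" "\<forall>i\<in>{1..d'}. \<forall>j\<in>{1..d'}. (\<kappa> i = \<kappa> j) = (\<kappa>' i = \<kappa>' j)"
  have "\<forall>i\<in>{1..d}. \<forall>j\<in>{1..d}. (\<kappa> i = \<kappa> j) = (\<kappa>' i = \<kappa>' j)"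
    using a(2,3) by (intro ballI) simp
  then show "f \<kappa> = f \<kappa>'" using a(1) by blast
qed

lemma class_fun_eq:
  "i \<in> {1..d} \<Longrightarrow> j \<in> {1..d} \<Longrightarrow> class_fun d (\<lambda>\<kappa>. of_bool (\<kappa> i = \<kappa> j))"
  unfolding class_fun_def
proof (intro allI impI)
  fix \<kappa> \<kappa>' :: "nat \<Rightarrow> nat"
  assume "i \<in> {1..d}" "j \<in> {1..d}" "\<forall>i\<in>{1..d}. \<forall>j\<in>{1..d}. (\<kappa> i = \<kappa> j) = (\<kappa>' i = \<kappa>' j)"
  then have "\<kappa> i = \<kappa> j \<longleftrightarrow> \<kappa>' i = \<kappa>' j" by blast
  then show "of_bool (\<kappa> i = \<kappa> j) = (of_bool (\<kappa>' i = \<kappa>' j) :: rat)" by simp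
qed

lemma class_fun_inj_on:
  assumes "B \<subseteq> {1..d}"
  shows "class_fun d (\<lambda>\<kappa>. of_bool (inj_on \<kappa> B))"
  unfolding class_fun_def
proof (intro allI impI)
  fix \<kappa> \<kappa>' :: "nat \<Rightarrow> nat"
  assume a: "\<forall>i\<in>{1..d}. \<forall>j\<in>{1..d}. (\<kappa> i = \<kappa> j) = (\<kappa>' i = \<kappa>' j)"
  have "inj_on \<kappa> B \<longleftrightarrow> inj_on \<kappa>' B"
    unfolding inj_on_def
    by (rule ball_cong[OF refl], rule ball_cong[OF refl]) (use a assms in blast)
  then show "of_bool (inj_on \<kappa> B) = (of_bool (inj_on \<kappa>' B) :: rat)" by simp
qed

lemma class_fun_notin:
  assumes "x \<in> {1..d}" "T \<subseteq> {1..d}"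
  shows "class_fun d (\<lambda>\<kappa>. of_bool (\<kappa> x \<notin> \<kappa> ` T))"
  unfolding class_fun_def
proof (intro allI impI)
  fix \<kappa> \<kappa>' :: "nat \<Rightarrow> nat"
  assume a: "\<forall>i\<in>{1..d}. \<forall>j\<in>{1..d}. (\<kappa> i = \<kappa> j) = (\<kappa>' i = \<kappa>' j)"
  have "\<kappa> x \<in> \<kappa> ` T \<longleftrightarrow> \<kappa>' x \<in> \<kappa>' ` T"
    unfolding image_iff by (rule bex_cong[OF refl]) (use a assms in blast)
  then show "of_bool (\<kappa> x \<notin> \<kappa> ` T) = (of_bool (\<kappa>' x \<notin> \<kappa>' ` T) :: rat)" by simp
qed

lemma class_fun_cliques:
  assumes "\<Union> \<pi> \<subseteq> {1..d}"
  shows "class_fun d (cliques \<pi>)"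
  unfolding class_fun_def
proof (intro allI impI)
  fix \<kappa> \<kappa>' :: "nat \<Rightarrow> nat"
  assume a: "\<forall>i\<in>{1..d}. \<forall>j\<in>{1..d}. (\<kappa> i = \<kappa> j) = (\<kappa>' i = \<kappa>' j)"
  have "inj_on \<kappa> B \<longleftrightarrow> inj_on \<kappa>' B" if "B \<in> \<pi>" for B
  proof -
    have "B \<subseteq> {1..d}" using assms that by blast
    then show ?thesis unfolding inj_on_def
      by (intro ball_cong refl) (use a in blast)
  qed
  then show "cliques \<pi> \<kappa> = cliques \<pi> \<kappa>'" by (simp add: cliques_def)
qed

lemma class_fun_partition: "partition_on {1..d} \<pi> \<Longrightarrow> class_fun d (cliques \<pi>)"
  by (rule class_fun_cliques) (simp add: partition_on_def)

text \<open>The positivity test accounts for the variables of NCSym starting at \<open>x\<^sub>1\<close>.\<close>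

definition wordify :: "nat \<Rightarrow> ((nat \<Rightarrow> nat) \<Rightarrow> rat) \<Rightarrow> nc_series" where
  "wordify d f = (\<lambda>w. if length w = d \<and> (\<forall>i\<in>set w. 0 < i) then f (\<lambda>i. w ! (i - 1)) else 0)"

definition ubc_of :: "nat \<Rightarrow> ((nat \<Rightarrow> nat) \<Rightarrow> rat) \<Rightarrow> ubc" where
  "ubc_of d f = nu d (wordify d f)"

lemma block_eq:
  assumes "partition_on S \<pi>" "B \<in> \<pi>" "i \<in> B"
  shows "block \<pi> i = B"
  unfolding block_def
proof (rule the_equality)
  fix C assume "C \<in> \<pi> \<and> i \<in> C"
  then show "C = B" using same_block_image[OF assms(1)] assms(2,3) by metis
qed (use assms in simp)

lemma block_mem:
  assumes "partition_on S \<pi>" "i \<in> S"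
  shows "block \<pi> i \<in> \<pi>" "i \<in> block \<pi> i"
proof -
  have "i \<in> \<Union> \<pi>" using partition_onD1[OF assms(1)] assms(2) by simp
  then obtain B where "B \<in> \<pi>" "i \<in> B" by blast
  then show "block \<pi> i \<in> \<pi>" "i \<in> block \<pi> i" using block_eq[OF assms(1)] by simp_all
qed

lemma e_nc_eq_wordify:
  assumes "partition_on {1..d} \<pi>"
  shows "e_nc d \<pi> = wordify d (cliques \<pi>)"
proof -
  have "(\<forall>j\<in>{1..d}. \<forall>k\<in>{1..d}. j \<noteq> k \<and> block \<pi> j = block \<pi> k \<longrightarrow> w ! (j - 1) \<noteq> w ! (k - 1)) \<longleftrightarrow>
      (\<forall>B\<in>\<pi>. inj_on (\<lambda>i. w ! (i - 1)) B)" (is "?L \<longleftrightarrow> ?R") for w :: "nat list"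
  proof
    assume L: ?L
    show ?R
    proof (intro ballI inj_onI)
      fix B j k assume *: "B \<in> \<pi>" "j \<in> B" "k \<in> B" "w ! (j - 1) = w ! (k - 1)"
      then have "j \<in> {1..d}" "k \<in> {1..d}" using partition_onD1[OF assms] by blast+
      moreover have "block \<pi> j = block \<pi> k" using block_eq[OF assms] * by simp
      ultimately show "j = k" using L *(4) by blast
    qed
  next
    assume R: ?R
    show ?L
    proof (intro ballI impI)
      fix j k assume *: "j \<in> {1..d}" "k \<in> {1..d}" "j \<noteq> k \<and> block \<pi> j = block \<pi> k"
      then have "block \<pi> j \<in> \<pi>" "j \<in> block \<pi> j" "k \<in> block \<pi> j"
        using block_mem[OF assms] by metis+
      then show "w ! (j - 1) \<noteq> w ! (k - 1)" using R *(3) by (metis inj_onD)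
    qed
  qed
  then show ?thesis
    unfolding e_nc_def wordify_def monomial_sum_def cliques_def by (intro ext) auto
qed

text \<open>Evaluating the definite description needs uniqueness: equality of words is carried back
  to equality of functions of colourings, where \<open>cliques_independent\<close> applies.\<close>

lemma e_coeff_wordify:
  assumes f: "\<And>\<kappa>. f \<kappa> = (\<Sum>\<pi> | partition_on {1..d} \<pi>. c \<pi> * cliques \<pi> \<kappa>)"
    and \<pi>: "partition_on {1..d} \<pi>"
  shows "e_coeff d (wordify d f) \<pi> = c \<pi>"
proof -
  let ?P = "{\<pi>. partition_on {1..d} \<pi>}"
  have w: "(\<Sum>\<pi>\<in>?P. b \<pi> * e_nc d \<pi> w) = wordify d (\<lambda>\<kappa>. \<Sum>\<pi>\<in>?P. b \<pi> * cliques \<pi> \<kappa>) w" for b w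
  proof -
    have "(\<Sum>\<pi>\<in>?P. b \<pi> * e_nc d \<pi> w) = (\<Sum>\<pi>\<in>?P. b \<pi> * wordify d (cliques \<pi>) w)"
      by (rule sum.cong) (auto simp: e_nc_eq_wordify)
    moreover define q where "q = (of_bool (length w = d \<and> (\<forall>i\<in>set w. 0 < i)) :: rat)"
    have "wordify d g w = q * g (\<lambda>i. w ! (i - 1))" for g
      by (auto simp: wordify_def q_def)
    ultimately show ?thesis by (simp add: sum_distrib_left mult.left_commute)
  qed
  have ext: "f \<kappa> = g \<kappa>" if "wordify d f = wordify d g" "class_fun d f" "class_fun d g" for f g \<kappa>
  proof -
    \<comment> \<open>The shift by \<open>Suc\<close> makes all letters positive, so that
      \<open>wordify\<close> does not vanish on \<open>w\<close>, and it preserves which colours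
      agree.\<close>
    define w where "w = map (\<lambda>i. Suc (\<kappa> i)) [1..<Suc d]"
    have nth: "w ! (i - 1) = Suc (\<kappa> i)" if "i \<in> {1..d}" for i
      using that by (auto simp: w_def nth_append less_Suc_eq_le simp del: upt_Suc)
    have agree: "\<forall>i\<in>{1..d}. \<forall>j\<in>{1..d}. \<kappa> i = \<kappa> j \<longleftrightarrow> w ! (i - 1) = w ! (j - 1)"
      using nth by (intro ballI) (simp del: atLeastAtMost_iff)
    have "f \<kappa> = f (\<lambda>i. w ! (i - 1))"
      using that(2) unfolding class_fun_def by (elim allE impE) (rule agree)
    moreover have "g \<kappa> = g (\<lambda>i. w ! (i - 1))"
      using that(3) unfolding class_fun_def by (elim allE impE) (rule agree)
    moreover have "f (\<lambda>i. w ! (i - 1)) = wordify d f w" "g (\<lambda>i. w ! (i - 1)) = wordify d g w"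
      by (simp_all add: wordify_def w_def del: upt_Suc)
    ultimately show ?thesis using that(1) by simp
  qed
  have cl: "class_fun d (\<lambda>\<kappa>. \<Sum>\<pi>\<in>?P. b \<pi> * cliques \<pi> \<kappa>)" for b
    by (intro class_fun_sum class_fun_mult class_fun_const class_fun_cliques) (auto simp: partition_on_def)
  have "e_coeff d (wordify d f) = (\<lambda>\<pi>. if partition_on {1..d} \<pi> then c \<pi> else 0)" (is "_ = ?c")
    unfolding e_coeff_def
  proof (rule the_equality)
    have "(\<Sum>\<pi>\<in>?P. ?c \<pi> * cliques \<pi> \<kappa>) = f \<kappa>" for \<kappa>
      unfolding f by (rule sum.cong) auto
    then show "(\<forall>\<pi>. \<not> partition_on {1..d} \<pi> \<longrightarrow> ?c \<pi> = 0) \<and>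
        wordify d f = (\<lambda>w. \<Sum>\<pi>\<in>?P. ?c \<pi> * e_nc d \<pi> w)"
      unfolding w by simp
  next
    fix b assume b: "(\<forall>\<pi>. \<not> partition_on {1..d} \<pi> \<longrightarrow> b \<pi> = 0) \<and>
        wordify d f = (\<lambda>w. \<Sum>\<pi>\<in>?P. b \<pi> * e_nc d \<pi> w)"
    then have "wordify d f = wordify d (\<lambda>\<kappa>. \<Sum>\<pi>\<in>?P. b \<pi> * cliques \<pi> \<kappa>)" unfolding w by simp
    moreover have "class_fun d f" using cl[of c] unfolding f[symmetric] by simp
    ultimately have "f \<kappa> = (\<Sum>\<pi>\<in>?P. b \<pi> * cliques \<pi> \<kappa>)" for \<kappa> using ext cl by blast
    then have "(\<Sum>\<pi>\<in>?P. (b \<pi> - c \<pi>) * cliques \<pi> \<kappa>) = 0" for \<kappa>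
      using f[of \<kappa>] by (simp add: left_diff_distrib sum_subtractf)
    then have "b \<pi> - c \<pi> = 0" if "partition_on {1..d} \<pi>" for \<pi>
      by (rule cliques_independent[OF _ that])
    then show "b = ?c" using b by auto
  qed
  then show ?thesis using \<pi> by simp
qed

lemma ubc_of_expansion:
  assumes "\<And>\<kappa>. f \<kappa> = (\<Sum>\<pi> | partition_on {1..d} \<pi>. c \<pi> * cliques \<pi> \<kappa>)"
  shows "ubc_of d f t = (\<Sum>\<pi> | partition_on {1..d} \<pi>. c \<pi> * of_bool (ptype d \<pi> = t))"
  unfolding ubc_of_def nu_def
  by (rule sum.cong) (auto simp: e_coeff_wordify[OF assms] e_ubc_def)

lemma class_fun_expansion:
  assumes "class_fun d f"
  obtains c where "\<And>\<kappa>. f \<kappa> = (\<Sum>\<pi> | partition_on {1..d} \<pi>. c \<pi> * cliques \<pi> \<kappa>)"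
  using clique_span_class_fun[OF assms] unfolding clique_span_def by blast

lemma ubc_of_add:
  assumes "class_fun d f" "class_fun d g"
  shows "ubc_of d (\<lambda>\<kappa>. f \<kappa> + g \<kappa>) t = ubc_of d f t + ubc_of d g t"
proof -
  obtain c where c: "\<And>\<kappa>. f \<kappa> = (\<Sum>\<pi> | partition_on {1..d} \<pi>. c \<pi> * cliques \<pi> \<kappa>)"
    using class_fun_expansion[OF assms(1)] by blast
  obtain c' where c': "\<And>\<kappa>. g \<kappa> = (\<Sum>\<pi> | partition_on {1..d} \<pi>. c' \<pi> * cliques \<pi> \<kappa>)"
    using class_fun_expansion[OF assms(2)] by blast
  have "f \<kappa> + g \<kappa> = (\<Sum>\<pi> | partition_on {1..d} \<pi>. (c \<pi> + c' \<pi>) * cliques \<pi> \<kappa>)" for \<kappa>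
    unfolding c c' by (simp add: distrib_right sum.distrib)
  from ubc_of_expansion[of "\<lambda>\<kappa>. f \<kappa> + g \<kappa>", OF this] ubc_of_expansion[of f, OF c]
    ubc_of_expansion[of g, OF c'] show ?thesis
    by (simp add: distrib_right sum.distrib)
qed

lemma ubc_of_scale:
  assumes "class_fun d f"
  shows "ubc_of d (\<lambda>\<kappa>. a * f \<kappa>) t = a * ubc_of d f t"
proof -
  obtain c where c: "\<And>\<kappa>. f \<kappa> = (\<Sum>\<pi> | partition_on {1..d} \<pi>. c \<pi> * cliques \<pi> \<kappa>)"
    using class_fun_expansion[OF assms] by blast
  have "a * f \<kappa> = (\<Sum>\<pi> | partition_on {1..d} \<pi>. (a * c \<pi>) * cliques \<pi> \<kappa>)" for \<kappa>
    unfolding c by (simp add: sum_distrib_left mult.assoc)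
  from ubc_of_expansion[of "\<lambda>\<kappa>. a * f \<kappa>", OF this] ubc_of_expansion[of f, OF c]
  show ?thesis by (simp add: sum_distrib_left mult.assoc)
qed

lemma ubc_of_zero: "ubc_of d (\<lambda>_. 0) t = 0"
  using ubc_of_scale[OF class_fun_const, of d 0 0 t] by simp

lemma ubc_of_diff:
  assumes "class_fun d f" "class_fun d g"
  shows "ubc_of d (\<lambda>\<kappa>. f \<kappa> - g \<kappa>) t = ubc_of d f t - ubc_of d g t"
  using ubc_of_add[OF assms(1) class_fun_mult[OF class_fun_const assms(2), of "- 1"], of t]
    ubc_of_scale[OF assms(2), of "- 1" t] by simp

lemma ubc_of_sum:
  assumes "finite I" "\<And>i. i \<in> I \<Longrightarrow> class_fun d (f i)"
  shows "ubc_of d (\<lambda>\<kappa>. \<Sum>i\<in>I. f i \<kappa>) t = (\<Sum>i\<in>I. ubc_of d (f i) t)"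
  using assms
proof (induction I)
  case empty
  then show ?case by (simp add: ubc_of_zero)
next
  case (insert i I)
  then show ?case using ubc_of_add[of d "f i" "\<lambda>\<kappa>. \<Sum>i\<in>I. f i \<kappa>" t] class_fun_sum[of I d f] by simp
qed

lemma ubc_of_cliques:
  assumes "partition_on {1..d} \<pi>"
  shows "ubc_of d (cliques \<pi>) t = of_bool (ptype d \<pi> = t)"
proof -
  have fin: "finite {\<pi>. partition_on {1..d} \<pi>}" using finite_partitions[of "{1..d}" "\<lambda>_. True"] by simp
  have "cliques \<pi> \<kappa> = (\<Sum>\<pi>' | partition_on {1..d} \<pi>'. of_bool (\<pi>' = \<pi>) * cliques \<pi>' \<kappa>)" for \<kappa>
  proof -
    have "(\<Sum>\<pi>' | partition_on {1..d} \<pi>'. of_bool (\<pi>' = \<pi>) * cliques \<pi>' \<kappa>) =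
        (\<Sum>\<pi>' | partition_on {1..d} \<pi>'. if \<pi>' = \<pi> then cliques \<pi> \<kappa> else 0)"
      by (rule sum.cong) auto
    then show ?thesis using fin assms by simp
  qed
  from ubc_of_expansion[of "cliques \<pi>", OF this]
  have "ubc_of d (cliques \<pi>) t =
      (\<Sum>\<pi>' | partition_on {1..d} \<pi>'. of_bool (\<pi>' = \<pi>) * of_bool (ptype d \<pi>' = t))" .
  also have "\<dots> = (\<Sum>\<pi>' | partition_on {1..d} \<pi>'. if \<pi>' = \<pi> then of_bool (ptype d \<pi> = t) else 0)"
    by (rule sum.cong) auto
  finally show ?thesis using fin assms by simp
qed

lemma ubc_of_linear:
  assumes "finite I" "\<And>i. i \<in> I \<Longrightarrow> class_fun d (f i)"
  shows "ubc_of d (\<lambda>\<kappa>. \<Sum>i\<in>I. a i * f i \<kappa>) t = (\<Sum>i\<in>I. a i * ubc_of d (f i) t)"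
  using ubc_of_sum[OF assms(1), of d "\<lambda>i \<kappa>. a i * f i \<kappa>" t]
    class_fun_mult[OF class_fun_const assms(2)] ubc_of_scale[OF assms(2)] by simp

text \<open>Such a relabelling permutes the partitions and preserves block sizes; as it fixes
  \<open>d\<close>, it also preserves the size of the block of \<open>d\<close>, hence the
  type.\<close>

lemma ubc_of_permute:
  assumes "class_fun d f" "inj \<tau>" "\<tau> ` {1..d} = {1..d}" "\<tau> d = d" "1 \<le> d"
  shows "ubc_of d (\<lambda>\<kappa>. f (\<kappa> \<circ> \<tau>)) t = ubc_of d f t"
proof -
  let ?P = "{\<pi>. partition_on {1..d} \<pi>}"
  have fin: "finite ?P" using finite_partitions[of "{1..d}" "\<lambda>_. True"] by simp
  have inj2: "inj ((`) \<tau>)" using assms(2) by (simp add: inj_def inj_image_eq_iff)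
  have part: "partition_on {1..d} ((`) \<tau> ` \<pi>)" if "partition_on {1..d} \<pi>" for \<pi>
  proof -
    have "\<Union> ((`) \<tau> ` \<pi>) = \<tau> ` \<Union> \<pi>" by blast
    then have "\<Union> ((`) \<tau> ` \<pi>) = {1..d}" using assms(3) partition_onD1[OF that] by simp
    moreover have "disjoint ((`) \<tau> ` \<pi>)"
      unfolding disjoint_def
    proof (intro ballI impI)
      fix B C assume "B \<in> (`) \<tau> ` \<pi>" "C \<in> (`) \<tau> ` \<pi>" "B \<noteq> C"
      then obtain B' C' where "B = \<tau> ` B'" "C = \<tau> ` C'" "B' \<in> \<pi>" "C' \<in> \<pi>" "B' \<noteq> C'" by blast
      then show "B \<inter> C = {}"
        using partition_onD2[OF that] image_Int[OF assms(2), of B' C']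
        by (simp add: disjoint_def)
    qed
    ultimately show ?thesis using that by (auto simp: partition_on_def)
  qed
  have ty: "ptype d ((`) \<tau> ` \<pi>) = ptype d \<pi>" if "partition_on {1..d} \<pi>" for \<pi>
  proof -
    have "block \<pi> d \<in> \<pi>" "d \<in> block \<pi> d" using block_mem[OF that] assms(5) by simp_all
    then have b: "block ((`) \<tau> ` \<pi>) d = \<tau> ` block \<pi> d"
      using block_eq[OF part[OF that], of "\<tau> ` block \<pi> d" d] assms(4) by (metis imageI)
    have "(`) \<tau> ` \<pi> - {\<tau> ` block \<pi> d} = (`) \<tau> ` (\<pi> - {block \<pi> d})"
      using inj2 by (metis image_empty image_insert image_set_diff)
    moreover have "mset_set ((`) \<tau> ` (\<pi> - {block \<pi> d})) = image_mset ((`) \<tau>) (mset_set (\<pi> - {block \<pi> d}))"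
      using inj2 by (metis image_mset_mset_set inj_on_subset subset_UNIV)
    ultimately show ?thesis
      using assms(2) unfolding ptype_def b
      by (simp add: multiset.map_comp comp_def card_image inj_on_subset[OF assms(2)])
  qed
  obtain c where c: "\<And>\<kappa>. f \<kappa> = (\<Sum>\<pi>\<in>?P. c \<pi> * cliques \<pi> \<kappa>)"
    using class_fun_expansion[OF assms(1)] by blast
  have "cliques \<pi> (\<kappa> \<circ> \<tau>) = cliques ((`) \<tau> ` \<pi>) \<kappa>" for \<pi> \<kappa>
  proof -
    have "inj_on (\<kappa> \<circ> \<tau>) B \<longleftrightarrow> inj_on \<kappa> (\<tau> ` B)" for B
      using comp_inj_on_iff[of \<tau> B \<kappa>] inj_on_subset[OF assms(2)] by simp
    then show ?thesis by (simp add: cliques_def)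
  qed
  then have "ubc_of d (\<lambda>\<kappa>. f (\<kappa> \<circ> \<tau>)) t = ubc_of d (\<lambda>\<kappa>. \<Sum>\<pi>\<in>?P. c \<pi> * cliques ((`) \<tau> ` \<pi>) \<kappa>) t"
    unfolding c by simp
  also have "\<dots> = (\<Sum>\<pi>\<in>?P. c \<pi> * ubc_of d (cliques ((`) \<tau> ` \<pi>)) t)"
    by (rule ubc_of_linear[OF fin]) (use part class_fun_partition in blast)
  also have "\<dots> = (\<Sum>\<pi>\<in>?P. c \<pi> * of_bool (ptype d \<pi> = t))"
    by (rule sum.cong) (auto simp: ubc_of_cliques[OF part] ty)
  finally show ?thesis using ubc_of_expansion[of f, OF c] by simp
qed

lemma ubc_of_transpose:
  assumes "class_fun d f" "x \<in> {1..<d}" "y \<in> {1..<d}"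
  shows "ubc_of d (\<lambda>\<kappa>. f (\<kappa> \<circ> transpose x y)) t = ubc_of d f t"
proof (rule ubc_of_permute[OF assms(1)])
  show "transpose x y ` {1..d} = {1..d}" using assms(2,3) by (intro transpose_image_eq) auto
qed (use assms in auto)

definition ubc_nonneg :: "nat \<Rightarrow> ((nat \<Rightarrow> nat) \<Rightarrow> rat) \<Rightarrow> bool" where
  "ubc_nonneg d f \<longleftrightarrow> class_fun d f \<and> (\<forall>t. 0 \<le> ubc_of d f t)"

text \<open>
  It suffices to treat \<open>f = cliques \<pi>\<close>, provided that the outcome depends on the type of \<open>\<pi>\<close> only.
\<close>

lemma ubc_nonneg_times:
  assumes f: "ubc_nonneg d f" and "d \<le> D" and q: "class_fun D q"
    and nonneg: "\<And>\<pi> t. partition_on {1..d} \<pi> \<Longrightarrow> 0 \<le> V (ptype d \<pi>) t"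
    and V: "\<And>\<pi> t. partition_on {1..d} \<pi> \<Longrightarrow> ubc_of D (\<lambda>\<kappa>. cliques \<pi> \<kappa> * q \<kappa>) t = V (ptype d \<pi>) t"
  shows "ubc_nonneg D (\<lambda>\<kappa>. f \<kappa> * q \<kappa>)"
  unfolding ubc_nonneg_def
proof (intro conjI allI)
  have cf: "class_fun d f" using f by (simp add: ubc_nonneg_def)
  show "class_fun D (\<lambda>\<kappa>. f \<kappa> * q \<kappa>)" using class_fun_mult[OF class_fun_mono[OF cf assms(2)] q] .
  fix t
  let ?P = "{\<pi>. partition_on {1..d} \<pi>}"
  have fin: "finite ?P" using finite_partitions[of "{1..d}" "\<lambda>_. True"] by simp
  obtain c where c: "\<And>\<kappa>. f \<kappa> = (\<Sum>\<pi>\<in>?P. c \<pi> * cliques \<pi> \<kappa>)"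
    using class_fun_expansion[OF cf] by blast
  have clq: "class_fun D (\<lambda>\<kappa>. cliques \<pi> \<kappa> * q \<kappa>)" if "\<pi> \<in> ?P" for \<pi>
    using that assms(2) by (intro class_fun_mult q class_fun_cliques) (auto simp: partition_on_def)
  have "f \<kappa> * q \<kappa> = (\<Sum>\<pi>\<in>?P. c \<pi> * (cliques \<pi> \<kappa> * q \<kappa>))" for \<kappa>
    unfolding c by (simp add: sum_distrib_right mult.assoc)
  then have "ubc_of D (\<lambda>\<kappa>. f \<kappa> * q \<kappa>) t = (\<Sum>\<pi>\<in>?P. c \<pi> * ubc_of D (\<lambda>\<kappa>. cliques \<pi> \<kappa> * q \<kappa>) t)"
    using ubc_of_linear[OF fin clq, where a = c and t = t] by simp
  also have "\<dots> = (\<Sum>\<pi>\<in>?P. c \<pi> * V (ptype d \<pi>) t)"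
    by (rule sum.cong) (auto simp: V)
  \<comment> \<open>A single coefficient \<open>c \<pi>\<close> may be negative; only its sum over
    all \<pi> of one type, which is a coefficient of \<open>ubc_of d f\<close>, is known to be
    nonnegative.\<close>
  also have "\<dots> = (\<Sum>s\<in>ptype d ` ?P. \<Sum>\<pi>\<in>{\<pi>\<in>?P. ptype d \<pi> = s}. c \<pi> * V (ptype d \<pi>) t)"
    by (rule sum.image_gen[OF fin])
  also have "\<dots> = (\<Sum>s\<in>ptype d ` ?P. ubc_of d f s * V s t)"
  proof (rule sum.cong[OF refl])
    fix s
    have "(\<Sum>\<pi>\<in>{\<pi>\<in>?P. ptype d \<pi> = s}. c \<pi> * V (ptype d \<pi>) t) =
        (\<Sum>\<pi>\<in>?P. c \<pi> * of_bool (ptype d \<pi> = s) * V s t)"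
      by (rule sum.mono_neutral_cong_left) (use fin in auto)
    also have "\<dots> = ubc_of d f s * V s t"
      unfolding ubc_of_expansion[of f, OF c] by (rule sum_distrib_right[symmetric])
    finally show "(\<Sum>\<pi>\<in>{\<pi>\<in>?P. ptype d \<pi> = s}. c \<pi> * V (ptype d \<pi>) t) = ubc_of d f s * V s t" .
  qed
  also have "\<dots> \<ge> 0"
  proof (intro sum_nonneg mult_nonneg_nonneg)
    show "0 \<le> ubc_of d f s" for s using f unfolding ubc_nonneg_def by blast
    show "0 \<le> V s t" if "s \<in> ptype d ` ?P" for s using nonneg that by blast
  qed
  finally show "0 \<le> ubc_of D (\<lambda>\<kappa>. f \<kappa> * q \<kappa>) t" .
qed

section \<open>Two cliques sharing a vertex\<close>

text \<open>By injectivity at most one element of \<open>T\<close> shares the colour of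
  \<open>x\<close>, so inclusion-exclusion stops after the first term.\<close>

lemma of_bool_notin_image:
  assumes "finite T" "inj_on \<kappa> T"
  shows "of_bool (\<kappa> x \<notin> \<kappa> ` T) = 1 - (\<Sum>y\<in>T. of_bool (\<kappa> x = \<kappa> y) :: rat)"
proof (cases "\<kappa> x \<in> \<kappa> ` T")
  case True
  then obtain z where z: "z \<in> T" "\<kappa> x = \<kappa> z" by blast
  have "(\<Sum>y\<in>T. of_bool (\<kappa> x = \<kappa> y) :: rat) = (\<Sum>y\<in>T. if y = z then 1 else 0)"
    using z assms(2) by (intro sum.cong) (auto simp: inj_on_def)
  then show ?thesis using True z assms(1) by simp
next
  case False
  then have "(\<Sum>y\<in>T. of_bool (\<kappa> x = \<kappa> y) :: rat) = 0" by (intro sum.neutral) auto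
  then show ?thesis using False by simp
qed

lemma inj_on_comp_transpose:
  assumes "x \<in> B \<longleftrightarrow> y \<in> B"
  shows "inj_on (\<kappa> \<circ> transpose x y) B \<longleftrightarrow> inj_on \<kappa> B"
  using comp_inj_on_iff[of "transpose x y" B \<kappa>] transpose_image_eq[of x B y] assms
  by (metis inj_on_transpose)

text \<open>
  The type of a partition with blocks of sizes \<open>l\<close>, a further block of size \<open>i\<close> (no block if
  \<open>i = 0\<close>), and a block of size \<open>s - i\<close> containing the last element.
\<close>

definition two_type :: "nat multiset \<Rightarrow> nat \<Rightarrow> nat \<Rightarrow> nat multiset \<times> nat" where
  "two_type l s i = (l + (if i = 0 then {#} else {#i#}), s - i)"

text \<open>For \<open>i < s\<close> the binomial counts the splittings of an
  \<open>s\<close>-element set into a part of size \<open>i\<close> avoiding the last element and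
  the rest. In this normalisation the closed forms below have integer coefficients.\<close>

definition two_term :: "nat multiset \<Rightarrow> nat \<Rightarrow> nat multiset \<times> nat \<Rightarrow> nat \<Rightarrow> rat" where
  "two_term l s t i = of_nat ((s - 1) choose i) * of_bool (two_type l s i = t)"

text \<open>
  The closed forms below solve the recurrences \<open>glue_last_sum_step\<close> and \<open>glue_sum_step\<close>, in which the
  shared vertex is replaced by a vertex moved from one clique to the other. Up to a binomial factor
  they are the coefficients of two cliques of sizes \<open>b\<close> and \<open>s + 1 - b\<close> sharing the last vertex and
  sharing another vertex, respectively.
\<close>

definition glue_last_sum :: "nat multiset \<Rightarrow> nat \<Rightarrow> nat multiset \<times> nat \<Rightarrow> nat \<Rightarrow> rat" where
  "glue_last_sum l s t b = (\<Sum>i<s. (of_bool (i \<le> s - b) - of_bool (b \<le> i)) * two_term l s t i)"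

text \<open>This is max 0 (n - i) for i < b and max 0 (i - n) for b \<le> i, so it is never
  negative.\<close>

definition glue_coeff :: "nat \<Rightarrow> nat \<Rightarrow> nat \<Rightarrow> rat" where
  "glue_coeff b n i = max 0 (of_nat n - of_nat i) - of_bool (b \<le> i) * (of_nat n - of_nat i)"

definition glue_sum :: "nat multiset \<Rightarrow> nat \<Rightarrow> nat multiset \<times> nat \<Rightarrow> nat \<Rightarrow> rat" where
  "glue_sum l s t b = (\<Sum>i<s. glue_coeff b (s - b) i * two_term l s t i)"

section \<open>Recurrences and signs of the closed forms\<close>

lemma two_term_nonneg: "0 \<le> two_term l s t i"
  by (simp add: two_term_def)

lemma sum_of_bool_eq_times:
  fixes f :: "nat \<Rightarrow> rat"
  assumes "j < s"
  shows "(\<Sum>i<s. of_bool (i = j) * f i) = f j"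
proof -
  have "(\<Sum>i<s. of_bool (i = j) * f i) = (\<Sum>i<s. if i = j then f j else 0)"
    by (rule sum.cong) auto
  then show ?thesis using assms by simp
qed

lemma glue_last_sum_step:
  assumes "1 \<le> b" "b < s"
  shows "glue_last_sum l s t b =
    two_term l s t (s - b) - two_term l s t b + glue_last_sum l s t (Suc b)"
proof -
  have "glue_last_sum l s t b =
      (\<Sum>i<s. of_bool (i = s - b) * two_term l s t i) - (\<Sum>i<s. of_bool (i = b) * two_term l s t i) +
      glue_last_sum l s t (Suc b)"
    unfolding glue_last_sum_def sum_subtractf[symmetric] sum.distrib[symmetric]
    using assms by (intro sum.cong refl) (auto simp: algebra_simps)
  then show ?thesis using assms by (simp add: sum_of_bool_eq_times)
qed

lemma glue_sum_step:
  assumes "1 \<le> b" "b < s"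
  shows "glue_sum l s t b =
    (of_nat b - of_nat (s - b)) * two_term l s t b + glue_sum l s t (Suc b) + glue_last_sum l s t (Suc b)"
proof -
  \<comment> \<open>Coefficientwise form of the recurrence. Lowering \<open>s - b\<close> by one
    changes the slope terms by the two indicators of \<open>glue_last_sum\<close>, and moving the
    threshold past \<open>b\<close> leaves the boundary term at \<open>i = b\<close>.\<close>
  have c: "glue_coeff b (s - b) i =
      (of_nat b - of_nat (s - b)) * of_bool (i = b) + glue_coeff (Suc b) (s - Suc b) i +
      (of_bool (i \<le> s - Suc b) - of_bool (Suc b \<le> i))" for i
  proof -
    obtain n where n: "s = b + Suc n" using assms less_iff_Suc_add by auto
    show ?thesis unfolding glue_coeff_def n by (auto simp: max_def algebra_simps)
  qed
  have "glue_sum l s t b =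
      (of_nat b - of_nat (s - b)) * (\<Sum>i<s. of_bool (i = b) * two_term l s t i) +
      glue_sum l s t (Suc b) + glue_last_sum l s t (Suc b)"
    unfolding glue_sum_def glue_last_sum_def sum_distrib_left sum.distrib[symmetric]
    by (intro sum.cong refl) (subst c, simp add: algebra_simps)
  then show ?thesis using assms by (simp add: sum_of_bool_eq_times)
qed

lemma glue_sum_nonneg: "0 \<le> glue_sum l s t b"
  unfolding glue_sum_def
  by (intro sum_nonneg mult_nonneg_nonneg two_term_nonneg) (auto simp: glue_coeff_def max_def)

lemma glue_sum_last: "glue_sum l s t s = 0"
  unfolding glue_sum_def by (rule sum.neutral) (simp add: glue_coeff_def)

text \<open>Only the coefficient at \<open>i = b\<close> is in doubt. There \<open>glue_sum\<close>
  contributes max 0 (s - b - 1 - b), and the total is max 0 (b + 1 - (s - b)).\<close>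

lemma glue_minus_sum_nonneg:
  assumes "1 \<le> b" "b < s"
  shows "0 \<le> (of_nat b + 1 - of_nat (s - b)) * two_term l s t b + glue_sum l s t (Suc b)"
proof -
  have "(of_nat b + 1 - of_nat (s - b)) * two_term l s t b + glue_sum l s t (Suc b) =
      (\<Sum>i<s. ((of_nat b + 1 - of_nat (s - b)) * of_bool (i = b) + glue_coeff (Suc b) (s - Suc b) i) *
        two_term l s t i)"
    using assms unfolding glue_sum_def
    by (simp add: distrib_right sum.distrib mult.assoc sum_distrib_left[symmetric] sum_of_bool_eq_times)
  also have "\<dots> \<ge> 0"
  proof (intro sum_nonneg mult_nonneg_nonneg two_term_nonneg)
    fix i
    obtain n where n: "s = b + Suc n" using assms less_iff_Suc_add by auto
    show "0 \<le> (of_nat b + 1 - of_nat (s - b)) * of_bool (i = b) + glue_coeff (Suc b) (s - Suc b) i"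
      unfolding glue_coeff_def n by (auto simp: max_def)
  qed
  finally show ?thesis .
qed

text \<open>Absorption, linking the weight used for cliques sharing a vertex to the binomial in
  \<open>two_term\<close>.\<close>

lemma choose_glue:
  assumes "1 \<le> b" "1 \<le> n" "s = b + n"
  shows "(s - 1) * ((s - 2) choose (b - 1)) = b * ((s - 1) choose b)"
proof -
  obtain a m where "b = Suc a" "n = Suc m" using assms by (cases b; cases n) auto
  then show ?thesis using Suc_times_binomial_eq[of "a + m" a] assms(3) by (simp add: mult.commute)
qed

text \<open>The blocks in \<rho> are spectators; the two cliques live on \<open>W\<close>, which
  contains the last vertex \<open>D\<close>. In the applications \<open>W\<close> is the block of
  the gluing vertex together with all new vertices.\<close>

locale two_cliques =
  fixes D :: nat and \<rho> :: "nat set set" and W :: "nat set" and t :: "nat multiset \<times> nat"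
  assumes \<rho>: "partition_on ({1..D} - W) \<rho>" and W: "W \<subseteq> {1..D}" and D: "D \<in> W"
begin

abbreviation "l \<equiv> image_mset card (mset_set \<rho>)"

abbreviation "s \<equiv> card W"

definition pair :: "nat set \<Rightarrow> nat set \<Rightarrow> (nat \<Rightarrow> nat) \<Rightarrow> rat" where
  "pair A N \<kappa> = cliques \<rho> \<kappa> * of_bool (inj_on \<kappa> A) * of_bool (inj_on \<kappa> N)"

lemma finite_W: "finite W"
  using W finite_subset by blast

lemma \<rho>_subset: "B \<in> \<rho> \<Longrightarrow> B \<subseteq> {1..D} - W"
  using partition_onD1[OF \<rho>] by blast

lemma class_pair:
  assumes "A \<subseteq> W" "N \<subseteq> W"
  shows "class_fun D (pair A N)"
proof -
  have "\<Union> \<rho> \<subseteq> {1..D}" using \<rho>_subset by blast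
  then have "class_fun D (\<lambda>\<kappa>. cliques \<rho> \<kappa> * of_bool (inj_on \<kappa> A) * of_bool (inj_on \<kappa> N))"
    using assms W by (intro class_fun_mult class_fun_cliques class_fun_inj_on) auto
  then show ?thesis by (simp add: pair_def[abs_def])
qed

lemma pair_commute: "pair A N = pair N A"
  by (auto simp: pair_def fun_eq_iff)

lemma ubc_of_pair:
  assumes "A \<union> N = W" "A \<inter> N = {}" "D \<in> N"
  shows "ubc_of D (pair A N) t = of_bool (two_type l s (card A) = t)"
proof -
  define \<pi> where "\<pi> = \<rho> \<union> ({A, N} - {{}})"
  have N: "N \<noteq> {}" using assms(3) by auto
  have fin: "finite A" "finite N" using finite_W assms(1) by auto
  have fin\<rho>: "finite \<rho>" using finite_elements[OF _ \<rho>] by simp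
  have dis\<rho>: "disjoint \<rho>" "{} \<notin> \<rho>" "\<Union> \<rho> = {1..D} - W"
    using \<rho> by (auto simp: partition_on_def)
  have AN: "A \<in> \<rho> \<Longrightarrow> A = {}" "N \<notin> \<rho>"
    using \<rho>_subset[of A] \<rho>_subset[of N] assms by auto
  have "\<Union> \<pi> = {1..D}" using dis\<rho>(3) assms(1) W unfolding \<pi>_def by auto
  moreover have "disjoint \<pi>"
    unfolding disjoint_def
  proof (intro ballI impI)
    fix B C assume BC: "B \<in> \<pi>" "C \<in> \<pi>" "B \<noteq> C"
    have 1: "B' \<inter> A = {}" "B' \<inter> N = {}" if "B' \<in> \<rho>" for B'
      using \<rho>_subset[OF that] assms(1) by auto
    have 2: "B \<inter> C = {}" if "B \<in> \<rho>" "C \<in> \<rho>"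
      using dis\<rho>(1) that BC(3) by (simp add: disjoint_def)
    consider "B \<in> \<rho>" "C \<in> \<rho>" | "B \<in> \<rho>" "C \<in> {A, N}" | "C \<in> \<rho>" "B \<in> {A, N}" | "B \<in> {A, N}" "C \<in> {A, N}"
      using BC unfolding \<pi>_def by blast
    then show "B \<inter> C = {}"
      by cases (use 1 2 assms(2) BC(3) in \<open>auto simp: Int_commute\<close>)
  qed
  moreover have "{} \<notin> \<pi>" using dis\<rho> unfolding \<pi>_def by auto
  ultimately have part: "partition_on {1..D} \<pi>" by (simp add: partition_on_def)
  have "pair A N = cliques \<pi>"
    unfolding pair_def cliques_def \<pi>_def by (auto simp: fun_eq_iff)
  then have "ubc_of D (pair A N) t = of_bool (ptype D \<pi> = t)"
    using ubc_of_cliques[OF part] by simp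
  also have "ptype D \<pi> = two_type l s (card A)"
  proof -
    have b: "block \<pi> D = N"
      by (rule block_eq[OF part]) (use assms(3) N in \<open>auto simp: \<pi>_def\<close>)
    have c: "card N = s - card A"
      using card_Un_disjoint[OF fin assms(2)] assms(1) by simp
    show ?thesis
    proof (cases "A = {}")
      case True
      then have "\<pi> - {N} = \<rho>" using N AN unfolding \<pi>_def by auto
      then show ?thesis using b c True by (simp add: ptype_def two_type_def)
    next
      case False
      then have "\<pi> - {N} = insert A \<rho>" "A \<notin> \<rho>" using N AN assms(2) unfolding \<pi>_def by auto
      then show ?thesis using b c False fin fin\<rho> by (simp add: ptype_def two_type_def)
    qed
  qed
  finally show ?thesis .
qed

lemma pair_insert:
  assumes "y \<notin> A"
  shows "pair (insert y A) N \<kappa> = pair A N \<kappa> * of_bool (\<kappa> y \<notin> \<kappa> ` A)"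
  using assms by (auto simp: pair_def inj_on_insert)

lemma pair_insert_right:
  assumes "x \<notin> N"
  shows "pair A (insert x N) = (\<lambda>\<kappa>. pair A N \<kappa> * of_bool (\<kappa> x \<notin> \<kappa> ` N))"
  using pair_insert[OF assms, of A] by (simp add: fun_eq_iff pair_commute[of A] del: of_bool_eq_iff)

text \<open>
  All pairs \<open>x \<in> A\<close>, \<open>y \<in> N\<close> with fixed \<open>y\<close> contribute equally, by a relabelling of \<open>A\<close>; summing
  over \<open>x\<close> counts the colourings in which the colour of \<open>y\<close> occurs in \<open>A\<close>.
\<close>

lemma ubc_of_coincidence:
  assumes "A \<union> N = W" "A \<inter> N = {}" "D \<in> N" "x \<in> A" "y \<in> N"
  shows "of_nat (card A) * ubc_of D (\<lambda>\<kappa>. pair A N \<kappa> * of_bool (\<kappa> x = \<kappa> y)) t =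
    of_bool (two_type l s (card A) = t) - ubc_of D (pair (insert y A) N) t"
proof -
  let ?S = "\<lambda>x \<kappa>. pair A N \<kappa> * of_bool (\<kappa> x = \<kappa> y)"
  have sub: "A \<subseteq> W" "N \<subseteq> W" and fin: "finite A" using assms(1) finite_W by auto
  have y: "y \<in> {1..D}" using assms(5) sub W by auto
  have cl: "class_fun D (?S z)" if "z \<in> A" for z
    using that y sub W by (intro class_fun_mult class_pair class_fun_eq) auto
  have eq: "ubc_of D (?S z) t = ubc_of D (?S x) t" if "z \<in> A" for z
  proof -
    have xz: "x \<in> {1..<D}" "z \<in> {1..<D}"
    proof -
      have "x \<in> {1..D}" "z \<in> {1..D}" "x \<noteq> D" "z \<noteq> D"
        using that assms(2-4) sub W by blast+
      then show "x \<in> {1..<D}" "z \<in> {1..<D}" by simp_all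
    qed
    have "cliques \<rho> (\<kappa> \<circ> transpose x z) = cliques \<rho> \<kappa>" for \<kappa>
    proof -
      have "inj_on (\<kappa> \<circ> transpose x z) B \<longleftrightarrow> inj_on \<kappa> B" if B: "B \<in> \<rho>" for B
      proof -
        have "x \<notin> B" "z \<notin> B" using \<rho>_subset[OF B] \<open>z \<in> A\<close> assms(4) sub by auto
        then show ?thesis by (simp add: inj_on_comp_transpose)
      qed
      then show ?thesis by (simp add: cliques_def)
    qed
    moreover have "inj_on (\<kappa> \<circ> transpose x z) A \<longleftrightarrow> inj_on \<kappa> A" for \<kappa> :: "nat \<Rightarrow> nat"
      by (rule inj_on_comp_transpose) (simp add: that assms(4))
    moreover have "inj_on (\<kappa> \<circ> transpose x z) N \<longleftrightarrow> inj_on \<kappa> N" for \<kappa> :: "nat \<Rightarrow> nat"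
      by (rule inj_on_comp_transpose) (use that assms(2,4) in blast)
    moreover have "(\<kappa> \<circ> transpose x z) x = \<kappa> z" "(\<kappa> \<circ> transpose x z) y = \<kappa> y" for \<kappa> :: "nat \<Rightarrow> nat"
      using that assms by (auto simp: transpose_def)
    ultimately have "?S x (\<kappa> \<circ> transpose x z) = ?S z \<kappa>" for \<kappa>
      by (simp only: pair_def)
    then show ?thesis using ubc_of_transpose[OF cl[OF assms(4)] xz] by simp
  qed
  have "pair A N \<kappa> - pair (insert y A) N \<kappa> = (\<Sum>z\<in>A. ?S z \<kappa>)" for \<kappa>
  proof (cases "inj_on \<kappa> A")
    case True
    have "y \<notin> A" using assms by auto
    then have "pair A N \<kappa> - pair (insert y A) N \<kappa> = pair A N \<kappa> * (1 - of_bool (\<kappa> y \<notin> \<kappa> ` A))"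
      by (simp add: pair_insert algebra_simps)
    also have "\<dots> = pair A N \<kappa> * (\<Sum>z\<in>A. of_bool (\<kappa> y = \<kappa> z))"
      using of_bool_notin_image[OF fin True, of y] by simp
    finally show ?thesis by (simp add: sum_distrib_left eq_commute)
  next
    case False
    then show ?thesis by (simp add: pair_def)
  qed
  then have "ubc_of D (\<lambda>\<kappa>. pair A N \<kappa> - pair (insert y A) N \<kappa>) t = (\<Sum>z\<in>A. ubc_of D (?S z) t)"
    using ubc_of_sum[OF fin cl, where t = t] by simp
  then have "ubc_of D (pair A N) t - ubc_of D (pair (insert y A) N) t =
      of_nat (card A) * ubc_of D (?S x) t"
    using eq ubc_of_diff[OF class_pair[OF sub] class_pair[OF _ sub(2), of "insert y A"], of t] sub assms(5)
    by auto
  then show ?thesis using ubc_of_pair[OF assms(1-3)] by simp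
qed

lemma ubc_of_notin:
  assumes "A \<union> N = W" "A \<inter> N = {}" "x \<in> A" "T \<subseteq> N"
  shows "ubc_of D (\<lambda>\<kappa>. pair A N \<kappa> * of_bool (\<kappa> x \<notin> \<kappa> ` T)) t =
    ubc_of D (pair A N) t - (\<Sum>y\<in>T. ubc_of D (\<lambda>\<kappa>. pair A N \<kappa> * of_bool (\<kappa> x = \<kappa> y)) t)"
proof -
  have sub: "A \<subseteq> W" "N \<subseteq> W" and fin: "finite T"
    using assms finite_W finite_subset[of T W] by auto
  have cl: "class_fun D (\<lambda>\<kappa>. pair A N \<kappa> * of_bool (\<kappa> x = \<kappa> z))" if "z \<in> T" for z
    using that assms sub W by (intro class_fun_mult class_pair class_fun_eq) auto
  have "pair A N \<kappa> * of_bool (\<kappa> x \<notin> \<kappa> ` T) =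
      pair A N \<kappa> - (\<Sum>y\<in>T. pair A N \<kappa> * of_bool (\<kappa> x = \<kappa> y))" for \<kappa>
  proof (cases "inj_on \<kappa> N")
    case True
    then have "inj_on \<kappa> T" using assms(4) inj_on_subset by blast
    then show ?thesis using of_bool_notin_image[OF fin, of \<kappa> x]
      by (simp add: sum_distrib_left right_diff_distrib)
  next
    case False
    then show ?thesis by (simp add: pair_def)
  qed
  then show ?thesis
    using ubc_of_diff[OF class_pair[OF sub] class_fun_sum[of T D, OF cl], where t = t]
      ubc_of_sum[OF fin cl, where t = t] by simp
qed

text \<open>Adding \<open>D\<close> to \<open>N\<close> subtracts the coincidences of
  \<open>D\<close> with each \<open>y\<close> in \<open>N\<close>. Each of these is, up to division
  by \<open>card A\<close>, the difference of a two-block term and the same configuration with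
  \<open>y\<close> moved from \<open>N\<close> to \<open>A\<close>; hence the induction on
  \<open>card N\<close>.\<close>

lemma ubc_of_glue_last:
  assumes "A \<union> N = W" "A \<inter> N = {}" "D \<in> A"
  shows "of_nat ((s - 1) choose (card A - 1)) * ubc_of D (pair A (insert D N)) t =
    glue_last_sum l s t (card A)"
  using assms
proof (induction "card N" arbitrary: A N)
  case 0
  then have N: "N = {}" "A = W" using finite_W by auto
  \<comment> \<open>The one-vertex clique \<open>{D}\<close> imposes no condition, so a single
    clique on \<open>W\<close> remains, which is the case \<open>i = 0\<close> of
    \<open>two_type\<close>.\<close>
  have "pair W {D} = pair {} W" by (auto simp: pair_def fun_eq_iff)
  then have "ubc_of D (pair A (insert D N)) t = of_bool (two_type l s 0 = t)"
    using ubc_of_pair[of "{}" W] N D by simp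
  moreover have "glue_last_sum l s t s = two_term l s t 0"
  proof -
    have s: "0 < s" using D finite_W card_gt_0_iff by blast
    have "glue_last_sum l s t s = (\<Sum>i<s. of_bool (i = 0) * two_term l s t i)"
      unfolding glue_last_sum_def by (rule sum.cong) auto
    then show ?thesis using s by (simp add: sum_of_bool_eq_times)
  qed
  ultimately show ?case using N by (simp add: two_term_def)
next
  case (Suc n N A)
  define b where "b = card A"
  have fin: "finite A" "finite N" using Suc.prems(1) finite_W by auto
  have b: "1 \<le> b" using Suc.prems(3) fin card_gt_0_iff[of A] unfolding b_def by fastforce
  have s: "s = b + card N" using card_Un_disjoint[OF fin Suc.prems(2)] Suc.prems(1) b_def by simp
  then have bs: "b < s" using Suc.hyps(2) by simp
  let ?v = "of_bool (two_type l s b = t) :: rat"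
  \<comment> \<open>\<open>ubc_of_coincidence\<close> wants \<open>D\<close> in the second clique.
    Where \<open>D\<close> and \<open>y\<close> have the same colour they may be exchanged between
    the cliques, which puts \<open>D\<close> there.\<close>
  have step: "of_nat b * ubc_of D (\<lambda>\<kappa>. pair A N \<kappa> * of_bool (\<kappa> D = \<kappa> y)) t =
      ?v - ubc_of D (pair (insert y A) (insert D (N - {y}))) t" if y: "y \<in> N" for y
  proof -
    let ?A = "insert y (A - {D})" and ?N = "insert D (N - {y})"
    have yA: "y \<noteq> D" "y \<notin> A" "D \<notin> N" using y Suc.prems by auto
    have "inj_on \<kappa> A \<and> inj_on \<kappa> N \<longleftrightarrow> inj_on \<kappa> ?A \<and> inj_on \<kappa> ?N" if "\<kappa> D = \<kappa> y" for \<kappa> :: "nat \<Rightarrow> nat"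
    proof -
      have A: "A = insert D (A - {D})" and N: "N = insert y (N - {y})" using Suc.prems(3) y by auto
      have "inj_on \<kappa> A \<longleftrightarrow> inj_on \<kappa> ?A"
        by (subst A) (use yA that in \<open>simp only: inj_on_insert Diff_idemp, auto\<close>)
      moreover have "inj_on \<kappa> N \<longleftrightarrow> inj_on \<kappa> ?N"
        by (subst N) (use yA that in \<open>simp only: inj_on_insert Diff_idemp, auto\<close>)
      ultimately show ?thesis by simp
    qed
    then have "inj_on \<kappa> A \<and> inj_on \<kappa> N \<and> \<kappa> D = \<kappa> y \<longleftrightarrow> inj_on \<kappa> ?A \<and> inj_on \<kappa> ?N \<and> \<kappa> y = \<kappa> D"
      for \<kappa> :: "nat \<Rightarrow> nat"
      by metis
    then have "(\<lambda>\<kappa>. pair A N \<kappa> * of_bool (\<kappa> D = \<kappa> y)) = (\<lambda>\<kappa>. pair ?A ?N \<kappa> * of_bool (\<kappa> y = \<kappa> D))"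
      by (simp only: pair_def mult.assoc of_bool_conj[symmetric] conj_assoc)
    moreover have "card ?A = b"
      using Suc.prems(3) yA fin card_Suc_Diff1[of A D] unfolding b_def by simp
    moreover have "insert D ?A = insert y A" using Suc.prems(3) by auto
    moreover have "?A \<union> ?N = W" "?A \<inter> ?N = {}" "D \<in> ?N" "y \<in> ?A"
      using Suc.prems y yA by auto
    note ubc_of_coincidence[OF this(1,2,3,4,3)]
    ultimately show ?thesis by (simp only:)
  qed
  have IH: "of_nat ((s - 1) choose b) * ubc_of D (pair (insert y A) (insert D (N - {y}))) t =
      glue_last_sum l s t (Suc b)" if y: "y \<in> N" for y
  proof -
    have "n = card (N - {y})" using Suc.hyps(2) y fin by simp
    moreover have "insert y A \<union> (N - {y}) = W" "insert y A \<inter> (N - {y}) = {}" "D \<in> insert y A"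
      using Suc.prems y by auto
    moreover have "y \<notin> A" using y Suc.prems(2) by blast
    then have "card (insert y A) = Suc b" using fin b_def by simp
    ultimately show ?thesis using Suc.hyps(1)[of "N - {y}" "insert y A"] by simp
  qed
  let ?w = "of_nat ((s - 1) choose (b - 1)) :: rat" and ?w' = "of_nat ((s - 1) choose b) :: rat"
  \<comment> \<open>This identity trades the division by \<open>b\<close> and the
    \<open>card N\<close> choices of \<open>y\<close> for the change of weight from \<open>b\<close>
    to \<open>b + 1\<close>.\<close>
  have w: "of_nat b * ?w' = of_nat (card N) * ?w"
  proof -
    have "b * ((s - 1) choose b) = card N * ((s - 1) choose (b - 1))"
    proof -
      obtain a where "b = Suc a" using b by (cases b) auto
      then show ?thesis using Suc_times_binomial_add[of a n] s Suc.hyps(2)[symmetric] by simp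
    qed
    then show ?thesis by (metis of_nat_mult)
  qed
  have "D \<notin> N" using Suc.prems(2,3) by blast
  then have "ubc_of D (pair A (insert D N)) t =
      ubc_of D (pair N A) t - (\<Sum>y\<in>N. ubc_of D (\<lambda>\<kappa>. pair A N \<kappa> * of_bool (\<kappa> D = \<kappa> y)) t)"
    using ubc_of_notin[OF Suc.prems order_refl] by (simp add: pair_insert_right pair_commute[of N A])
  moreover have "ubc_of D (pair N A) t = of_bool (two_type l s (s - b) = t)"
    using ubc_of_pair[of N A] Suc.prems s by (simp add: Un_commute Int_commute)
  ultimately have "of_nat b * ubc_of D (pair A (insert D N)) t =
      of_nat b * of_bool (two_type l s (s - b) = t) -
      (\<Sum>y\<in>N. ?v - ubc_of D (pair (insert y A) (insert D (N - {y}))) t)"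
    using step by (simp add: right_diff_distrib sum_distrib_left)
  then have e: "of_nat b * ubc_of D (pair A (insert D N)) t =
      of_nat b * of_bool (two_type l s (s - b) = t) -
      (of_nat (card N) * ?v - (\<Sum>y\<in>N. ubc_of D (pair (insert y A) (insert D (N - {y}))) t))"
    by (simp only: sum_subtractf sum_constant)
  have "c * (w * P) = c * (w * v') - n * w * v + w * G"
    if "c * P = c * v' - (n * v - G)" for c w P v v' n G :: rat
    using arg_cong[OF that, of "(*) w"] by (simp add: algebra_simps)
  from this[OF e] have "of_nat b * (?w * ubc_of D (pair A (insert D N)) t) =
      of_nat b * (?w * of_bool (two_type l s (s - b) = t)) - of_nat (card N) * ?w * ?v +
      (\<Sum>y\<in>N. ?w * ubc_of D (pair (insert y A) (insert D (N - {y}))) t)"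
    unfolding sum_distrib_left[symmetric] .
  moreover have "(\<Sum>y\<in>N. ?w * ubc_of D (pair (insert y A) (insert D (N - {y}))) t) =
      of_nat b * glue_last_sum l s t (Suc b)"
  proof -
    have "of_nat (card N) * (?w * ubc_of D (pair (insert y A) (insert D (N - {y}))) t) =
        of_nat b * glue_last_sum l s t (Suc b)" if "y \<in> N" for y
      using IH[OF that] w by (metis mult.assoc)
    then have "of_nat (card N) * (\<Sum>y\<in>N. ?w * ubc_of D (pair (insert y A) (insert D (N - {y}))) t) =
        of_nat (card N) * (of_nat b * glue_last_sum l s t (Suc b))"
      by (simp add: sum_distrib_left)
    then show ?thesis using Suc.hyps(2) by (simp del: sum_distrib_left)
  qed
  moreover have "?w * of_bool (two_type l s (s - b) = t) = two_term l s t (s - b)"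
    using binomial_symmetric[of "b - 1" "s - 1"] b bs by (simp add: two_term_def)
  moreover have "of_nat (card N) * ?w * ?v = of_nat b * two_term l s t b"
    using w by (simp add: two_term_def mult.assoc[symmetric])
  ultimately have "of_nat b * (?w * ubc_of D (pair A (insert D N)) t) =
      of_nat b * glue_last_sum l s t b"
    unfolding glue_last_sum_step[OF b bs] by (simp add: algebra_simps)
  then show ?case using b unfolding b_def[symmetric] by simp
qed

text \<open>The values for cliques sharing \<open>y\<close> are a hypothesis, so that the lemma
  serves both inside the induction for \<open>ubc_of_glue\<close>, fed with the induction
  hypothesis, and after it for the graph lacking one edge. The coincidence with \<open>D\<close> is
  left out because it follows a different formula.\<close>

lemma ubc_of_glue_coincidences:
  assumes "A \<union> N = W" "A \<inter> N = {}" "D \<in> N" "x \<in> A"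
    and glue: "\<And>y. y \<in> N - {D} \<Longrightarrow> of_nat ((s - 1) * ((s - 2) choose card A)) *
      ubc_of D (pair (insert y A) N) t = glue_sum l s t (Suc (card A))"
  shows "of_nat ((s - 1) * ((s - 2) choose (card A - 1))) *
      (\<Sum>y\<in>N - {D}. ubc_of D (\<lambda>\<kappa>. pair A N \<kappa> * of_bool (\<kappa> x = \<kappa> y)) t) =
    (of_nat (card N) - 1) * two_term l s t (card A) - glue_sum l s t (Suc (card A))"
proof -
  define b where "b = card A"
  have fin: "finite A" "finite N" using assms(1) finite_W by auto
  have b: "1 \<le> b" using assms(4) fin card_gt_0_iff[of A] unfolding b_def by fastforce
  have s: "s = b + card N" using card_Un_disjoint[OF fin assms(2)] assms(1) b_def by simp
  obtain m where m: "card N = Suc m" using assms(3) fin by (cases "card N") auto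
  obtain a where a: "b = Suc a" using b by (cases b) auto
  have cm: "card (N - {D}) = m" using m assms(3) fin by simp
  define u :: rat where "u = of_nat ((s - 1) * ((s - 2) choose (b - 1)))"
  define u' :: rat where "u' = of_nat ((s - 1) * ((s - 2) choose b))"
  have u: "u * of_bool (two_type l s b = t) = of_nat b * two_term l s t b"
    using choose_glue[of b "card N"] b m s unfolding u_def two_term_def by (simp add: mult.assoc)
  have uu: "of_nat b * u' = of_nat m * u"
  \<comment> \<open>For \<open>m = 0\<close> both sides vanish: then \<open>s - 2 = b - 1\<close>,
    which makes \<open>(s - 2) choose b\<close> zero.\<close>
  proof (cases m)
    case 0
    then show ?thesis using s a m by (simp add: u'_def binomial_eq_0)
  next
    case (Suc k)
    then have "b * ((s - 2) choose b) = m * ((s - 2) choose (b - 1))"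
      using Suc_times_binomial_add[of a k] s a m by simp
    then have "b * ((s - 1) * ((s - 2) choose b)) = m * ((s - 1) * ((s - 2) choose (b - 1)))"
      by (simp only: mult.left_commute[of b] mult.left_commute[of m])
    then have "(of_nat (b * ((s - 1) * ((s - 2) choose b))) :: rat) =
        of_nat (m * ((s - 1) * ((s - 2) choose (b - 1))))"
      by (rule arg_cong)
    then show ?thesis unfolding u_def u'_def by (simp only: of_nat_mult)
  qed
  let ?S = "\<lambda>y. ubc_of D (\<lambda>\<kappa>. pair A N \<kappa> * of_bool (\<kappa> x = \<kappa> y)) t"
  have S: "of_nat m * (u * ?S y) = of_nat m * two_term l s t b - glue_sum l s t (Suc b)"
    if y: "y \<in> N - {D}" for y
  proof -
    let ?g = "ubc_of D (pair (insert y A) N) t"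
    have g: "u' * ?g = glue_sum l s t (Suc b)" using glue[OF y] unfolding u'_def b_def .
    have "of_nat b * ?S y = of_bool (two_type l s b = t) - ?g"
      using ubc_of_coincidence[OF assms(1-4), of y] y b_def by simp
    then have "of_nat m * u * (of_nat b * ?S y) = of_nat m * u * (of_bool (two_type l s b = t) - ?g)"
      by (simp only:)
    then have "of_nat b * (of_nat m * (u * ?S y)) =
        of_nat m * u * (of_bool (two_type l s b = t) - ?g)" by (simp only: mult_ac)
    also have "\<dots> = of_nat m * (of_nat b * two_term l s t b) - of_nat b * (u' * ?g)"
      using u uu by (simp add: right_diff_distrib mult.assoc[symmetric])
    also have "\<dots> = of_nat b * (of_nat m * two_term l s t b - glue_sum l s t (Suc b))"
      using g by (simp add: algebra_simps)
    finally show ?thesis using b by simp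
  qed
  have "u * (\<Sum>y\<in>N - {D}. ?S y) = of_nat m * two_term l s t b - glue_sum l s t (Suc b)"
  \<comment> \<open>If \<open>N = {D}\<close> there is no \<open>y\<close> to which \<open>S\<close>
    could be applied and no dividing by \<open>m\<close>; the claim then rests on
    \<open>glue_sum_last\<close>.\<close>
  proof (cases "m = 0")
    case True
    then have ND: "N - {D} = {}" and "s = Suc b" using cm fin s m by auto
    then show ?thesis unfolding ND using True glue_sum_last[of l s t] by simp
  next
    case False
    have "of_nat m * (u * (\<Sum>y\<in>N - {D}. ?S y)) = (\<Sum>y\<in>N - {D}. of_nat m * (u * ?S y))"
      by (simp add: sum_distrib_left)
    also have "\<dots> = (\<Sum>y\<in>N - {D}. of_nat m * two_term l s t b - glue_sum l s t (Suc b))"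
      by (rule sum.cong[OF refl S])
    also have "\<dots> = of_nat m * (of_nat m * two_term l s t b - glue_sum l s t (Suc b))"
      using cm by simp
    finally show ?thesis using False by simp
  qed
  then show ?thesis unfolding u_def b_def using m by simp
qed

text \<open>Adding \<open>x\<close> to \<open>N\<close> subtracts the coincidences of
  \<open>x\<close> with each \<open>y\<close> in \<open>N\<close>. For \<open>y\<close> other than
  \<open>D\<close> this leads to cliques sharing \<open>y\<close>, with \<open>y\<close> moved into
  \<open>A\<close>, covered by induction; for \<open>y = D\<close> it leads to cliques sharing
  \<open>D\<close>, covered by \<open>ubc_of_glue_last\<close>.\<close>

lemma ubc_of_glue:
  assumes "A \<union> N = W" "A \<inter> N = {}" "D \<in> N" "x \<in> A"
  shows "of_nat ((s - 1) * ((s - 2) choose (card A - 1))) * ubc_of D (pair A (insert x N)) t =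
    glue_sum l s t (card A)"
  using assms
proof (induction "card N" arbitrary: x A N rule: less_induct)
  case less
  define b where "b = card A"
  have fin: "finite A" "finite N" using less.prems(1) finite_W by auto
  have b: "1 \<le> b" using less.prems(4) fin card_gt_0_iff[of A] unfolding b_def by fastforce
  have s: "s = b + card N" using card_Un_disjoint[OF fin less.prems(2)] less.prems(1) b_def by simp
  have N: "1 \<le> card N" using less.prems(3) fin card_gt_0_iff[of N] by fastforce
  have bs: "b < s" using s N by simp
  let ?S = "\<lambda>y. ubc_of D (\<lambda>\<kappa>. pair A N \<kappa> * of_bool (\<kappa> x = \<kappa> y)) t"
  define u :: rat where "u = of_nat ((s - 1) * ((s - 2) choose (b - 1)))"
  have u: "u = of_nat b * of_nat ((s - 1) choose b)"
    using choose_glue[of b "card N"] b N s unfolding u_def by simp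
  have IH: "of_nat ((s - 1) * ((s - 2) choose card A)) *
      ubc_of D (pair (insert y A) N) t = glue_sum l s t (Suc (card A))" if y: "y \<in> N - {D}" for y
  proof -
    have "card (N - {y}) < card N" using y card_Diff1_less[OF fin(2)] by blast
    moreover have "insert y A \<union> (N - {y}) = W" "insert y A \<inter> (N - {y}) = {}" "D \<in> N - {y}"
      "y \<in> insert y A" using less.prems y by auto
    moreover have "y \<notin> A" using y less.prems(2) by blast
    then have "card (insert y A) = Suc (card A)" using fin by simp
    moreover have "insert y (N - {y}) = N" using y by blast
    ultimately show ?thesis using less.hyps[of "N - {y}" "insert y A" y] by simp
  qed
  have last: "u * ?S D = two_term l s t b - glue_last_sum l s t (Suc b)"
  proof -
    have "insert D A \<union> (N - {D}) = W" "insert D A \<inter> (N - {D}) = {}" "D \<in> insert D A"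
      using less.prems by auto
    note ubc_of_glue_last[OF this]
    moreover have "D \<notin> A" using less.prems(2,3) by blast
    then have "card (insert D A) = Suc b" using fin b_def by simp
    moreover have "insert D (N - {D}) = N" using less.prems(3) by blast
    ultimately have "of_nat ((s - 1) choose b) * ubc_of D (pair (insert D A) N) t =
        glue_last_sum l s t (Suc b)" by simp
    moreover have "of_nat b * ?S D = of_bool (two_type l s b = t) - ubc_of D (pair (insert D A) N) t"
      using ubc_of_coincidence[OF less.prems less.prems(3)] b_def by simp
    moreover have "u * ?S D = of_nat ((s - 1) choose b) * (of_nat b * ?S D)"
      unfolding u by simp
    ultimately show ?thesis by (simp add: two_term_def right_diff_distrib)
  qed
  have "x \<notin> N" using less.prems by auto
  then have "ubc_of D (pair A (insert x N)) t = ubc_of D (pair A N) t - (\<Sum>y\<in>N. ?S y)"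
    using ubc_of_notin[OF less.prems(1,2,4) order_refl] pair_insert_right by simp
  also have "(\<Sum>y\<in>N. ?S y) = ?S D + (\<Sum>y\<in>N - {D}. ?S y)"
    by (rule sum.remove[OF fin(2) less.prems(3)])
  finally have "u * ubc_of D (pair A (insert x N)) t =
      u * (ubc_of D (pair A N) t - (?S D + (\<Sum>y\<in>N - {D}. ?S y)))"
    by (simp only:)
  then have "u * ubc_of D (pair A (insert x N)) t =
      u * ubc_of D (pair A N) t - u * ?S D - u * (\<Sum>y\<in>N - {D}. ?S y)"
    by (simp only: right_diff_distrib distrib_left diff_diff_eq)
  moreover have "u * ubc_of D (pair A N) t = of_nat b * two_term l s t b"
    unfolding ubc_of_pair[OF less.prems(1-3)] u two_term_def b_def by (simp add: mult.assoc)
  moreover have "u * (\<Sum>y\<in>N - {D}. ?S y) =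
      (of_nat (card N) - 1) * two_term l s t b - glue_sum l s t (Suc b)"
    using ubc_of_glue_coincidences[OF less.prems IH] unfolding u_def b_def by simp
  ultimately show ?case
    unfolding u_def[symmetric] b_def[symmetric] glue_sum_step[OF b bs] using last s
    by (simp add: algebra_simps)
qed

text \<open>Without the edge from \<open>x\<close> to \<open>D\<close>, the coincidence of
  \<open>x\<close> with \<open>D\<close> is simply not subtracted, so the signed
  \<open>glue_last_sum\<close> disappears and the boundary coefficient at \<open>card A\<close>
  grows by one.\<close>

lemma ubc_of_glue_minus:
  assumes "A \<union> N = W" "A \<inter> N = {}" "D \<in> N" "x \<in> A"
  shows "of_nat ((s - 1) * ((s - 2) choose (card A - 1))) *
      ubc_of D (\<lambda>\<kappa>. pair A N \<kappa> * of_bool (\<kappa> x \<notin> \<kappa> ` (N - {D}))) t =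
    (of_nat (card A) + 1 - of_nat (s - card A)) * two_term l s t (card A) +
      glue_sum l s t (Suc (card A))"
proof -
  define b where "b = card A"
  have fin: "finite A" "finite N" using assms(1) finite_W by auto
  have b: "1 \<le> b" using assms(4) fin card_gt_0_iff[of A] unfolding b_def by fastforce
  have s: "s = b + card N" using card_Un_disjoint[OF fin assms(2)] assms(1) b_def by simp
  have N: "1 \<le> card N" using assms(3) fin card_gt_0_iff[of N] by fastforce
  define u :: rat where "u = of_nat ((s - 1) * ((s - 2) choose (b - 1)))"
  have u: "u = of_nat b * of_nat ((s - 1) choose b)"
    using choose_glue[of b "card N"] b N s unfolding u_def by simp
  have IH: "of_nat ((s - 1) * ((s - 2) choose card A)) *
      ubc_of D (pair (insert y A) N) t = glue_sum l s t (Suc (card A))" if y: "y \<in> N - {D}" for y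
  proof -
    have "insert y A \<union> (N - {y}) = W" "insert y A \<inter> (N - {y}) = {}" "D \<in> N - {y}"
      "y \<in> insert y A" using assms y by auto
    moreover have "y \<notin> A" using y assms(2) by blast
    then have "card (insert y A) = Suc (card A)" using fin by simp
    moreover have "insert y (N - {y}) = N" using y by blast
    ultimately show ?thesis using ubc_of_glue[of "insert y A" "N - {y}" y] by simp
  qed
  have "u * ubc_of D (pair A N) t = of_nat b * two_term l s t b"
    unfolding ubc_of_pair[OF assms(1-3)] u two_term_def b_def by (simp add: mult.assoc)
  moreover have "u * ubc_of D (\<lambda>\<kappa>. pair A N \<kappa> * of_bool (\<kappa> x \<notin> \<kappa> ` (N - {D}))) t =
      u * ubc_of D (pair A N) t -
      u * (\<Sum>y\<in>N - {D}. ubc_of D (\<lambda>\<kappa>. pair A N \<kappa> * of_bool (\<kappa> x = \<kappa> y)) t)"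
    unfolding ubc_of_notin[OF assms(1,2,4) Diff_subset] by (rule right_diff_distrib)
  ultimately show ?thesis
    using ubc_of_glue_coincidences[OF assms IH] s
    unfolding u_def[symmetric] b_def[symmetric] by (simp add: algebra_simps)
qed

end

section \<open>Appending graphs\<close>

lemma ptype_mem_ubc_index:
  assumes "partition_on {1..d} \<pi>" "1 \<le> d"
  shows "ptype d \<pi> \<in> ubc_index d"
proof -
  define B where "B = block \<pi> d"
  have B: "B \<in> \<pi>" using block_mem[OF assms(1), of d] assms(2) by (simp add: B_def)
  have fin: "finite \<pi>" using finite_elements[OF _ assms(1)] by simp
  have "B \<subseteq> {1..d}" if "B \<in> \<pi>" for B using that partition_onD1[OF assms(1)] by blast
  then have finB: "finite B" if "B \<in> \<pi>" for B using that finite_subset by blast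
  have pos: "0 < card B" if "B \<in> \<pi>" for B
    using that finB partition_onD3[OF assms(1)] by (metis card_gt_0_iff)
  have "d = card (\<Union> \<pi>)" using partition_onD1[OF assms(1)] by (metis card_atLeastAtMost diff_Suc_1)
  also have "\<dots> = (\<Sum>C\<in>\<pi>. card C)"
    using partition_onD2[OF assms(1)] finB by (intro card_Union_disjoint) (auto simp: disjoint_def pairwise_def disjnt_def)
  also have "\<dots> = card B + (\<Sum>C\<in>\<pi> - {B}. card C)" by (rule sum.remove[OF fin B])
  also have "(\<Sum>C\<in>\<pi> - {B}. card C) = \<Sum>\<^sub># (image_mset card (mset_set (\<pi> - {B})))"
    by (simp add: sum_unfold_sum_mset)
  finally show ?thesis
    using pos B fin unfolding ptype_def ubc_index_def B_def[symmetric] by force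
qed

lemma ubc_of_nonindex:
  assumes "class_fun d f" "1 \<le> d" "t \<notin> ubc_index d"
  shows "ubc_of d f t = 0"
proof -
  obtain c where c: "\<And>\<kappa>. f \<kappa> = (\<Sum>\<pi> | partition_on {1..d} \<pi>. c \<pi> * cliques \<pi> \<kappa>)"
    using class_fun_expansion[OF assms(1)] by blast
  show ?thesis unfolding ubc_of_expansion[of f, OF c]
    by (rule sum.neutral) (use ptype_mem_ubc_index assms in auto)
qed

text \<open>Only the block of \<open>d\<close> interacts with the new vertices. The remaining blocks
  enter the outcome through their sizes alone, as the type-dependence required by
  \<open>ubc_nonneg_times\<close> demands.\<close>

lemma two_cliques_block:
  assumes "1 \<le> d" "1 \<le> m" and \<pi>: "partition_on {1..d} \<pi>"
  defines "B \<equiv> block \<pi> d"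
  shows "two_cliques (d + m) (\<pi> - {B}) (B \<union> {d + 1..d + m})"
    and "B \<inter> {d + 1..d + m} = {}" and "d \<in> B"
    and "card (B \<union> {d + 1..d + m}) = card B + m" and "1 \<le> card B"
    and "cliques \<pi> \<kappa> = cliques (\<pi> - {B}) \<kappa> * of_bool (inj_on \<kappa> B)"
proof -
  have B: "B \<in> \<pi>" "d \<in> B" using block_mem[OF \<pi>, of d] assms(1) by (simp_all add: B_def)
  have U: "\<Union> \<pi> = {1..d}" using partition_onD1[OF \<pi>] by simp
  have sub: "B \<subseteq> {1..d}" using B U by blast
  have fin: "finite B" using sub finite_subset by blast
  have dis: "C \<inter> B = {}" if "C \<in> \<pi> - {B}" for C
    using partition_onD2[OF \<pi>] B(1) that by (auto simp: disjoint_def)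
  have "\<Union> (\<pi> - {B}) = {1..d} - B"
  proof (intro equalityI subsetI)
    fix x assume "x \<in> \<Union> (\<pi> - {B})"
    then obtain C where "C \<in> \<pi> - {B}" "x \<in> C" by blast
    then show "x \<in> {1..d} - B" using dis[of C] U by blast
  next
    fix x assume x: "x \<in> {1..d} - B"
    then have "x \<in> \<Union> \<pi>" using U by simp
    then show "x \<in> \<Union> (\<pi> - {B})" using x by blast
  qed
  also have "\<dots> = {1..d + m} - (B \<union> {d + 1..d + m})" using sub by auto
  finally have "partition_on ({1..d + m} - (B \<union> {d + 1..d + m})) (\<pi> - {B})"
    using partition_onD2[OF \<pi>] partition_onD3[OF \<pi>]
    unfolding partition_on_def by (intro conjI pairwise_subset[OF _ Diff_subset]) auto
  then show "two_cliques (d + m) (\<pi> - {B}) (B \<union> {d + 1..d + m})"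
    using sub assms(2) by unfold_locales auto
  show dj: "B \<inter> {d + 1..d + m} = {}" using sub by auto
  show "d \<in> B" by fact
  show "card (B \<union> {d + 1..d + m}) = card B + m"
    using card_Un_disjoint[OF fin _ dj] by simp
  show "1 \<le> card B" using B(2) fin card_gt_0_iff[of B] by (simp add: Suc_le_eq) blast
  show "cliques \<pi> \<kappa> = cliques (\<pi> - {B}) \<kappa> * of_bool (inj_on \<kappa> B)"
    using B(1) by (auto simp: cliques_def)
qed

lemma glue_denominator_nonzero:
  "1 \<le> b \<Longrightarrow> 1 \<le> m \<Longrightarrow> (of_nat ((b + m - 1) * ((b + m - 2) choose (b - 1))) :: rat) \<noteq> 0"
  by (simp add: binomial_eq_0_iff)

text \<open>The block of the old last vertex becomes an ordinary block, and the new clique becomes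
  the distinguished one. With \<open>m = 1\<close> this adds an isolated vertex.\<close>

lemma ubc_nonneg_union_clique:
  assumes "ubc_nonneg d f" "1 \<le> d" "1 \<le> m"
  shows "ubc_nonneg (d + m) (\<lambda>\<kappa>. f \<kappa> * of_bool (inj_on \<kappa> {d + 1..d + m}))"
proof (rule ubc_nonneg_times[OF assms(1), where V = "\<lambda>p t. of_bool (two_type (fst p) (snd p + m) (snd p) = t)"])
  show "class_fun (d + m) (\<lambda>\<kappa>. of_bool (inj_on \<kappa> {d + 1..d + m}))"
    by (rule class_fun_inj_on) auto
  fix \<pi> t
  assume \<pi>: "partition_on {1..d} \<pi>"
  let ?p = "ptype d \<pi>" and ?B = "block \<pi> d" and ?N = "{d + 1..d + m}"
  note b = two_cliques_block[OF assms(2,3) \<pi>]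
  interpret two_cliques "d + m" "\<pi> - {?B}" "?B \<union> ?N" t by (rule b(1))
  have "(\<lambda>\<kappa>. cliques \<pi> \<kappa> * of_bool (inj_on \<kappa> ?N)) = pair ?B ?N"
    unfolding pair_def b(6) ..
  moreover have "d + m \<in> ?N" using assms(3) by simp
  ultimately show "ubc_of (d + m) (\<lambda>\<kappa>. cliques \<pi> \<kappa> * of_bool (inj_on \<kappa> ?N)) t =
      of_bool (two_type (fst (ptype d \<pi>)) (snd (ptype d \<pi>) + m) (snd (ptype d \<pi>)) = t)"
    using ubc_of_pair[OF refl b(2)] b(4) by (simp add: ptype_def)
qed simp_all

lemma ubc_nonneg_glue_clique:
  assumes "ubc_nonneg d f" "1 \<le> d" "1 \<le> m"
  shows "ubc_nonneg (d + m) (\<lambda>\<kappa>. f \<kappa> * of_bool (inj_on \<kappa> {d..d + m}))"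
proof (rule ubc_nonneg_times[OF assms(1), where V = "\<lambda>p t. glue_sum (fst p) (snd p + m) t (snd p) /
    of_nat ((snd p + m - 1) * ((snd p + m - 2) choose (snd p - 1)))"])
  show "class_fun (d + m) (\<lambda>\<kappa>. of_bool (inj_on \<kappa> {d..d + m}))"
    using assms(2) by (intro class_fun_inj_on) auto
  fix \<pi> t
  assume \<pi>: "partition_on {1..d} \<pi>"
  let ?p = "ptype d \<pi>" and ?B = "block \<pi> d" and ?N = "{d + 1..d + m}"
  note b = two_cliques_block[OF assms(2,3) \<pi>]
  interpret two_cliques "d + m" "\<pi> - {?B}" "?B \<union> ?N" t by (rule b(1))
  have "insert d ?N = {d..d + m}" by auto
  then have "(\<lambda>\<kappa>. cliques \<pi> \<kappa> * of_bool (inj_on \<kappa> {d..d + m})) = pair ?B (insert d ?N)"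
    unfolding pair_def b(6) by simp
  moreover have "d + m \<in> ?N" using assms(3) by simp
  ultimately show "ubc_of (d + m) (\<lambda>\<kappa>. cliques \<pi> \<kappa> * of_bool (inj_on \<kappa> {d..d + m})) t =
      glue_sum (fst ?p) (snd ?p + m) t (snd ?p) /
        of_nat ((snd ?p + m - 1) * ((snd ?p + m - 2) choose (snd ?p - 1)))"
    using ubc_of_glue[OF refl b(2) _ b(3)] b(4) glue_denominator_nonzero[OF b(5) assms(3)]
    by (simp add: ptype_def nonzero_eq_divide_eq mult.commute)
qed (simp_all add: divide_nonneg_nonneg glue_sum_nonneg)

text \<open>The two cliques overlap in all but their end vertices: together they are the complete
  graph on \<open>{d..d + m}\<close> without the edge from \<open>d\<close> to
  \<open>d + m\<close>.\<close>

lemma ubc_nonneg_glue_clique_minus: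
  assumes "ubc_nonneg d f" "1 \<le> d" "1 \<le> m"
  shows "ubc_nonneg (d + m)
    (\<lambda>\<kappa>. f \<kappa> * (of_bool (inj_on \<kappa> {d..d + m - 1}) * of_bool (inj_on \<kappa> {d + 1..d + m})))"
proof (rule ubc_nonneg_times[OF assms(1), where V = "\<lambda>p t.
    ((of_nat (snd p) + 1 - of_nat m) * two_term (fst p) (snd p + m) t (snd p) +
      glue_sum (fst p) (snd p + m) t (Suc (snd p))) /
    of_nat ((snd p + m - 1) * ((snd p + m - 2) choose (snd p - 1)))"])
  show "class_fun (d + m)
      (\<lambda>\<kappa>. of_bool (inj_on \<kappa> {d..d + m - 1}) * of_bool (inj_on \<kappa> {d + 1..d + m}))"
    using assms(2) by (intro class_fun_mult class_fun_inj_on) auto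
  fix \<pi> t
  assume \<pi>: "partition_on {1..d} \<pi>"
  let ?p = "ptype d \<pi>" and ?B = "block \<pi> d" and ?N = "{d + 1..d + m}"
  note b = two_cliques_block[OF assms(2,3) \<pi>]
  interpret two_cliques "d + m" "\<pi> - {?B}" "?B \<union> ?N" t by (rule b(1))
  show "0 \<le> ((of_nat (snd ?p) + 1 - of_nat m) * two_term (fst ?p) (snd ?p + m) t (snd ?p) +
      glue_sum (fst ?p) (snd ?p + m) t (Suc (snd ?p))) /
    of_nat ((snd ?p + m - 1) * ((snd ?p + m - 2) choose (snd ?p - 1)))"
    using glue_minus_sum_nonneg[of "card ?B" "card ?B + m" l t] b(5) assms(3)
    by (simp add: ptype_def)
  have S: "{d..d + m - 1} = insert d (?N - {d + m})" "d \<notin> ?N - {d + m}"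
    using assms(3) by auto
  \<comment> \<open>Once \<kappa> is injective on \<open>?N\<close>, the other clique only forbids
    the colour of \<open>d\<close> on \<open>?N - {d + m}\<close>.\<close>
  have "of_bool (inj_on \<kappa> {d..d + m - 1}) * of_bool (inj_on \<kappa> ?N) =
      of_bool (inj_on \<kappa> ?N) * (of_bool (\<kappa> d \<notin> \<kappa> ` (?N - {d + m})) :: rat)" for \<kappa> :: "nat \<Rightarrow> nat"
    unfolding S(1) inj_on_insert using S(2) inj_on_subset[of \<kappa> ?N "?N - {d + m}"] by auto
  then have "(\<lambda>\<kappa>. cliques \<pi> \<kappa> * (of_bool (inj_on \<kappa> {d..d + m - 1}) * of_bool (inj_on \<kappa> ?N))) =
      (\<lambda>\<kappa>. pair ?B ?N \<kappa> * of_bool (\<kappa> d \<notin> \<kappa> ` (?N - {d + m})))"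
    unfolding pair_def b(6) by (simp only: mult.assoc)
  moreover have "d + m \<in> ?N" using assms(3) by simp
  ultimately show "ubc_of (d + m)
        (\<lambda>\<kappa>. cliques \<pi> \<kappa> * (of_bool (inj_on \<kappa> {d..d + m - 1}) * of_bool (inj_on \<kappa> ?N))) t =
      ((of_nat (snd ?p) + 1 - of_nat m) * two_term (fst ?p) (snd ?p + m) t (snd ?p) +
      glue_sum (fst ?p) (snd ?p + m) t (Suc (snd ?p))) /
    of_nat ((snd ?p + m - 1) * ((snd ?p + m - 2) choose (snd ?p - 1)))"
    using ubc_of_glue_minus[OF refl b(2) _ b(3)] b(4) glue_denominator_nonzero[OF b(5) assms(3)]
    by (simp add: ptype_def nonzero_eq_divide_eq mult.commute)
qed simp_all

text \<open>By the symmetry of \<open>Q\<close> in \<open>S\<close>, all coincidences of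
  \<open>g\<close> with a vertex of \<open>S\<close> have the same coefficients, so those for
  \<open>T\<close> are affine in \<open>card T\<close>: the weights are 1 - |T|/|S| on
  \<open>Q\<close> and |T|/|S| on the version for \<open>S\<close>.\<close>

lemma ubc_nonneg_interpolate:
  assumes Q: "ubc_nonneg D Q" and QS: "ubc_nonneg D (\<lambda>\<kappa>. Q \<kappa> * of_bool (\<kappa> g \<notin> \<kappa> ` S))"
    and S: "S \<subseteq> {1..<D}" and g: "g \<in> {1..D} - S" and T: "T \<subseteq> S"
    and inv: "\<And>x y \<kappa>. x \<in> S \<Longrightarrow> y \<in> S \<Longrightarrow> Q (\<kappa> \<circ> transpose x y) = Q \<kappa>"
    and inj: "\<And>\<kappa>. Q \<kappa> \<noteq> 0 \<Longrightarrow> inj_on \<kappa> S"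
  shows "ubc_nonneg D (\<lambda>\<kappa>. Q \<kappa> * of_bool (\<kappa> g \<notin> \<kappa> ` T))"
proof (cases "S = {}")
  case True
  then show ?thesis using QS T by simp
next
  case False
  then obtain x where x: "x \<in> S" by blast
  have clQ: "class_fun D Q" using Q by (simp add: ubc_nonneg_def)
  have SD: "S \<subseteq> {1..D}" using S by auto
  let ?e = "\<lambda>y \<kappa>. Q \<kappa> * of_bool (\<kappa> g = \<kappa> y)"
  have cl: "class_fun D (?e y)" if "y \<in> S" for y
    using that SD g by (intro class_fun_mult class_fun_eq clQ) auto
  have eq: "ubc_of D (?e y) t = ubc_of D (?e x) t" if y: "y \<in> S" for y t
  proof -
    have e: "?e y \<kappa> = ?e x (\<kappa> \<circ> transpose x y)" for \<kappa>
    proof -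
      have "(\<kappa> \<circ> transpose x y) g = \<kappa> g" "(\<kappa> \<circ> transpose x y) x = \<kappa> y"
        using x y g by (auto simp: transpose_def)
      then show ?thesis using inv[OF x y] by (simp only:)
    qed
    have "x \<in> {1..<D}" "y \<in> {1..<D}" using x y S by blast+
    note ubc_of_transpose[OF cl[OF x] this, of t]
    moreover have "ubc_of D (?e y) t = ubc_of D (\<lambda>\<kappa>. ?e x (\<kappa> \<circ> transpose x y)) t"
      by (rule arg_cong[where f = "\<lambda>h. ubc_of D h t"], rule ext, rule e)
    ultimately show ?thesis by (rule trans[rotated])
  qed
  have lin: "ubc_of D (\<lambda>\<kappa>. Q \<kappa> * of_bool (\<kappa> g \<notin> \<kappa> ` T)) t =
      ubc_of D Q t - of_nat (card T) * ubc_of D (?e x) t" if T: "T \<subseteq> S" for T t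
  proof -
    have fin: "finite T" by (rule finite_subset[OF order_trans[OF T SD] finite_atLeastAtMost])
    have "Q \<kappa> * of_bool (\<kappa> g \<notin> \<kappa> ` T) = Q \<kappa> - (\<Sum>y\<in>T. ?e y \<kappa>)" for \<kappa>
    proof (cases "Q \<kappa> = 0")
      case False
      have "inj_on \<kappa> T" by (rule inj_on_subset[OF inj[OF False] T])
      then show ?thesis using of_bool_notin_image[OF fin, of \<kappa> g]
        by (simp add: sum_distrib_left right_diff_distrib)
    qed simp
    moreover have c: "class_fun D (?e y)" if "y \<in> T" for y
      by (rule cl[OF subsetD[OF T that]])
    have "(\<Sum>y\<in>T. ubc_of D (?e y) t) = (\<Sum>y\<in>T. ubc_of D (?e x) t)"
      by (rule sum.cong[OF refl eq]) (use T in blast)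
    ultimately show ?thesis
      using ubc_of_diff[OF clQ class_fun_sum[of T D, OF c], where t = t]
        ubc_of_sum[OF fin c, where t = t] by simp
  qed
  have fin: "finite S" by (rule finite_subset[OF SD finite_atLeastAtMost])
  show ?thesis unfolding ubc_nonneg_def
  proof (intro conjI allI)
    show "class_fun D (\<lambda>\<kappa>. Q \<kappa> * of_bool (\<kappa> g \<notin> \<kappa> ` T))"
      using g T SD by (intro class_fun_mult clQ class_fun_notin) auto
    fix t
    have "of_nat (card S) * ubc_of D (\<lambda>\<kappa>. Q \<kappa> * of_bool (\<kappa> g \<notin> \<kappa> ` T)) t =
        (of_nat (card S) - of_nat (card T)) * ubc_of D Q t +
        of_nat (card T) * ubc_of D (\<lambda>\<kappa>. Q \<kappa> * of_bool (\<kappa> g \<notin> \<kappa> ` S)) t"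
      unfolding lin[OF T] lin[OF order_refl] by (simp add: algebra_simps)
    also have "\<dots> \<ge> 0"
    proof -
      have "0 \<le> ubc_of D Q t" "0 \<le> ubc_of D (\<lambda>\<kappa>. Q \<kappa> * of_bool (\<kappa> g \<notin> \<kappa> ` S)) t"
        using Q QS unfolding ubc_nonneg_def by blast+
      then show ?thesis using card_mono[OF fin T] by simp
    qed
    finally have "0 \<le> of_nat (card S) * ubc_of D (\<lambda>\<kappa>. Q \<kappa> * of_bool (\<kappa> g \<notin> \<kappa> ` T)) t" .
    moreover have "0 < card S" using fin False by (simp add: card_gt_0_iff)
    ultimately show "0 \<le> ubc_of D (\<lambda>\<kappa>. Q \<kappa> * of_bool (\<kappa> g \<notin> \<kappa> ` T)) t"
      by (simp add: zero_le_mult_iff)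
  qed
qed

section \<open>Proper colourings of labelled graphs and of their concatenations\<close>

definition proper :: "nat set set \<Rightarrow> (nat \<Rightarrow> nat) \<Rightarrow> bool" where
  "proper E \<kappa> \<longleftrightarrow> (\<forall>i j. {i, j} \<in> E \<longrightarrow> \<kappa> i \<noteq> \<kappa> j)"

lemma labelled_graph_edge:
  assumes "labelled_graph G" "e \<in> snd G"
  obtains i j where "e = {i, j}" "i \<in> {1..fst G}" "j \<in> {1..fst G}" "i \<noteq> j"
  using assms unfolding labelled_graph_def by blast

lemma labelled_graph_edge_range:
  assumes "labelled_graph G" "{i, j} \<in> snd G"
  shows "i \<in> {1..fst G}" "j \<in> {1..fst G}"
  using labelled_graph_edge[OF assms] by (metis insertCI insertE singletonD)+

lemma class_fun_proper:
  assumes "labelled_graph G"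
  shows "class_fun (fst G) (\<lambda>\<kappa>. of_bool (proper (snd G) \<kappa>))"
  unfolding class_fun_def
proof (intro allI impI)
  fix \<kappa> \<kappa>' :: "nat \<Rightarrow> nat"
  assume a: "\<forall>i\<in>{1..fst G}. \<forall>j\<in>{1..fst G}. (\<kappa> i = \<kappa> j) = (\<kappa>' i = \<kappa>' j)"
  have "proper (snd G) \<kappa> \<longleftrightarrow> proper (snd G) \<kappa>'"
    unfolding proper_def
    by (intro all_cong1 imp_cong refl) (use a labelled_graph_edge_range[OF assms] in blast)
  then show "of_bool (proper (snd G) \<kappa>) = (of_bool (proper (snd G) \<kappa>') :: rat)" by simp
qed

lemma Y_graph_eq_wordify:
  assumes "labelled_graph G"
  shows "Y_graph G = wordify (fst G) (\<lambda>\<kappa>. of_bool (proper (snd G) \<kappa>))"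
proof -
  define d where "d = fst G"
  have "(\<exists>\<kappa>. w = map \<kappa> [1..<Suc d] \<and> (\<forall>i\<in>{1..d}. 0 < \<kappa> i) \<and> proper (snd G) \<kappa>) \<longleftrightarrow>
      length w = d \<and> (\<forall>i\<in>set w. 0 < i) \<and> proper (snd G) (\<lambda>i. w ! (i - 1))" (is "?L \<longleftrightarrow> ?R") for w
  proof
    assume ?L
    then obtain \<kappa> where \<kappa>: "w = map \<kappa> [1..<Suc d]" "\<forall>i\<in>{1..d}. 0 < \<kappa> i" "proper (snd G) \<kappa>" by blast
    have nth: "w ! (i - 1) = \<kappa> i" if "i \<in> {1..d}" for i
      using that \<kappa>(1) by (auto simp del: upt_Suc)
    have "length w = d" using \<kappa>(1) by (simp del: upt_Suc)
    moreover have "\<forall>i\<in>set w. 0 < i" using \<kappa>(1,2) by (auto simp del: upt_Suc)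
    moreover have "proper (snd G) (\<lambda>i. w ! (i - 1))"
      unfolding proper_def
    proof (intro allI impI)
      fix i j assume e: "{i, j} \<in> snd G"
      then show "w ! (i - 1) \<noteq> w ! (j - 1)"
        using \<kappa>(3) nth labelled_graph_edge_range[OF assms e] by (simp add: proper_def d_def)
    qed
    ultimately show ?R by simp
  next
    assume R: ?R
    have "w = map (\<lambda>i. w ! (i - 1)) [1..<Suc d]"
      by (rule nth_equalityI) (use R in \<open>simp_all del: upt_Suc\<close>)
    moreover have "\<forall>i\<in>{1..d}. 0 < w ! (i - 1)" using R by (auto intro!: nth_mem)
    ultimately show ?L using R by blast
  qed
  then show ?thesis
    unfolding Y_graph_def wordify_def monomial_sum_def d_def[symmetric] proper_def[symmetric]
    by (intro ext) auto
qed

lemma e_positive_iff: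
  assumes "labelled_graph G"
  shows "e_positive G \<longleftrightarrow> ubc_nonneg (fst G) (\<lambda>\<kappa>. of_bool (proper (snd G) \<kappa>))"
proof -
  have d: "1 \<le> fst G" using assms by (simp add: labelled_graph_def)
  have "y_graph G = ubc_of (fst G) (\<lambda>\<kappa>. of_bool (proper (snd G) \<kappa>))"
    unfolding y_graph_def ubc_of_def Y_graph_eq_wordify[OF assms] ..
  then have "e_positive G \<longleftrightarrow>
      (\<forall>t\<in>ubc_index (fst G). 0 \<le> ubc_of (fst G) (\<lambda>\<kappa>. of_bool (proper (snd G) \<kappa>)) t)"
    by (simp add: e_positive_def)
  also have "\<dots> \<longleftrightarrow> (\<forall>t. 0 \<le> ubc_of (fst G) (\<lambda>\<kappa>. of_bool (proper (snd G) \<kappa>)) t)"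
  proof (intro iffI allI ballI)
    fix t
    assume nonneg: "\<forall>t\<in>ubc_index (fst G). 0 \<le> ubc_of (fst G) (\<lambda>\<kappa>. of_bool (proper (snd G) \<kappa>)) t"
    show "0 \<le> ubc_of (fst G) (\<lambda>\<kappa>. of_bool (proper (snd G) \<kappa>)) t"
    proof (cases "t \<in> ubc_index (fst G)")
      case False
      then show ?thesis using ubc_of_nonindex[OF class_fun_proper[OF assms] d] by simp
    qed (use nonneg in blast)
  qed blast
  finally show ?thesis using class_fun_proper[OF assms] by (simp only: ubc_nonneg_def simp_thms)
qed

lemma proper_image:
  assumes "labelled_graph G"
  shows "proper ((`) r ` snd G) \<kappa> \<longleftrightarrow> proper (snd G) (\<kappa> \<circ> r)"
proof
  assume L: "proper ((`) r ` snd G) \<kappa>"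
  show "proper (snd G) (\<kappa> \<circ> r)"
    unfolding proper_def
  proof (intro allI impI)
    fix i j assume "{i, j} \<in> snd G"
    then have "r ` {i, j} \<in> (`) r ` snd G" by (rule imageI)
    then have "{r i, r j} \<in> (`) r ` snd G" by (simp only: image_insert image_empty)
    then show "(\<kappa> \<circ> r) i \<noteq> (\<kappa> \<circ> r) j" using L by (simp add: proper_def)
  qed
next
  assume R: "proper (snd G) (\<kappa> \<circ> r)"
  show "proper ((`) r ` snd G) \<kappa>"
    unfolding proper_def
  proof (intro allI impI)
    fix i j assume "{i, j} \<in> (`) r ` snd G"
    then obtain e where e: "e \<in> snd G" "{i, j} = r ` e" by blast
    obtain a b where ab: "e = {a, b}" using labelled_graph_edge[OF assms e(1)] by blast
    then have "\<kappa> (r a) \<noteq> \<kappa> (r b)" using R e(1) by (simp add: proper_def)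
    then show "\<kappa> i \<noteq> \<kappa> j" using e(2) ab by (auto simp: doubleton_eq_iff)
  qed
qed

lemma proper_concat_graph:
  assumes "labelled_graph H"
  shows "proper (snd (concat_graph G H)) \<kappa> \<longleftrightarrow>
    proper (snd G) \<kappa> \<and> proper (snd H) (\<kappa> \<circ> (\<lambda>i. fst G - 1 + i))"
  unfolding proper_image[OF assms, symmetric] by (auto simp: concat_graph_def proper_def)

lemma labelled_concat_graph:
  assumes "labelled_graph G" "labelled_graph H"
  shows "labelled_graph (concat_graph G H)"
  unfolding labelled_graph_def
proof (intro conjI subsetI)
  have d: "1 \<le> fst G" "1 \<le> fst H" using assms by (simp_all add: labelled_graph_def)
  then show "1 \<le> fst (concat_graph G H)" by (simp add: concat_graph_def)
  fix e assume "e \<in> snd (concat_graph G H)"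
  then consider "e \<in> snd G" | f where "f \<in> snd H" "e = (\<lambda>i. fst G - 1 + i) ` f"
    unfolding concat_graph_def by auto
  then show "e \<in> {{i, j} |i j. i \<in> {1..fst (concat_graph G H)} \<and>
      j \<in> {1..fst (concat_graph G H)} \<and> i \<noteq> j}"
  proof cases
    case 1
    obtain i j where ij: "e = {i, j}" "i \<in> {1..fst G}" "j \<in> {1..fst G}" "i \<noteq> j"
      using labelled_graph_edge[OF assms(1) 1] .
    have "i \<in> {1..fst (concat_graph G H)}" "j \<in> {1..fst (concat_graph G H)}"
      using ij(2,3) d by (auto simp: concat_graph_def)
    then show ?thesis using ij(1,4) by blast
  next
    case 2
    obtain i j where ij: "f = {i, j}" "i \<in> {1..fst H}" "j \<in> {1..fst H}" "i \<noteq> j"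
      using labelled_graph_edge[OF assms(2) 2(1)] .
    have "fst G - 1 + i \<in> {1..fst (concat_graph G H)}" "fst G - 1 + j \<in> {1..fst (concat_graph G H)}"
      "fst G - 1 + i \<noteq> fst G - 1 + j"
      using ij(2-4) d by (auto simp: concat_graph_def)
    moreover have "e = {fst G - 1 + i, fst G - 1 + j}" using 2(2) ij(1) by simp
    ultimately show ?thesis by blast
  qed
qed

lemma labelled_reverse_graph:
  assumes "labelled_graph G"
  shows "labelled_graph (reverse_graph G)"
  unfolding labelled_graph_def
proof (intro conjI subsetI)
  show "1 \<le> fst (reverse_graph G)" using assms by (simp add: labelled_graph_def reverse_graph_def)
  fix e assume "e \<in> snd (reverse_graph G)"
  then obtain f where f: "f \<in> snd G" "e = (\<lambda>i. fst G + 1 - i) ` f"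
    unfolding reverse_graph_def by auto
  obtain i j where ij: "f = {i, j}" "i \<in> {1..fst G}" "j \<in> {1..fst G}" "i \<noteq> j"
    using labelled_graph_edge[OF assms f(1)] .
  have "fst G + 1 - i \<in> {1..fst (reverse_graph G)}" "fst G + 1 - j \<in> {1..fst (reverse_graph G)}"
    "fst G + 1 - i \<noteq> fst G + 1 - j"
    using ij(2-4) by (auto simp: reverse_graph_def)
  moreover have "e = {fst G + 1 - i, fst G + 1 - j}" using f(2) ij(1) by simp
  ultimately show "e \<in> {{i, j} |i j. i \<in> {1..fst (reverse_graph G)} \<and>
      j \<in> {1..fst (reverse_graph G)} \<and> i \<noteq> j}" by blast
qed

text \<open>Asking for all class functions \<open>f\<close>, rather than only for those of graphs,
  allows the lemmas on appending cliques to be chained.\<close>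

lemma appendable_e_positiveI:
  assumes H: "labelled_graph H"
    and append: "\<And>d f. 1 \<le> d \<Longrightarrow> ubc_nonneg d f \<Longrightarrow>
      ubc_nonneg (d + fst H - 1) (\<lambda>\<kappa>. f \<kappa> * of_bool (proper (snd H) (\<kappa> \<circ> (\<lambda>i. d - 1 + i))))"
  shows "appendable_e_positive H"
  unfolding appendable_e_positive_def
proof (intro conjI H allI impI)
  fix G assume G: "labelled_graph G \<and> e_positive G"
  then have "1 \<le> fst G" by (simp add: labelled_graph_def)
  then have "ubc_nonneg (fst G + fst H - 1) (\<lambda>\<kappa>. of_bool (proper (snd G) \<kappa>) *
      of_bool (proper (snd H) (\<kappa> \<circ> (\<lambda>i. fst G - 1 + i))))"
    using append G e_positive_iff by blast
  then show "e_positive (concat_graph G H)"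
    using G H by (simp add: e_positive_iff labelled_concat_graph proper_concat_graph of_bool_conj)
      (simp add: concat_graph_def)
qed

section \<open>The snowy twin peaks graph as a clique with two further vertices\<close>

lemma proper_STP:
  assumes "3 \<le> n" "1 \<le> k" "k \<le> n - 2"
  shows "proper (snd (STP (n + 1) k)) \<phi> \<longleftrightarrow>
    inj_on \<phi> {2..n} \<and> \<phi> 1 \<notin> \<phi> ` {2..k + 1} \<and> \<phi> (n + 1) \<notin> \<phi> ` {3..n}" (is "?L \<longleftrightarrow> ?R")
proof
  assume L: ?L
  have ne: "\<phi> i \<noteq> \<phi> j" if "1 \<le> i" "i < j" "j \<le> n + 1" "j \<le> stp_seq (n + 1) k i" for i j
    using that L unfolding proper_def STP_def edge_unit_interval_graph by (simp add: min_def max_def)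
  show ?R
  proof (intro conjI)
    show "inj_on \<phi> {2..n}"
    proof (rule linorder_inj_onI)
      fix i j assume "i < j" "i \<in> {2..n}" "j \<in> {2..n}"
      then show "\<phi> i \<noteq> \<phi> j" using ne[of i j] by (auto simp: stp_seq_def)
    qed auto
    show "\<phi> 1 \<notin> \<phi> ` {2..k + 1}" 
    proof
      assume "\<phi> 1 \<in> \<phi> ` {2..k + 1}"
      then obtain j where "j \<in> {2..k + 1}" "\<phi> 1 = \<phi> j" by blast
      moreover from this have "j \<le> n + 1" using assms by auto
      ultimately show False using ne[of 1 j] by (simp add: stp_seq_def)
    qed
    show "\<phi> (n + 1) \<notin> \<phi> ` {3..n}"
    proof
      assume "\<phi> (n + 1) \<in> \<phi> ` {3..n}"
      then obtain i where "i \<in> {3..n}" "\<phi> i = \<phi> (n + 1)" by force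
      then show False using ne[of i "n + 1"] by (simp add: stp_seq_def)
    qed
  qed
next
  assume R: ?R
  have ne: "\<phi> i \<noteq> \<phi> j" if "1 \<le> i" "i < j" "j \<le> n + 1" "j \<le> stp_seq (n + 1) k i" for i j
  proof -
    have "i = 1 \<or> (2 \<le> i \<and> j \<le> n) \<or> (3 \<le> i \<and> j = n + 1)"
      using that by (cases "i = 1"; cases "i = 2") (auto simp: stp_seq_def)
    then consider "i = 1" | "2 \<le> i" "j \<le> n" | "3 \<le> i" "j = n + 1"
      by blast
    then show ?thesis
    proof cases
      case 1
      then have "j \<in> {2..k + 1}" using that by (simp add: stp_seq_def)
      then show ?thesis using R 1 by (metis imageI)
    next
      case 2
      then show ?thesis using R that by (auto dest: inj_onD)
    next
      case 3
      then have "i \<in> {3..n}" using that by simp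
      then show ?thesis using R 3 by (metis imageI)
    qed
  qed
  show ?L
    unfolding proper_def STP_def edge_unit_interval_graph
  proof (intro allI impI)
    fix i j assume "1 \<le> min i j \<and> i \<noteq> j \<and> max i j \<le> n + 1 \<and> max i j \<le> stp_seq (n + 1) k (min i j)"
    then show "\<phi> i \<noteq> \<phi> j" using ne[of i j] ne[of j i] by (cases "i < j") (auto simp: min_def max_def)
  qed
qed

lemma ubc_nonneg_cong:
  assumes "ubc_nonneg d f" "\<And>\<kappa>. f \<kappa> = g \<kappa>" "d = d'"
  shows "ubc_nonneg d' g"
proof -
  have "f = g" using assms(2) by blast
  then show ?thesis using assms(1,3) by simp
qed

lemma class_fun_agree:
  assumes "class_fun d f" "\<And>i. i \<in> {1..d} \<Longrightarrow> \<kappa> i = \<kappa>' i"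
  shows "f \<kappa> = f \<kappa>'"
proof -
  have "\<forall>i\<in>{1..d}. \<forall>j\<in>{1..d}. \<kappa> i = \<kappa> j \<longleftrightarrow> \<kappa>' i = \<kappa>' j"
    by (intro ballI) (simp only: assms(2))
  then show ?thesis using assms(1) unfolding class_fun_def by blast
qed

lemma class_fun_comp_transpose:
  assumes "class_fun d f" "d < x" "d < y"
  shows "f (\<kappa> \<circ> transpose x y) = f \<kappa>"
  by (rule class_fun_agree[OF assms(1)]) (use assms in \<open>auto simp: transpose_def\<close>)

lemma image_comp_transpose:
  assumes "x \<in> B \<longleftrightarrow> y \<in> B"
  shows "(\<kappa> \<circ> transpose x y) ` B = \<kappa> ` B"
  using transpose_image_eq[of x B y] assms by (metis image_comp)

lemma comp_transpose_other:
  "z \<noteq> x \<Longrightarrow> z \<noteq> y \<Longrightarrow> (\<kappa> \<circ> transpose x y) z = \<kappa> z"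
  by (simp add: transpose_def)

text \<open>
  Both appended graphs consist of a clique \<open>C\<close> and two further vertices \<open>g\<close> and \<open>z\<close>. The number of
  neighbours of either vertex in \<open>C\<close> enters affinely, so each may be moved to an extreme value, where
  the graph is built from complete graphs and complete graphs minus an edge.
\<close>

lemma ubc_nonneg_append_STP:
  assumes n: "3 \<le> n" "1 \<le> k" "k \<le> n - 2" and d: "1 \<le> d" and f: "ubc_nonneg d f"
  shows "ubc_nonneg (d + n) (\<lambda>\<kappa>. f \<kappa> * of_bool (inj_on \<kappa> {d + 1..d + n - 1} \<and>
    \<kappa> d \<notin> \<kappa> ` {d + 1..d + k} \<and> \<kappa> (d + n) \<notin> \<kappa> ` {d + 2..d + n - 1}))"
proof -
  define C where "C = {d + 1..d + n - 1}"
  define R where "R = {d + 2..d + n - 1}"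
  have CR: "C = insert (d + 1) R" "d + 1 \<notin> R" "d \<notin> C" "d + n \<notin> C" "R \<subseteq> C"
    using n by (auto simp: C_def R_def)
  have cf: "class_fun d f" using f by (simp add: ubc_nonneg_def)
  have I: "{d..d + n - 1} = insert d C" "{d + 1..d + n} = insert (d + n) C"
    "{d + 2..d + n} = insert (d + n) R" "{d..d + 1} = {d, d + 1}"
    using n by (auto simp: C_def R_def)
  have C0: "C \<subseteq> {1..<d + n}" using d by (auto simp: C_def)
  have gd: "x \<in> C \<Longrightarrow> d < x" for x by (simp add: C_def)
  \<comment> \<open>Here \<open>d + n\<close> varies. Without neighbours in \<open>C\<close> it is
    an isolated vertex beside the clique on \<open>insert d C\<close>; joined to all of
    \<open>C\<close> it gives the complete graph minus the edge from \<open>d\<close> to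
    \<open>d + n\<close>.\<close>
  have glued: "ubc_nonneg (d + n) (\<lambda>\<kappa>. f \<kappa> * of_bool (inj_on \<kappa> (insert d C)) *
      of_bool (\<kappa> (d + n) \<notin> \<kappa> ` R))"
  proof (rule ubc_nonneg_interpolate[where S = C])
    have "ubc_nonneg (d + (n - 1)) (\<lambda>\<kappa>. f \<kappa> * of_bool (inj_on \<kappa> {d..d + (n - 1)}))"
      by (rule ubc_nonneg_glue_clique[OF f d]) (use n in simp)
    from ubc_nonneg_union_clique[OF this, of 1]
    show "ubc_nonneg (d + n) (\<lambda>\<kappa>. f \<kappa> * of_bool (inj_on \<kappa> (insert d C)))"
      by (rule ubc_nonneg_cong) (use n d in \<open>auto simp: I(1)[symmetric]\<close>)
    have "ubc_nonneg (d + n)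
        (\<lambda>\<kappa>. f \<kappa> * (of_bool (inj_on \<kappa> {d..d + n - 1}) * of_bool (inj_on \<kappa> {d + 1..d + n})))"
      by (rule ubc_nonneg_glue_clique_minus[OF f d]) (use n in simp)
    then show "ubc_nonneg (d + n) (\<lambda>\<kappa>. f \<kappa> * of_bool (inj_on \<kappa> (insert d C)) *
        of_bool (\<kappa> (d + n) \<notin> \<kappa> ` C))"
    proof (rule ubc_nonneg_cong)
      fix \<kappa> :: "nat \<Rightarrow> nat"
      have "inj_on \<kappa> (insert d C) \<and> inj_on \<kappa> (insert (d + n) C) \<longleftrightarrow>
          inj_on \<kappa> (insert d C) \<and> \<kappa> (d + n) \<notin> \<kappa> ` C"
        using CR(4) by (simp only: inj_on_insert Diff_insert0) blast
      then show "f \<kappa> * (of_bool (inj_on \<kappa> {d..d + n - 1}) * of_bool (inj_on \<kappa> {d + 1..d + n})) =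
          f \<kappa> * of_bool (inj_on \<kappa> (insert d C)) * of_bool (\<kappa> (d + n) \<notin> \<kappa> ` C)"
        by (simp only: I mult.assoc of_bool_conj[symmetric])
    qed (rule refl)
    show "C \<subseteq> {1..<d + n}" "d + n \<in> {1..d + n} - C" "R \<subseteq> C" using C0 CR d by auto
    show "f (\<kappa> \<circ> transpose x y) * of_bool (inj_on (\<kappa> \<circ> transpose x y) (insert d C)) =
        f \<kappa> * of_bool (inj_on \<kappa> (insert d C))" if "x \<in> C" "y \<in> C" for x y \<kappa>
    proof -
      have "inj_on (\<kappa> \<circ> transpose x y) (insert d C) \<longleftrightarrow> inj_on \<kappa> (insert d C)"
        by (rule inj_on_comp_transpose) (use that in simp)
      then show ?thesis using class_fun_comp_transpose[OF cf gd[OF that(1)] gd[OF that(2)]] by simp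
    qed
    show "inj_on \<kappa> C" if "f \<kappa> * of_bool (inj_on \<kappa> (insert d C)) \<noteq> 0" for \<kappa>
      using that by (auto split: if_splits simp: of_bool_def)
  qed
  \<comment> \<open>Now \<open>d\<close> varies. As \<open>d + 1\<close> is not joined to
    \<open>d + n\<close>, it is not interchangeable with the vertices in \<open>R\<close>; its edge
    to \<open>d\<close>, present because \<open>1 \<le> k\<close>, is kept fixed.\<close>
  have "ubc_nonneg (d + n) (\<lambda>\<kappa>. f \<kappa> * of_bool (inj_on \<kappa> C \<and> \<kappa> d \<noteq> \<kappa> (d + 1) \<and>
      \<kappa> (d + n) \<notin> \<kappa> ` R) * of_bool (\<kappa> d \<notin> \<kappa> ` {d + 2..d + k}))"
  proof (rule ubc_nonneg_interpolate[where S = R])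
    \<comment> \<open>With no neighbour of \<open>d\<close> in \<open>R\<close>, the graph is an
      edge from \<open>d\<close> to \<open>d + 1\<close>, followed at \<open>d + 1\<close> by a
      complete graph minus the edge from \<open>d + 1\<close> to \<open>d + n\<close>. The other
      extreme is \<open>glued\<close>.\<close>
    have "ubc_nonneg (d + 1) (\<lambda>\<kappa>. f \<kappa> * of_bool (inj_on \<kappa> {d..d + 1}))"
      by (rule ubc_nonneg_glue_clique[OF f d]) simp
    from ubc_nonneg_glue_clique_minus[OF this, of "n - 1"]
    have "ubc_nonneg (d + 1 + (n - 1)) (\<lambda>\<kappa>. f \<kappa> * of_bool (inj_on \<kappa> {d..d + 1}) *
        (of_bool (inj_on \<kappa> {d + 1..d + 1 + (n - 1) - 1}) *
         of_bool (inj_on \<kappa> {d + 1 + 1..d + 1 + (n - 1)})))"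
      using n by simp
    then show "ubc_nonneg (d + n) (\<lambda>\<kappa>. f \<kappa> * of_bool (inj_on \<kappa> C \<and> \<kappa> d \<noteq> \<kappa> (d + 1) \<and>
        \<kappa> (d + n) \<notin> \<kappa> ` R))"
    proof (rule ubc_nonneg_cong)
      fix \<kappa> :: "nat \<Rightarrow> nat"
      have J: "{d + 1..d + 1 + (n - 1) - 1} = C" "{d + 1 + 1..d + 1 + (n - 1)} = insert (d + n) R"
        using n by (auto simp: C_def R_def)
      have "inj_on \<kappa> {d, d + 1} \<and> inj_on \<kappa> C \<and> inj_on \<kappa> (insert (d + n) R) \<longleftrightarrow>
          inj_on \<kappa> C \<and> \<kappa> d \<noteq> \<kappa> (d + 1) \<and> \<kappa> (d + n) \<notin> \<kappa> ` R"
        using CR inj_on_subset[of \<kappa> C R] by auto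
      then show "f \<kappa> * of_bool (inj_on \<kappa> {d..d + 1}) *
          (of_bool (inj_on \<kappa> {d + 1..d + 1 + (n - 1) - 1}) *
           of_bool (inj_on \<kappa> {d + 1 + 1..d + 1 + (n - 1)})) =
          f \<kappa> * of_bool (inj_on \<kappa> C \<and> \<kappa> d \<noteq> \<kappa> (d + 1) \<and> \<kappa> (d + n) \<notin> \<kappa> ` R)"
        by (simp only: I(4) J mult.assoc of_bool_conj[symmetric])
    qed (use n in simp)
    from glued show "ubc_nonneg (d + n) (\<lambda>\<kappa>. f \<kappa> * of_bool (inj_on \<kappa> C \<and> \<kappa> d \<noteq> \<kappa> (d + 1) \<and>
        \<kappa> (d + n) \<notin> \<kappa> ` R) * of_bool (\<kappa> d \<notin> \<kappa> ` R))"
    proof (rule ubc_nonneg_cong)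
      fix \<kappa> :: "nat \<Rightarrow> nat"
      have "inj_on \<kappa> (insert d C) \<and> \<kappa> (d + n) \<notin> \<kappa> ` R \<longleftrightarrow>
          (inj_on \<kappa> C \<and> \<kappa> d \<noteq> \<kappa> (d + 1) \<and> \<kappa> (d + n) \<notin> \<kappa> ` R) \<and> \<kappa> d \<notin> \<kappa> ` R"
        using CR(1,3) by auto
      then show "f \<kappa> * of_bool (inj_on \<kappa> (insert d C)) * of_bool (\<kappa> (d + n) \<notin> \<kappa> ` R) =
          f \<kappa> * of_bool (inj_on \<kappa> C \<and> \<kappa> d \<noteq> \<kappa> (d + 1) \<and> \<kappa> (d + n) \<notin> \<kappa> ` R) *
          of_bool (\<kappa> d \<notin> \<kappa> ` R)"
        by (simp only: mult.assoc of_bool_conj[symmetric])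
    qed (rule refl)
    show "R \<subseteq> {1..<d + n}" "d \<in> {1..d + n} - R" "{d + 2..d + k} \<subseteq> R"
      using C0 CR d n by (auto simp: R_def)
    show "f (\<kappa> \<circ> transpose x y) * of_bool (inj_on (\<kappa> \<circ> transpose x y) C \<and>
        (\<kappa> \<circ> transpose x y) d \<noteq> (\<kappa> \<circ> transpose x y) (d + 1) \<and>
        (\<kappa> \<circ> transpose x y) (d + n) \<notin> (\<kappa> \<circ> transpose x y) ` R) =
        f \<kappa> * of_bool (inj_on \<kappa> C \<and> \<kappa> d \<noteq> \<kappa> (d + 1) \<and> \<kappa> (d + n) \<notin> \<kappa> ` R)"
      if xy: "x \<in> R" "y \<in> R" for x y \<kappa>
    proof -
      have xyC: "x \<in> C" "y \<in> C" using xy CR(5) by blast+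
      have "f (\<kappa> \<circ> transpose x y) = f \<kappa>"
        by (rule class_fun_comp_transpose[OF cf gd[OF xyC(1)] gd[OF xyC(2)]])
      moreover have "inj_on (\<kappa> \<circ> transpose x y) C \<longleftrightarrow> inj_on \<kappa> C"
        by (rule inj_on_comp_transpose) (use xyC in simp)
      moreover have "(\<kappa> \<circ> transpose x y) ` R = \<kappa> ` R"
        by (rule image_comp_transpose) (use xy in simp)
      moreover have "(\<kappa> \<circ> transpose x y) d = \<kappa> d" "(\<kappa> \<circ> transpose x y) (d + 1) = \<kappa> (d + 1)"
        "(\<kappa> \<circ> transpose x y) (d + n) = \<kappa> (d + n)"
        by (rule comp_transpose_other; use xy in \<open>auto simp: R_def\<close>)+
      ultimately show ?thesis by (simp only:)
    qed
    show "inj_on \<kappa> R" if "f \<kappa> * of_bool (inj_on \<kappa> C \<and> \<kappa> d \<noteq> \<kappa> (d + 1) \<and>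
        \<kappa> (d + n) \<notin> \<kappa> ` R) \<noteq> 0" for \<kappa>
      using that CR(5) inj_on_subset[of \<kappa> C R] by (auto simp: of_bool_def split: if_splits)
  qed
  then show ?thesis
    unfolding C_def[symmetric] R_def[symmetric]
  proof (rule ubc_nonneg_cong)
    fix \<kappa> :: "nat \<Rightarrow> nat"
    have "{d + 1..d + k} = insert (d + 1) {d + 2..d + k}" using n by auto
    then have "(inj_on \<kappa> C \<and> \<kappa> d \<noteq> \<kappa> (d + 1) \<and> \<kappa> (d + n) \<notin> \<kappa> ` R) \<and> \<kappa> d \<notin> \<kappa> ` {d + 2..d + k} \<longleftrightarrow>
        inj_on \<kappa> C \<and> \<kappa> d \<notin> \<kappa> ` {d + 1..d + k} \<and> \<kappa> (d + n) \<notin> \<kappa> ` R"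
      by auto
    then show "f \<kappa> * of_bool (inj_on \<kappa> C \<and> \<kappa> d \<noteq> \<kappa> (d + 1) \<and> \<kappa> (d + n) \<notin> \<kappa> ` R) *
        of_bool (\<kappa> d \<notin> \<kappa> ` {d + 2..d + k}) =
        f \<kappa> * of_bool (inj_on \<kappa> C \<and> \<kappa> d \<notin> \<kappa> ` {d + 1..d + k} \<and> \<kappa> (d + n) \<notin> \<kappa> ` R)"
      by (simp only: mult.assoc of_bool_conj[symmetric])
  qed (rule refl)
qed

text \<open>Reversal is not a symmetry of the problem, since gluing happens at the first vertex
  while types single out the last. The interpolation is the same with \<open>d\<close> and
  \<open>d + n\<close> exchanged, but its extreme graphs are built in the opposite order.\<close>

lemma ubc_nonneg_append_reverse_STP:
  assumes n: "3 \<le> n" "1 \<le> k" "k \<le> n - 2" and d: "1 \<le> d" and f: "ubc_nonneg d f"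
  shows "ubc_nonneg (d + n) (\<lambda>\<kappa>. f \<kappa> * of_bool (inj_on \<kappa> {d + 1..d + n - 1} \<and>
    \<kappa> (d + n) \<notin> \<kappa> ` {d + n - k..d + n - 1} \<and> \<kappa> d \<notin> \<kappa> ` {d + 1..d + n - 2}))"
proof -
  define w where "w = d + n - 1"
  define C where "C = {d + 1..d + n - 1}"
  define R where "R = {d + 1..d + n - 2}"
  have CR: "C = insert w R" "w \<notin> R" "d \<notin> C" "d + n \<notin> C" "R \<subseteq> C"
    using n by (auto simp: C_def R_def w_def)
  have cf: "class_fun d f" using f by (simp add: ubc_nonneg_def)
  have I: "{d..d + n - 1} = insert d C" "{d + 1..d + n} = insert (d + n) C"
    using n by (auto simp: C_def)
  have C0: "C \<subseteq> {1..<d + n}" using d by (auto simp: C_def)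
  have gd: "x \<in> C \<Longrightarrow> d < x" for x by (simp add: C_def)
  \<comment> \<open>Here \<open>d\<close> varies: without neighbours in \<open>C\<close> it leaves a
    disjoint clique on \<open>{d + 1..d + n}\<close>, with all of \<open>C\<close> the complete
    graph minus an edge.\<close>
  have glued: "ubc_nonneg (d + n) (\<lambda>\<kappa>. f \<kappa> * of_bool (inj_on \<kappa> (insert (d + n) C)) *
      of_bool (\<kappa> d \<notin> \<kappa> ` R))"
  proof (rule ubc_nonneg_interpolate[where S = C])
    have "ubc_nonneg (d + n) (\<lambda>\<kappa>. f \<kappa> * of_bool (inj_on \<kappa> {d + 1..d + n}))"
      by (rule ubc_nonneg_union_clique[OF f d]) (use n in simp)
    then show "ubc_nonneg (d + n) (\<lambda>\<kappa>. f \<kappa> * of_bool (inj_on \<kappa> (insert (d + n) C)))"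
      unfolding I .
    have "ubc_nonneg (d + n)
        (\<lambda>\<kappa>. f \<kappa> * (of_bool (inj_on \<kappa> {d..d + n - 1}) * of_bool (inj_on \<kappa> {d + 1..d + n})))"
      by (rule ubc_nonneg_glue_clique_minus[OF f d]) (use n in simp)
    then show "ubc_nonneg (d + n) (\<lambda>\<kappa>. f \<kappa> * of_bool (inj_on \<kappa> (insert (d + n) C)) *
        of_bool (\<kappa> d \<notin> \<kappa> ` C))"
    proof (rule ubc_nonneg_cong)
      fix \<kappa> :: "nat \<Rightarrow> nat"
      have "inj_on \<kappa> (insert d C) \<and> inj_on \<kappa> (insert (d + n) C) \<longleftrightarrow>
          inj_on \<kappa> (insert (d + n) C) \<and> \<kappa> d \<notin> \<kappa> ` C"
        using CR(3) by (simp only: inj_on_insert Diff_insert0) blast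
      then show "f \<kappa> * (of_bool (inj_on \<kappa> {d..d + n - 1}) * of_bool (inj_on \<kappa> {d + 1..d + n})) =
          f \<kappa> * of_bool (inj_on \<kappa> (insert (d + n) C)) * of_bool (\<kappa> d \<notin> \<kappa> ` C)"
        by (simp only: I mult.assoc of_bool_conj[symmetric])
    qed (rule refl)
    show "C \<subseteq> {1..<d + n}" "d \<in> {1..d + n} - C" "R \<subseteq> C" using C0 CR d by auto
    show "f (\<kappa> \<circ> transpose x y) * of_bool (inj_on (\<kappa> \<circ> transpose x y) (insert (d + n) C)) =
        f \<kappa> * of_bool (inj_on \<kappa> (insert (d + n) C))" if "x \<in> C" "y \<in> C" for x y \<kappa>
    proof -
      have "inj_on (\<kappa> \<circ> transpose x y) (insert (d + n) C) \<longleftrightarrow> inj_on \<kappa> (insert (d + n) C)"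
        by (rule inj_on_comp_transpose) (use that in simp)
      then show ?thesis using class_fun_comp_transpose[OF cf gd[OF that(1)] gd[OF that(2)]] by simp
    qed
    show "inj_on \<kappa> C" if "f \<kappa> * of_bool (inj_on \<kappa> (insert (d + n) C)) \<noteq> 0" for \<kappa>
      using that by (auto split: if_splits simp: of_bool_def)
  qed
  have "ubc_nonneg (d + n) (\<lambda>\<kappa>. f \<kappa> * of_bool (inj_on \<kappa> C \<and> \<kappa> (d + n) \<noteq> \<kappa> w \<and>
      \<kappa> d \<notin> \<kappa> ` R) * of_bool (\<kappa> (d + n) \<notin> \<kappa> ` {d + n - k..d + n - 2}))"
  proof (rule ubc_nonneg_interpolate[where S = R])
    \<comment> \<open>With no neighbour of \<open>d + n\<close> in \<open>R\<close>, the graph is a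
      complete graph on \<open>{d..w}\<close> minus the edge from \<open>d\<close> to
      \<open>w\<close>, followed by the edge from \<open>w\<close> to \<open>d + n\<close>.\<close>
    have "ubc_nonneg (d + (n - 1)) (\<lambda>\<kappa>. f \<kappa> * (of_bool (inj_on \<kappa> {d..d + (n - 1) - 1}) *
        of_bool (inj_on \<kappa> {d + 1..d + (n - 1)})))"
      by (rule ubc_nonneg_glue_clique_minus[OF f d]) (use n in simp)
    from ubc_nonneg_glue_clique[OF this, of 1]
    have "ubc_nonneg (d + (n - 1) + 1) (\<lambda>\<kappa>. f \<kappa> * (of_bool (inj_on \<kappa> {d..d + (n - 1) - 1}) *
        of_bool (inj_on \<kappa> {d + 1..d + (n - 1)})) *
        of_bool (inj_on \<kappa> {d + (n - 1)..d + (n - 1) + 1}))"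
      using d by simp
    then show "ubc_nonneg (d + n) (\<lambda>\<kappa>. f \<kappa> * of_bool (inj_on \<kappa> C \<and> \<kappa> (d + n) \<noteq> \<kappa> w \<and>
        \<kappa> d \<notin> \<kappa> ` R))"
    proof (rule ubc_nonneg_cong)
      fix \<kappa> :: "nat \<Rightarrow> nat"
      have J: "{d..d + (n - 1) - 1} = insert d R" "{d + 1..d + (n - 1)} = C"
        "{d + (n - 1)..d + (n - 1) + 1} = {d + n, w}" and dn: "d + n \<noteq> w"
        using n by (auto simp: C_def R_def w_def)
      have "inj_on \<kappa> (insert d R) \<and> inj_on \<kappa> C \<and> inj_on \<kappa> {d + n, w} \<longleftrightarrow>
          inj_on \<kappa> C \<and> \<kappa> (d + n) \<noteq> \<kappa> w \<and> \<kappa> d \<notin> \<kappa> ` R"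
        using CR dn inj_on_subset[of \<kappa> C R] by auto
      then show "f \<kappa> * (of_bool (inj_on \<kappa> {d..d + (n - 1) - 1}) *
          of_bool (inj_on \<kappa> {d + 1..d + (n - 1)})) *
          of_bool (inj_on \<kappa> {d + (n - 1)..d + (n - 1) + 1}) =
          f \<kappa> * of_bool (inj_on \<kappa> C \<and> \<kappa> (d + n) \<noteq> \<kappa> w \<and> \<kappa> d \<notin> \<kappa> ` R)"
        by (simp only: J mult.assoc of_bool_conj[symmetric] conj_assoc)
    qed (use n in simp)
    from glued show "ubc_nonneg (d + n) (\<lambda>\<kappa>. f \<kappa> * of_bool (inj_on \<kappa> C \<and> \<kappa> (d + n) \<noteq> \<kappa> w \<and>
        \<kappa> d \<notin> \<kappa> ` R) * of_bool (\<kappa> (d + n) \<notin> \<kappa> ` R))"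
    proof (rule ubc_nonneg_cong)
      fix \<kappa> :: "nat \<Rightarrow> nat"
      have "inj_on \<kappa> (insert (d + n) C) \<and> \<kappa> d \<notin> \<kappa> ` R \<longleftrightarrow>
          (inj_on \<kappa> C \<and> \<kappa> (d + n) \<noteq> \<kappa> w \<and> \<kappa> d \<notin> \<kappa> ` R) \<and> \<kappa> (d + n) \<notin> \<kappa> ` R"
        using CR(1,4) by auto
      then show "f \<kappa> * of_bool (inj_on \<kappa> (insert (d + n) C)) * of_bool (\<kappa> d \<notin> \<kappa> ` R) =
          f \<kappa> * of_bool (inj_on \<kappa> C \<and> \<kappa> (d + n) \<noteq> \<kappa> w \<and> \<kappa> d \<notin> \<kappa> ` R) *
          of_bool (\<kappa> (d + n) \<notin> \<kappa> ` R)"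
        by (simp only: mult.assoc of_bool_conj[symmetric])
    qed (rule refl)
    show "R \<subseteq> {1..<d + n}" "d + n \<in> {1..d + n} - R" "{d + n - k..d + n - 2} \<subseteq> R"
      using C0 CR d n by (auto simp: R_def)
    show "f (\<kappa> \<circ> transpose x y) * of_bool (inj_on (\<kappa> \<circ> transpose x y) C \<and>
        (\<kappa> \<circ> transpose x y) (d + n) \<noteq> (\<kappa> \<circ> transpose x y) w \<and>
        (\<kappa> \<circ> transpose x y) d \<notin> (\<kappa> \<circ> transpose x y) ` R) =
        f \<kappa> * of_bool (inj_on \<kappa> C \<and> \<kappa> (d + n) \<noteq> \<kappa> w \<and> \<kappa> d \<notin> \<kappa> ` R)"
      if xy: "x \<in> R" "y \<in> R" for x y \<kappa>
    proof -
      have xyC: "x \<in> C" "y \<in> C" using xy CR(5) by blast+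
      have "f (\<kappa> \<circ> transpose x y) = f \<kappa>"
        by (rule class_fun_comp_transpose[OF cf gd[OF xyC(1)] gd[OF xyC(2)]])
      moreover have "inj_on (\<kappa> \<circ> transpose x y) C \<longleftrightarrow> inj_on \<kappa> C"
        by (rule inj_on_comp_transpose) (use xyC in simp)
      moreover have "(\<kappa> \<circ> transpose x y) ` R = \<kappa> ` R"
        by (rule image_comp_transpose) (use xy in simp)
      moreover have "(\<kappa> \<circ> transpose x y) d = \<kappa> d" "(\<kappa> \<circ> transpose x y) w = \<kappa> w"
        "(\<kappa> \<circ> transpose x y) (d + n) = \<kappa> (d + n)"
        by (rule comp_transpose_other; use xy n in \<open>auto simp: R_def w_def\<close>)+
      ultimately show ?thesis by (simp only:)
    qed
    show "inj_on \<kappa> R" if "f \<kappa> * of_bool (inj_on \<kappa> C \<and> \<kappa> (d + n) \<noteq> \<kappa> w \<and>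
        \<kappa> d \<notin> \<kappa> ` R) \<noteq> 0" for \<kappa>
      using that CR(5) inj_on_subset[of \<kappa> C R] by (auto simp: of_bool_def split: if_splits)
  qed
  then show ?thesis
    unfolding C_def[symmetric] R_def[symmetric]
  proof (rule ubc_nonneg_cong)
    fix \<kappa> :: "nat \<Rightarrow> nat"
    have "{d + n - k..d + n - 1} = insert w {d + n - k..d + n - 2}" using n by (auto simp: w_def)
    then have "(inj_on \<kappa> C \<and> \<kappa> (d + n) \<noteq> \<kappa> w \<and> \<kappa> d \<notin> \<kappa> ` R) \<and>
        \<kappa> (d + n) \<notin> \<kappa> ` {d + n - k..d + n - 2} \<longleftrightarrow>
        inj_on \<kappa> C \<and> \<kappa> (d + n) \<notin> \<kappa> ` {d + n - k..d + n - 1} \<and> \<kappa> d \<notin> \<kappa> ` R"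
      by auto
    then show "f \<kappa> * of_bool (inj_on \<kappa> C \<and> \<kappa> (d + n) \<noteq> \<kappa> w \<and> \<kappa> d \<notin> \<kappa> ` R) *
        of_bool (\<kappa> (d + n) \<notin> \<kappa> ` {d + n - k..d + n - 2}) =
        f \<kappa> * of_bool (inj_on \<kappa> C \<and> \<kappa> (d + n) \<notin> \<kappa> ` {d + n - k..d + n - 1} \<and> \<kappa> d \<notin> \<kappa> ` R)"
      by (simp only: mult.assoc of_bool_conj[symmetric])
  qed (rule refl)
qed

lemma image_diff_atLeastAtMost:
  fixes a b e :: nat
  assumes "a \<le> b" "b \<le> e"
  shows "(\<lambda>i. e - i) ` {a..b} = {e - b..e - a}"
proof (intro equalityI subsetI)
  fix x assume x: "x \<in> {e - b..e - a}"
  then show "x \<in> (\<lambda>i. e - i) ` {a..b}"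
    using assms by (intro image_eqI[of _ _ "e - x"]) auto
qed (use assms in auto)

theorem proposition5p6:
  fixes n k :: nat
  assumes "3 \<le> n" and "1 \<le> k" and "k \<le> n - 2"
  shows "appendable_e_positive (STP (n + 1) k) \<and>
         appendable_e_positive (reverse_graph (STP (n + 1) k))"
proof
  have lg: "labelled_graph (STP (n + 1) k)"
    using STP_correct(1)[OF assms] by (simp add: labelled_unit_interval_graph_def)
  have size: "fst (STP (n + 1) k) = n + 1" by (simp add: STP_def unit_interval_graph_def)
  show "appendable_e_positive (STP (n + 1) k)"
  proof (rule appendable_e_positiveI[OF lg])
    fix d f
    assume d: "1 \<le> d" and f: "ubc_nonneg d f"
    show "ubc_nonneg (d + fst (STP (n + 1) k) - 1)
        (\<lambda>\<kappa>. f \<kappa> * of_bool (proper (snd (STP (n + 1) k)) (\<kappa> \<circ> (\<lambda>i. d - 1 + i))))"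
    proof (rule ubc_nonneg_cong[OF ubc_nonneg_append_STP[OF assms d f]])
      fix \<kappa> :: "nat \<Rightarrow> nat"
      let ?r = "\<lambda>i. d - 1 + i"
      have im: "?r ` {2..n} = {d + 1..d + n - 1}" "?r ` {2..k + 1} = {d + 1..d + k}"
        "?r ` {3..n} = {d + 2..d + n - 1}" "?r 1 = d" "?r (n + 1) = d + n"
        unfolding image_add_atLeastAtMost using d by auto
      have inj: "inj_on (\<kappa> \<circ> ?r) {2..n} \<longleftrightarrow> inj_on \<kappa> (?r ` {2..n})"
        by (rule comp_inj_on_iff[symmetric]) simp
      show "f \<kappa> * of_bool (inj_on \<kappa> {d + 1..d + n - 1} \<and> \<kappa> d \<notin> \<kappa> ` {d + 1..d + k} \<and>
          \<kappa> (d + n) \<notin> \<kappa> ` {d + 2..d + n - 1}) =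
          f \<kappa> * of_bool (proper (snd (STP (n + 1) k)) (\<kappa> \<circ> ?r))"
        by (simp only: proper_STP[OF assms] inj image_comp[symmetric] im o_apply)
    qed (simp add: size[simplified])
  qed
  show "appendable_e_positive (reverse_graph (STP (n + 1) k))"
  proof (rule appendable_e_positiveI[OF labelled_reverse_graph[OF lg]])
    fix d f
    assume d: "1 \<le> d" and f: "ubc_nonneg d f"
    show "ubc_nonneg (d + fst (reverse_graph (STP (n + 1) k)) - 1)
        (\<lambda>\<kappa>. f \<kappa> * of_bool (proper (snd (reverse_graph (STP (n + 1) k))) (\<kappa> \<circ> (\<lambda>i. d - 1 + i))))"
    proof (rule ubc_nonneg_cong[OF ubc_nonneg_append_reverse_STP[OF assms d f]])
      fix \<kappa> :: "nat \<Rightarrow> nat"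
      let ?r = "(\<lambda>i. d - 1 + i) \<circ> (\<lambda>i. fst (STP (n + 1) k) + 1 - i)"
      have im: "?r ` {2..n} = {d + 1..d + n - 1}" "?r ` {2..k + 1} = {d + n - k..d + n - 1}"
        "?r ` {3..n} = {d + 1..d + n - 2}" "?r 1 = d + n" "?r (n + 1) = d"
      proof -
        have q: "(\<lambda>i. n + 1 + 1 - i) ` {2..n} = {2..n}"
          "(\<lambda>i. n + 1 + 1 - i) ` {2..k + 1} = {n + 1 - k..n}"
          "(\<lambda>i. n + 1 + 1 - i) ` {3..n} = {2..n - 1}"
          using assms image_diff_atLeastAtMost[of 2 n "n + 1 + 1"]
            image_diff_atLeastAtMost[of 2 "k + 1" "n + 1 + 1"] image_diff_atLeastAtMost[of 3 n "n + 1 + 1"]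
          by auto
        show "?r ` {2..n} = {d + 1..d + n - 1}" "?r ` {2..k + 1} = {d + n - k..d + n - 1}"
          "?r ` {3..n} = {d + 1..d + n - 2}" "?r 1 = d + n" "?r (n + 1) = d"
          unfolding size image_comp[symmetric] q image_add_atLeastAtMost
          using d assms by auto
      qed
      have "inj_on ?r {2..n}" unfolding size by (auto simp: inj_on_def)
      then have inj: "inj_on (\<kappa> \<circ> ?r) {2..n} \<longleftrightarrow> inj_on \<kappa> (?r ` {2..n})"
        by (rule comp_inj_on_iff[symmetric])
      have "proper (snd (reverse_graph (STP (n + 1) k))) (\<kappa> \<circ> (\<lambda>i. d - 1 + i)) \<longleftrightarrow>
          proper (snd (STP (n + 1) k)) (\<kappa> \<circ> ?r)"
        unfolding reverse_graph_def snd_conv proper_image[OF lg] comp_assoc ..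
      also have "\<dots> \<longleftrightarrow> inj_on \<kappa> {d + 1..d + n - 1} \<and>
          \<kappa> (d + n) \<notin> \<kappa> ` {d + n - k..d + n - 1} \<and> \<kappa> d \<notin> \<kappa> ` {d + 1..d + n - 2}"
        unfolding proper_STP[OF assms] inj image_comp[symmetric, of \<kappa> ?r] im comp_apply[of \<kappa> ?r] ..
      finally show "f \<kappa> * of_bool (inj_on \<kappa> {d + 1..d + n - 1} \<and>
          \<kappa> (d + n) \<notin> \<kappa> ` {d + n - k..d + n - 1} \<and> \<kappa> d \<notin> \<kappa> ` {d + 1..d + n - 2}) =
          f \<kappa> * of_bool (proper (snd (reverse_graph (STP (n + 1) k))) (\<kappa> \<circ> (\<lambda>i. d - 1 + i)))"
        by (simp only:)
    qed (simp add: size[simplified] reverse_graph_def)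
  qed
qed

end
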